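(* Let $(J^s)_{s\in(1/2,1)}$ satisfy Hypothesis (H1) below with constant $\delta>0$. For $\varepsilon\in(0,1]$ and $s\in(1/2,1)$ let $F^s_\varepsilon$ be the probability equilibrium of $\partial_tu=\varepsilon^{-2s}(J^s_\varepsilon*u-u)+\mathrm{div}(xu)$ and let $F^s$ be the equilibrium of $\partial_tv=-(-\Delta)^sv+\mathrm{div}(xv)$, i.e. $\widehat{F^s}(\xi)=e^{-|\xi|^{2s}/(2s)}$. Let $0\le k<m<1$ and $\theta=\frac{m-k}{m+d/2}$. Then there exists a constant $C$ independent of $s$ (and of $\varepsilon$) such that $$\|F^s_\varepsilon-F^s\|_{L^1_k}\le C\varepsilon^{\theta\delta}.$$
   Context: $\langle x\rangle=(1+|x|^2)^{1/2}$; $\|f\|_{L^1_k}=\int\langle x\rangle^k|f|$; $(-\Delta)^s$ the Fourier multiplier with symbol $|\xi|^{2s}$; $\hat f(\xi)=\int e^{-ix\cdot\xi}f$; $J^s_\varepsilon(x)=\varepsilon^{-d}J^s(x/\varepsilon)$. An equilibrium is a probability density solving the stationary equation weakly. Hypothesis (H1): $(J^s)_{s\in(1/2,1)}$ is a family of probability densities on $\mathbb{R}^d$ with $J^s\in L^1\cap L^p$ for some $p\in(1,\infty]$, such that (i) $\int\min\{1,|y|^2\}J^s<\infty$; (ii) there exist $\delta,C_0>0$ independent of $s$ with $\hat J^s(\xi)=1-|\xi|^{2s}+R_s(\xi)$, $|R_s(\xi)|\le C_0|\xi|^{2s+\delta}$ for $|\xi|\le1$; (iii) there exist $C,R>0$,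 $\Psi$ with $\int(1+|x|^2)|\Psi|<\infty$, $\int x\Psi=0$, independent of $s$, with $J^s(x)\le C(1-s)|x|^{-d-2s}+\Psi(x)$ for $|x|\ge R$. *)

theory Defs
  imports "HOL-Analysis.Analysis"
begin

definition prob_density :: "('a::euclidean_space \<Rightarrow> real) \<Rightarrow> bool" where
  "prob_density f \<longleftrightarrow> f \<in> borel_measurable lborel \<and> (\<forall>x. 0 \<le> f x)
      \<and> (\<integral>\<^sup>+ x. ennreal (f x) \<partial>lborel) = 1"

definition fourier :: "('a::euclidean_space \<Rightarrow> real) \<Rightarrow> 'a \<Rightarrow> complex" where
  "fourier f \<xi> = (\<integral> x. cis (- (x \<bullet> \<xi>)) * complex_of_real (f x) \<partial>lborel)"

fun Cn :: "nat \<Rightarrow> ('a::euclidean_space \<Rightarrow> real) \<Rightarrow> bool" where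
  "Cn 0 f = continuous_on UNIV f"
| "Cn (Suc n) f = (continuous_on UNIV f \<and> f differentiable_on UNIV \<and>
      (\<forall>i\<in>Basis. Cn n (\<lambda>x. frechet_derivative f (at x) i)))"

definition smooth :: "('a::euclidean_space \<Rightarrow> real) \<Rightarrow> bool" where
  "smooth f \<longleftrightarrow> (\<forall>n. Cn n f)"

definition test_fun :: "('a::euclidean_space \<Rightarrow> real) \<Rightarrow> bool" where
  "test_fun \<phi> \<longleftrightarrow> smooth \<phi> \<and> (\<exists>R. \<forall>x. R < norm x \<longrightarrow> \<phi> x = 0)"

definition rescale :: "real \<Rightarrow> ('a::euclidean_space \<Rightarrow> real) \<Rightarrow> 'a \<Rightarrow> real" where
  "rescale \<epsilon> J x = \<epsilon> powr (- real DIM('a)) * J (x /\<^sub>R \<epsilon>)"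

definition L1k_norm :: "real \<Rightarrow> ('a::euclidean_space \<Rightarrow> real) \<Rightarrow> ennreal" where
  "L1k_norm k f = (\<integral>\<^sup>+ x. ennreal ((1 + (norm x)\<^sup>2) powr (k / 2) * \<bar>f x\<bar>) \<partial>lborel)"

text \<open>F is a probability equilibrium (weak stationary solution) of
  d_t u = eps^(-2s) (J_eps * u - u) + div (x u):
  for every test function phi,
  integral F(y) [ eps^(-2s) (integral J_eps(z) phi(y+z) dz - phi(y)) - y . grad phi(y) ] dy = 0.\<close>
definition nonlocal_equilibrium ::
    "real \<Rightarrow> real \<Rightarrow> ('a::euclidean_space \<Rightarrow> real) \<Rightarrow> ('a \<Rightarrow> real) \<Rightarrow> bool" where
  "nonlocal_equilibrium \<epsilon> s J F \<longleftrightarrow> prob_density F \<and>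
     (\<forall>\<phi>. test_fun \<phi> \<longrightarrow>
        (\<integral> y. F y * (\<epsilon> powr (-2 * s) *
             ((\<integral> z. rescale \<epsilon> J z * \<phi> (y + z) \<partial>lborel) - \<phi> y)
           - frechet_derivative \<phi> (at y) y) \<partial>lborel) = 0)"

definition H1 :: "(real \<Rightarrow> 'a::euclidean_space \<Rightarrow> real) \<Rightarrow> real \<Rightarrow> bool" where
  "H1 J \<delta> \<longleftrightarrow> 0 < \<delta> \<and>
    (\<forall>s\<in>{1/2<..<1}. prob_density (J s) \<and>
        ((\<exists>p>1. integrable lborel (\<lambda>x. \<bar>J s x\<bar> powr p)) \<or>
         (\<exists>M. AE x in lborel. \<bar>J s x\<bar> \<le> M)) \<and>
        (\<integral>\<^sup>+ y. ennreal (min 1 ((norm y)\<^sup>2) * J s y) \<partial>lborel) < \<infinity>) \<and>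
    (\<exists>C0>0. \<forall>s\<in>{1/2<..<1}. \<forall>\<xi>::'a. norm \<xi> \<le> 1 \<longrightarrow>
        cmod (fourier (J s) \<xi> - complex_of_real (1 - norm \<xi> powr (2 * s)))
          \<le> C0 * norm \<xi> powr (2 * s + \<delta>)) \<and>
    (\<exists>C>0. \<exists>R>0. \<exists>\<Psi>::'a \<Rightarrow> real. \<Psi> \<in> borel_measurable lborel \<and>
        integrable lborel (\<lambda>x. (1 + (norm x)\<^sup>2) * \<bar>\<Psi> x\<bar>) \<and>
        (\<integral> x. \<Psi> x *\<^sub>R x \<partial>lborel) = 0 \<and>
        (\<forall>s\<in>{1/2<..<1}. \<forall>x. R \<le> norm x \<longrightarrow>
            J s x \<le> C * (1 - s) * norm x powr (- real DIM('a) - 2 * s) + \<Psi> x))"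

end

(* On the Fourier side the stationary equation is a linear ODE along rays, solved by
     Feps^(xi) = exp (eps^(-2s) int_0^1 (J^(eps rho xi) - 1) / rho drho).
   For |xi| <= r / eps the expansion of J^ at 0 gives
     |Feps^ - F^| <= C eps^delta |xi|^(2s + delta) exp (- |xi|^(2s) / (4s)).
   For larger |xi| one only needs that 1 - Re J^ has a positive logarithmic average on rays, uniformly in s;
   this follows from the expansion as well, since it prevents J from concentrating on a hyperplane.
   Hence ||Feps^ - F^||_2 <= C eps^delta for small eps.  Moreover 1 - Re Feps^(xi) <= C |xi| bounds the
   m-th moments for m < 1.  Splitting the weighted L1 norm at radius eps^(- delta / (m + d/2)), with
   Plancherel inside and the m-th moment outside, gives the rate. *)
theory Submission
  imports Defs "HOL-Probability.Probability" "HOL-Computational_Algebra.Polynomial" "HOL-Real_Asymp.Real_Asymp"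
begin

section \<open>Smooth functions and a compactly supported cutoff\<close>

text \<open>A priori \<open>Feps\<close> is only a probability density, with no moment and no square
  integrability, and this shapes the argument. The drift acting on a plane wave is unbounded in y,
  so plane waves are replaced by averages of cosines over a segment of a ray. The resulting equation
  lives on [a, 1] with a > 0, because its coefficient carries the factor 1/\<rho>; only the solved
  exponent is sent to a = 0. Plancherel enters as a one-sided inequality, by duality against
  continuous functions of compact support. The logarithmic average has a price: beyond |\<xi>| =
  r/\<epsilon> the bound decays only like a negative power of \<epsilon> |\<xi>| / r, with exponent
  proportional to \<epsilon>^(-2s). It exceeds d only for \<epsilon> below a threshold
  \<open>\<epsilon>0\<close>; above it the rate is trivial, since the moments are bounded uniformly.
  Constants stay free of s because 1 < 2s < 2 confines every power that occurs. The radius of the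
  splitting is the one at which the ball term R^(k + d/2) \<epsilon>^\<delta> equals the tail term
  R^(k - m).\<close>

lemma Cn_imp_continuous: "Cn n f \<Longrightarrow> continuous_on UNIV f"
  by (cases n) auto

lemma Cn_SucD: "Cn (Suc n) f \<Longrightarrow> Cn n f"
proof (induction n arbitrary: f)
  case (Suc n)
  then show ?case unfolding Cn.simps(2)[of "Suc n"] Cn.simps(2)[of n] by blast
qed auto

text \<open>\<open>Cn\<close> refers to \<open>frechet_derivative\<close>, which is a choice;
  uniqueness of derivatives lets any explicit derivative \<open>f'\<close> stand in for it.\<close>

lemma Cn_SucI:
  fixes f :: "'a::euclidean_space \<Rightarrow> real"
  assumes "\<And>x. (f has_derivative f' x) (at x)"
    and "\<And>i. i \<in> Basis \<Longrightarrow> Cn n (\<lambda>x. f' x i)"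
  shows "Cn (Suc n) f"
proof -
  have "frechet_derivative f (at x) = f' x" for x
    using frechet_derivative_at[OF assms(1)] by simp
  moreover have "f differentiable_on UNIV"
    using assms(1) by (auto simp: differentiable_on_def differentiable_def)
  ultimately show ?thesis
    using assms(2) by (auto intro: differentiable_imp_continuous_on)
qed

lemma Cn_const: "Cn n (\<lambda>x. c)"
proof (induction n arbitrary: c)
  case (Suc n)
  show ?case by (rule Cn_SucI[where f' = "\<lambda>x h. 0"]) (use Suc in auto)
qed auto

lemma Cn_SucE:
  fixes f :: "'a::euclidean_space \<Rightarrow> real"
  assumes "Cn (Suc n) f"
  shows "(f has_derivative frechet_derivative f (at x)) (at x)"
  using assms by (auto simp: differentiable_on_def frechet_derivative_works)

lemma Cn_add:
  fixes f g :: "'a::euclidean_space \<Rightarrow> real"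
  shows "Cn n f \<Longrightarrow> Cn n g \<Longrightarrow> Cn n (\<lambda>x. f x + g x)"
proof (induction n arbitrary: f g)
  case (Suc n)
  show ?case
    by (rule Cn_SucI, rule has_derivative_add[OF Cn_SucE[OF Suc.prems(1)] Cn_SucE[OF Suc.prems(2)]])
       (use Suc in auto)
qed (auto intro!: continuous_intros)

lemma Cn_mult:
  fixes f g :: "'a::euclidean_space \<Rightarrow> real"
  shows "Cn n f \<Longrightarrow> Cn n g \<Longrightarrow> Cn n (\<lambda>x. f x * g x)"
proof (induction n arbitrary: f g)
  case (Suc n)
  show ?case
  proof (rule Cn_SucI, rule has_derivative_mult[OF Cn_SucE[OF Suc.prems(1)] Cn_SucE[OF Suc.prems(2)]])
    fix i :: 'a assume "i \<in> Basis"
    with Suc.prems have "Cn n (\<lambda>x. frechet_derivative f (at x) i)" "Cn n (\<lambda>x. frechet_derivative g (at x) i)"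
      by auto
    with Suc.IH Cn_SucD[OF Suc.prems(1)] Cn_SucD[OF Suc.prems(2)]
    show "Cn n (\<lambda>x. f x * frechet_derivative g (at x) i + frechet_derivative f (at x) i * g x)"
      by (intro Cn_add) auto
  qed
qed (auto intro!: continuous_intros)

text \<open>Differentiating \<open>g k\<close> along \<open>u\<close> produces
  \<open>g (Suc k)\<close>, so the outer function has to come as a whole sequence of successive
  derivatives, and the induction runs over all \<open>k\<close> at once. Both the flat functions and
  the oscillatory integrals arrive in this form.\<close>

lemma Cn_compose_real:
  fixes u :: "'a::euclidean_space \<Rightarrow> real" and g :: "nat \<Rightarrow> real \<Rightarrow> real"
  assumes g: "\<And>k t. (g k has_real_derivative g (Suc k) t) (at t)" and u: "\<And>n. Cn n u"
  shows "Cn n (\<lambda>x. g k (u x))"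
proof (induction n arbitrary: k)
  case 0
  have "continuous_on UNIV (g k)"
    using g by (meson DERIV_isCont continuous_at_imp_continuous_on)
  with u[of 0] show ?case
    by (auto intro: continuous_on_compose2)
next
  case (Suc n)
  show ?case
  proof (rule Cn_SucI)
    fix x
    have "(g k has_derivative (\<lambda>h. h * g (Suc k) (u x))) (at (u x))"
      using g[of k "u x"] by (simp add: has_field_derivative_def mult_commute_abs)
    from has_derivative_compose[OF Cn_SucE[OF u[of "Suc 0"]] this]
    show "((\<lambda>x. g k (u x)) has_derivative (\<lambda>h. frechet_derivative u (at x) h * g (Suc k) (u x))) (at x)" .
  next
    fix i :: 'a assume "i \<in> Basis"
    then show "Cn n (\<lambda>x. frechet_derivative u (at x) i * g (Suc k) (u x))"
      using u[of "Suc n"] Suc.IH by (auto intro: Cn_mult)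
  qed
qed

lemma Cn_inner: "Cn n (\<lambda>x::'a::euclidean_space. x \<bullet> w)"
proof (cases n)
  case (Suc m)
  show ?thesis unfolding Suc
    by (rule Cn_SucI[where f' = "\<lambda>x h. h \<bullet> w"]) (auto intro!: derivative_eq_intros Cn_const)
qed (auto intro!: continuous_intros)

lemma Cn_norm_square: "Cn n (\<lambda>x::'a::euclidean_space. (norm x)\<^sup>2)"
proof (cases n)
  case (Suc m)
  have "Cn m (\<lambda>x::'a. 2 * (x \<bullet> i))" for i by (intro Cn_mult Cn_const Cn_inner)
  then show ?thesis unfolding Suc
    by (intro Cn_SucI[where f' = "\<lambda>x h. 2 * (x \<bullet> h)"])
       (auto intro!: derivative_eq_intros simp: power2_norm_eq_inner inner_commute)
qed (auto intro!: continuous_intros)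

section \<open>The flat functions p(1/t) exp(-1/t) and the cutoff built from them\<close>

text \<open>This family is closed under differentiation, so all its members are smooth.\<close>

definition flat_fun :: "real poly \<Rightarrow> real \<Rightarrow> real" where
  "flat_fun p t = (if t > 0 then poly p (1 / t) * exp (- (1 / t)) else 0)"

text \<open>With u = 1/t one has du/dt = -u^2, so p(u) exp(-u) has t-derivative u^2 (p - p')(u)
  exp(-u); the factor \<open>[:0, 0, 1:]\<close> is u^2.\<close>

definition flat_deriv :: "real poly \<Rightarrow> real poly" where
  "flat_deriv p = [:0, 0, 1:] * (p - pderiv p)"

lemma poly_times_exp_minus_tendsto: "((\<lambda>u::real. poly p u * exp (- u)) \<longlongrightarrow> 0) at_top"
proof (induction p)
  case (pCons a p)
  have *: "poly q u * exp (- u) = (\<Sum>i\<le>degree q. coeff q i * (u ^ i / exp u))" for q and u :: real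
    by (simp add: poly_altdef sum_distrib_right exp_minus divide_inverse mult.assoc)
  have "((\<lambda>u. \<Sum>i\<le>degree (pCons a p). coeff (pCons a p) i * (u ^ i / exp u)) \<longlongrightarrow> (\<Sum>i\<le>degree (pCons a p). coeff (pCons a p) i * 0)) at_top"
    by (intro tendsto_sum tendsto_mult tendsto_const tendsto_power_div_exp_0)
  then show ?case unfolding * by simp
qed simp

lemma flat_fun_has_derivative: "(flat_fun p has_real_derivative flat_fun (flat_deriv p) t) (at t)"
proof -
  consider "t > 0" | "t < 0" | "t = 0" by linarith
  then show ?thesis
  proof cases
    case 1
    have "((\<lambda>t. poly p (1 / t) * exp (- (1 / t))) has_real_derivative flat_fun (flat_deriv p) t) (at t)"
    proof -
      have i: "((\<lambda>t. 1 / t) has_real_derivative - (1 / t)\<^sup>2) (at t)"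
        using 1 by (auto intro!: derivative_eq_intros simp: power2_eq_square field_simps)
      show ?thesis
        by (rule DERIV_cong, rule DERIV_mult[OF DERIV_chain2[OF poly_DERIV i] DERIV_chain2[OF DERIV_exp DERIV_minus[OF i]]])
           (use 1 in \<open>simp add: flat_fun_def flat_deriv_def algebra_simps power2_eq_square\<close>)
    qed
    moreover have "eventually (\<lambda>x. flat_fun p x = poly p (1 / x) * exp (- (1 / x))) (nhds t)"
      using eventually_nhds_in_open[of "{0<..}" t] 1 by (auto elim!: eventually_mono simp: flat_fun_def)
    ultimately show ?thesis by (simp add: DERIV_cong_ev[OF refl _ refl])
  next
    case 2
    have "eventually (\<lambda>x. flat_fun p x = 0) (nhds t)"
      using eventually_nhds_in_open[of "{..<0}" t] 2 by (auto elim!: eventually_mono simp: flat_fun_def)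
    moreover have "((\<lambda>x. 0) has_real_derivative 0) (at t)" by simp
    ultimately show ?thesis using 2 by (simp add: DERIV_cong_ev[OF refl _ refl] flat_fun_def[of _ t])
  next
    case 3
    \<comment> \<open>At 0 the right difference quotient is again of the form q(1/h) exp(-1/h), now
      with q = X p, so polynomial growth loses against the exponential.\<close>
    have "((\<lambda>h. flat_fun p h / h) \<longlongrightarrow> 0) (at_right 0)"
    proof -
      have "((\<lambda>h. poly ([:0,1:] * p) (inverse h) * exp (- inverse h)) \<longlongrightarrow> 0) (at_right 0)"
        by (rule filterlim_compose[OF poly_times_exp_minus_tendsto filterlim_inverse_at_top_right])
      then show ?thesis
        by (rule tendsto_cong[THEN iffD1, rotated])
           (auto simp: eventually_at_filter flat_fun_def field_simps)
    qed
    moreover have "((\<lambda>h. flat_fun p h / h) \<longlongrightarrow> 0) (at_left 0)"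
      by (rule tendsto_cong[THEN iffD1, OF _ tendsto_const])
         (auto simp: eventually_at_filter flat_fun_def)
    ultimately have "((\<lambda>h. flat_fun p h / h) \<longlongrightarrow> 0) (at 0)"
      by (simp add: filterlim_split_at)
    then show ?thesis using 3 by (simp add: DERIV_def flat_fun_def)
  qed
qed

text \<open>The squared norm keeps the function smooth at the origin, and the factor
  \<open>exp 1\<close> makes its value there 1.\<close>

definition cutoff :: "'a::euclidean_space \<Rightarrow> real" where
  "cutoff x = exp 1 * flat_fun 1 (1 - (norm x)\<^sup>2)"

lemma smooth_cutoff: "smooth (\<lambda>x. cutoff (x /\<^sub>R r))"
proof -
  have g: "(flat_fun ((flat_deriv ^^ k) 1) has_real_derivative flat_fun ((flat_deriv ^^ Suc k) 1) t) (at t)" for k t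
    using flat_fun_has_derivative by simp
  have u: "Cn n (\<lambda>x::'a. 1 + (- (inverse r)\<^sup>2) * (norm x)\<^sup>2)" for n
    by (intro Cn_add Cn_mult Cn_const Cn_norm_square)
  have "Cn n (\<lambda>x::'a. exp 1 * flat_fun ((flat_deriv ^^ 0) 1) (1 + (- (inverse r)\<^sup>2) * (norm x)\<^sup>2))" for n
    by (rule Cn_mult[OF Cn_const Cn_compose_real[where g = "\<lambda>k. flat_fun ((flat_deriv ^^ k) 1)", OF g u]])
  moreover have "(\<lambda>x::'a. exp 1 * flat_fun ((flat_deriv ^^ 0) 1) (1 + (- (inverse r)\<^sup>2) * (norm x)\<^sup>2)) = (\<lambda>x. cutoff (x /\<^sub>R r))"
    by (simp add: cutoff_def power_mult_distrib power_inverse)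
  ultimately show ?thesis by (simp add: smooth_def)
qed

lemma cutoff_bounds: "0 \<le> cutoff x" "cutoff x \<le> 1"
proof -
  show "0 \<le> cutoff x" by (simp add: cutoff_def flat_fun_def)
  show "cutoff x \<le> 1"
  proof (cases "1 - (norm x)\<^sup>2 > 0")
    case True
    then have "1 / (1 - (norm x)\<^sup>2) \<ge> 1" by simp
    then have "exp 1 * exp (- (1 / (1 - (norm x)\<^sup>2))) \<le> 1"
      by (simp add: exp_add[symmetric])
    with True show ?thesis by (simp add: cutoff_def flat_fun_def)
  qed (simp add: cutoff_def flat_fun_def)
qed

lemma cutoff_eq_0: "norm x \<ge> 1 \<Longrightarrow> cutoff x = 0"
  by (simp add: cutoff_def flat_fun_def not_less)

lemma cutoff_0: "cutoff 0 = 1"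
  by (simp add: cutoff_def flat_fun_def exp_add[symmetric])

text \<open>This is x . grad applied to \<open>cutoff\<close>. The operator x . grad commutes with
  dilations, so the cutoff at scale r yields the same bounded function evaluated at x / r: the drift
  acting on the cutoff stays bounded as r grows and tends to 0 pointwise.\<close>

definition cutoff_radial :: "'a::euclidean_space \<Rightarrow> real" where
  "cutoff_radial x = - exp 1 * flat_fun (flat_deriv 1) (1 - (norm x)\<^sup>2) * (2 * (norm x)\<^sup>2)"

lemma cutoff_has_derivative:
  fixes x :: "'a::euclidean_space"
  shows "((\<lambda>x. cutoff (x /\<^sub>R r)) has_derivative
    (\<lambda>h. - exp 1 * flat_fun (flat_deriv 1) (1 - (norm (x /\<^sub>R r))\<^sup>2) * (2 * ((x /\<^sub>R r) \<bullet> (h /\<^sub>R r))))) (at x)"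
proof -
  have u: "((\<lambda>x::'a. 1 - (norm (x /\<^sub>R r))\<^sup>2) has_derivative (\<lambda>h. - (2 * ((x /\<^sub>R r) \<bullet> (h /\<^sub>R r))))) (at x)"
    unfolding power2_norm_eq_inner by (auto intro!: derivative_eq_intros simp: inner_commute)
  have g: "(flat_fun 1 has_derivative (\<lambda>h. h * flat_fun (flat_deriv 1) (1 - (norm (x /\<^sub>R r))\<^sup>2))) (at (1 - (norm (x /\<^sub>R r))\<^sup>2))"
    using flat_fun_has_derivative[of 1 "1 - (norm (x /\<^sub>R r))\<^sup>2"]
    by (simp add: has_field_derivative_def mult_commute_abs)
  show ?thesis unfolding cutoff_def
    using has_derivative_mult_right[OF has_derivative_compose[OF u g], of "exp 1"]
    by (simp add: algebra_simps)
qed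

lemma cutoff_radial: "frechet_derivative (\<lambda>x. cutoff (x /\<^sub>R r)) (at x) x = cutoff_radial (x /\<^sub>R r)"
  by (subst frechet_derivative_at[OF cutoff_has_derivative, symmetric])
     (simp add: cutoff_radial_def dot_square_norm[symmetric] del: inner_scaleR_left inner_scaleR_right norm_scaleR)

lemma continuous_flat_fun: "continuous_on UNIV (flat_fun p)"
  using flat_fun_has_derivative by (meson DERIV_isCont continuous_at_imp_continuous_on)

lemma continuous_cutoff: "continuous_on UNIV (cutoff :: 'a::euclidean_space \<Rightarrow> real)"
  unfolding cutoff_def
  by (intro continuous_intros continuous_on_compose2[OF continuous_flat_fun]) auto

lemma continuous_cutoff_radial: "continuous_on UNIV (cutoff_radial :: 'a::euclidean_space \<Rightarrow> real)"
  unfolding cutoff_radial_def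
  by (intro continuous_intros continuous_on_compose2[OF continuous_flat_fun]) auto

lemma cutoff_radial_bounded: "\<exists>B. \<forall>x::'a::euclidean_space. \<bar>cutoff_radial x\<bar> \<le> B"
proof -
  have "bounded (cutoff_radial ` cball (0::'a) 1)"
    by (intro compact_imp_bounded compact_continuous_image continuous_on_subset[OF continuous_cutoff_radial]) auto
  then obtain B where B: "\<forall>x\<in>cball (0::'a) 1. \<bar>cutoff_radial x\<bar> \<le> B"
    by (auto simp: bounded_iff simp del: mem_cball_0)
  have "\<bar>cutoff_radial x\<bar> \<le> \<bar>B\<bar>" for x :: 'a
  proof (cases "norm x \<le> 1")
    case True then show ?thesis using order_trans[OF bspec[OF B] abs_ge_self, of x] by simp
  next
    case False
    then have "1 \<le> (norm x)\<^sup>2" by (intro one_le_power) auto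
    then show ?thesis by (simp add: cutoff_radial_def flat_fun_def)
  qed
  then show ?thesis by blast
qed

section \<open>The weak equation for bounded test functions\<close>

lemma prob_densityD:
  assumes "prob_density f"
  shows "f \<in> borel_measurable borel" "0 \<le> f x" "integrable lborel f" "(\<integral>x. f x \<partial>lborel) = 1"
proof -
  show "f \<in> borel_measurable borel" "0 \<le> f x"
    using assms by (auto simp: prob_density_def)
  have *: "has_bochner_integral lborel f 1"
    using assms by (intro has_bochner_integral_nn_integral) (auto simp: prob_density_def)
  then show "integrable lborel f" "(\<integral>x. f x \<partial>lborel) = 1"
    by (auto simp: has_bochner_integral_iff)
qed

lemma lborel_integral_affine:
  fixes f :: "'a::euclidean_space \<Rightarrow> 'b::{banach, second_countable_topology}"
  assumes [measurable]: "f \<in> borel_measurable borel" and c: "c \<noteq> 0"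
  shows "(\<integral>x. f x \<partial>lborel) = \<bar>c\<bar> ^ DIM('a) *\<^sub>R (\<integral>x. f (t + c *\<^sub>R x) \<partial>lborel)"
  by (subst lborel_affine[OF c, of t], subst integral_density) (auto simp: integral_distr)

text \<open>Moves the scale from the kernel to the jump, so that the transform of \<open>J\<close>
  itself appears later, at frequency \<epsilon> \<xi>.\<close>

lemma integral_rescale:
  fixes J \<phi> :: "'a::euclidean_space \<Rightarrow> real"
  assumes [measurable]: "J \<in> borel_measurable borel" "\<phi> \<in> borel_measurable borel" and "\<epsilon> > 0"
  shows "(\<integral>z. rescale \<epsilon> J z * \<phi> (y + z) \<partial>lborel) = (\<integral>z. J z * \<phi> (y + \<epsilon> *\<^sub>R z) \<partial>lborel)"
proof -
  have "(\<integral>z. rescale \<epsilon> J z * \<phi> (y + z) \<partial>lborel)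
      = \<bar>\<epsilon>\<bar> ^ DIM('a) *\<^sub>R (\<integral>z. rescale \<epsilon> J (0 + \<epsilon> *\<^sub>R z) * \<phi> (y + (0 + \<epsilon> *\<^sub>R z)) \<partial>lborel)"
    unfolding rescale_def using \<open>\<epsilon> > 0\<close> by (intro lborel_integral_affine) auto
  also have "\<dots> = (\<integral>z. \<bar>\<epsilon>\<bar> ^ DIM('a) * (rescale \<epsilon> J (0 + \<epsilon> *\<^sub>R z) * \<phi> (y + (0 + \<epsilon> *\<^sub>R z))) \<partial>lborel)"
    by simp
  also have "\<dots> = (\<integral>z. J z * \<phi> (y + \<epsilon> *\<^sub>R z) \<partial>lborel)"
  proof (rule Bochner_Integration.integral_cong[OF refl])
    fix z :: 'a
    have "\<epsilon> ^ DIM('a) * \<epsilon> powr (- real DIM('a)) = 1"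
      using \<open>\<epsilon> > 0\<close> by (simp add: powr_minus powr_realpow)
    then show "\<bar>\<epsilon>\<bar> ^ DIM('a) * (rescale \<epsilon> J (0 + \<epsilon> *\<^sub>R z) * \<phi> (y + (0 + \<epsilon> *\<^sub>R z))) = J z * \<phi> (y + \<epsilon> *\<^sub>R z)"
      using \<open>\<epsilon> > 0\<close> by (simp add: rescale_def)
  qed
  finally show ?thesis .
qed

text \<open>Multiply \<Phi> by cutoffs at scale n + 1 and let n grow. The radial derivative of the
  product is \<kappa> D + \<rho> \<Phi>, where \<kappa> tends to 1 and \<rho> to 0 boundedly, so
  every term is dominated by a constant multiple of \<open>F\<close> and its total mass suffices.
  This is why the bound is imposed on y . grad \<Phi> as a whole.\<close>

lemma nonlocal_equilibrium_bounded_test: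
  fixes J F \<Phi> D :: "'a::euclidean_space \<Rightarrow> real"
  assumes eq: "nonlocal_equilibrium \<epsilon> s J F" and \<epsilon>: "0 < \<epsilon>" and J: "prob_density J"
    and \<Phi>: "smooth \<Phi>" "\<And>x. \<bar>\<Phi> x\<bar> \<le> B"
    and D: "continuous_on UNIV D" "\<And>x. frechet_derivative \<Phi> (at x) x = D x" "\<And>x. \<bar>D x\<bar> \<le> B'"
  shows "(\<integral>y. F y * (\<epsilon> powr (-2 * s) * ((\<integral>z. J z * \<Phi> (y + \<epsilon> *\<^sub>R z) \<partial>lborel) - \<Phi> y) - D y) \<partial>lborel) = 0"
proof -
  have F: "prob_density F" using eq by (simp add: nonlocal_equilibrium_def)
  note [measurable] = prob_densityD(1)[OF F] prob_densityD(1)[OF J]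
  have cont\<Phi>: "continuous_on UNIV \<Phi>" using \<Phi>(1) Cn_imp_continuous by (auto simp: smooth_def)
  have [measurable]: "\<Phi> \<in> borel_measurable borel" "D \<in> borel_measurable borel"
    "(cutoff :: 'a \<Rightarrow> real) \<in> borel_measurable borel" "(cutoff_radial :: 'a \<Rightarrow> real) \<in> borel_measurable borel"
    using cont\<Phi> D(1) continuous_cutoff continuous_cutoff_radial by (auto intro: borel_measurable_continuous_onI)
  define \<kappa> where "\<kappa> n = (\<lambda>x::'a. cutoff (x /\<^sub>R real (Suc n)))" for n
  define \<rho> where "\<rho> n = (\<lambda>x::'a. cutoff_radial (x /\<^sub>R real (Suc n)))" for n
  define \<phi> where "\<phi> n = (\<lambda>x. \<kappa> n x * \<Phi> x)" for n
  have [measurable]: "\<kappa> n \<in> borel_measurable borel" "\<rho> n \<in> borel_measurable borel" for n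
    unfolding \<kappa>_def \<rho>_def by measurable
  obtain B0 where B0: "\<And>x::'a. \<bar>cutoff_radial x\<bar> \<le> B0" using cutoff_radial_bounded by blast
  have nn: "0 \<le> B" "0 \<le> B'" "0 \<le> B0"
    using \<Phi>(2)[of 0] D(3)[of 0] B0[of 0] by linarith+
  have \<kappa>b: "\<bar>\<kappa> n x\<bar> \<le> 1" for n x
    using cutoff_bounds[of "x /\<^sub>R real (Suc n)"] by (simp add: \<kappa>_def)
  have \<rho>b: "\<bar>\<rho> n x\<bar> \<le> B0" for n x
    using B0 by (simp add: \<rho>_def)
  have \<phi>b: "\<bar>\<phi> n x\<bar> \<le> B" for n x
    using mult_mono[OF \<kappa>b[of n x] \<Phi>(2)[of x]] by (simp add: \<phi>_def abs_mult)
  have tend0: "(\<lambda>n. x /\<^sub>R real (Suc n)) \<longlonglongrightarrow> 0" for x :: 'a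
    using tendsto_scaleR[OF LIMSEQ_inverse_real_of_nat tendsto_const, of x] by simp
  have isC: "isCont (cutoff :: 'a \<Rightarrow> real) 0" "isCont (cutoff_radial :: 'a \<Rightarrow> real) 0"
    using continuous_cutoff continuous_cutoff_radial by (auto simp only: continuous_on_eq_continuous_at[OF open_UNIV])
  have \<kappa>lim: "(\<lambda>n. \<kappa> n x) \<longlonglongrightarrow> 1" for x
    using isCont_tendsto_compose[OF isC(1) tend0[of x]] by (simp only: \<kappa>_def cutoff_0)
  have \<rho>lim: "(\<lambda>n. \<rho> n x) \<longlonglongrightarrow> 0" for x
    using isCont_tendsto_compose[OF isC(2) tend0[of x]] by (simp add: \<rho>_def cutoff_radial_def[of "0::'a"])
  have \<phi>lim: "(\<lambda>n. \<phi> n x) \<longlonglongrightarrow> \<Phi> x" for x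
    using tendsto_mult[OF \<kappa>lim tendsto_const, of x "\<Phi> x"] by (simp add: \<phi>_def)
  have [measurable]: "\<phi> n \<in> borel_measurable borel" for n
    unfolding \<phi>_def by measurable
  have deriv: "frechet_derivative (\<phi> n) (at y) y = \<kappa> n y * D y + \<rho> n y * \<Phi> y" for n y
  proof -
    have 1: "(\<kappa> n has_derivative frechet_derivative (\<kappa> n) (at y)) (at y)"
      unfolding \<kappa>_def using cutoff_has_derivative frechet_derivative_works differentiable_def by blast
    have 2: "(\<Phi> has_derivative frechet_derivative \<Phi> (at y)) (at y)"
      using \<Phi>(1) Cn_SucE[of 0 \<Phi> y] unfolding smooth_def by blast
    have "frechet_derivative (\<phi> n) (at y) y = \<kappa> n y * frechet_derivative \<Phi> (at y) y + frechet_derivative (\<kappa> n) (at y) y * \<Phi> y"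
      unfolding \<phi>_def by (subst frechet_derivative_at[OF has_derivative_mult[OF 1 2], symmetric]) simp
    then show ?thesis unfolding D(2) \<kappa>_def \<rho>_def cutoff_radial .
  qed
  have test: "test_fun (\<phi> n)" for n
    unfolding test_fun_def
  proof
    show "smooth (\<phi> n)"
      using \<Phi>(1) smooth_cutoff[of "real (Suc n)"] unfolding smooth_def \<phi>_def \<kappa>_def by (auto intro: Cn_mult)
    have "\<phi> n x = 0" if "real (Suc n) < norm x" for x
    proof -
      have "1 \<le> norm (x /\<^sub>R real (Suc n))" using that by (simp add: field_simps)
      then show ?thesis by (simp add: \<phi>_def \<kappa>_def cutoff_eq_0)
    qed
    then show "\<exists>R. \<forall>x. R < norm x \<longrightarrow> \<phi> n x = 0" by blast
  qed
  define S where "S n y = F y * (\<epsilon> powr (-2 * s) * ((\<integral>z. J z * \<phi> n (y + \<epsilon> *\<^sub>R z) \<partial>lborel) - \<phi> n y)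
      - (\<kappa> n y * D y + \<rho> n y * \<Phi> y))" for n y
  have S0: "(\<integral>y. S n y \<partial>lborel) = 0" for n
  proof -
    have "(\<integral>y. F y * (\<epsilon> powr (-2 * s) * ((\<integral>z. rescale \<epsilon> J z * \<phi> n (y + z) \<partial>lborel) - \<phi> n y)
           - frechet_derivative (\<phi> n) (at y) y) \<partial>lborel) = 0"
      using eq test[of n] unfolding nonlocal_equilibrium_def by blast
    moreover have "(\<integral>z. rescale \<epsilon> J z * \<phi> n (y + z) \<partial>lborel) = (\<integral>z. J z * \<phi> n (y + \<epsilon> *\<^sub>R z) \<partial>lborel)" for y
      by (rule integral_rescale) (use \<epsilon> in auto)
    ultimately show ?thesis unfolding S_def deriv by simp
  qed
  have bound: "\<bar>\<integral>z. J z * h z \<partial>lborel\<bar> \<le> B" if "\<And>z. \<bar>h z\<bar> \<le> B" for h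
  proof -
    have "norm (\<integral>z. J z * h z \<partial>lborel) \<le> (\<integral>z. J z * B \<partial>lborel)"
    proof (cases "integrable lborel (\<lambda>z. J z * h z)")
      case True
      then show ?thesis
        using prob_densityD[OF J] that
        by (intro Bochner_Integration.integral_norm_bound_integral) (auto simp: abs_mult intro!: mult_left_mono)
    next
      \<comment> \<open>A non-integrable Bochner integral is 0 by convention, so the bound holds for
        arbitrary \<open>h\<close>.\<close>
      case False
      then show ?thesis using nn prob_densityD(4)[OF J] by (simp add: not_integrable_integral_eq)
    qed
    then show ?thesis using prob_densityD(4)[OF J] by simp
  qed
  have "(\<lambda>n. \<integral>y. S n y \<partial>lborel) \<longlonglongrightarrow>
     (\<integral>y. F y * (\<epsilon> powr (-2 * s) * ((\<integral>z. J z * \<Phi> (y + \<epsilon> *\<^sub>R z) \<partial>lborel) - \<Phi> y) - (1 * D y + 0 * \<Phi> y)) \<partial>lborel)"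
  proof (rule integral_dominated_convergence[where w = "\<lambda>y. F y * (\<epsilon> powr (-2 * s) * (B + B) + (B' + B0 * B))"])
    show "integrable lborel (\<lambda>y. F y * (\<epsilon> powr (-2 * s) * (B + B) + (B' + B0 * B)))"
      using prob_densityD(3)[OF F] by simp
    show "AE y in lborel. (\<lambda>n. S n y) \<longlonglongrightarrow>
       F y * (\<epsilon> powr (-2 * s) * ((\<integral>z. J z * \<Phi> (y + \<epsilon> *\<^sub>R z) \<partial>lborel) - \<Phi> y) - (1 * D y + 0 * \<Phi> y))"
    proof (rule AE_I2)
      fix y
      have "(\<lambda>n. \<integral>z. J z * \<phi> n (y + \<epsilon> *\<^sub>R z) \<partial>lborel) \<longlonglongrightarrow> (\<integral>z. J z * \<Phi> (y + \<epsilon> *\<^sub>R z) \<partial>lborel)"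
        by (rule integral_dominated_convergence[where w = "\<lambda>z. J z * B"])
           (use prob_densityD[OF J] \<phi>b in \<open>auto intro!: tendsto_intros \<phi>lim mult_left_mono simp: abs_mult\<close>)
      then show "(\<lambda>n. S n y) \<longlonglongrightarrow>
       F y * (\<epsilon> powr (-2 * s) * ((\<integral>z. J z * \<Phi> (y + \<epsilon> *\<^sub>R z) \<partial>lborel) - \<Phi> y) - (1 * D y + 0 * \<Phi> y))"
        unfolding S_def by (intro tendsto_intros \<phi>lim \<kappa>lim \<rho>lim)
    qed
    show "AE y in lborel. norm (S n y) \<le> F y * (\<epsilon> powr (-2 * s) * (B + B) + (B' + B0 * B))" for n
    proof (rule AE_I2)
      fix y
      have "\<bar>(\<integral>z. J z * \<phi> n (y + \<epsilon> *\<^sub>R z) \<partial>lborel) - \<phi> n y\<bar> \<le> B + B"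
        using bound[of "\<lambda>z. \<phi> n (y + \<epsilon> *\<^sub>R z)", OF \<phi>b] \<phi>b[of n y] by linarith
      then have 1: "\<bar>\<epsilon> powr (-2 * s) * ((\<integral>z. J z * \<phi> n (y + \<epsilon> *\<^sub>R z) \<partial>lborel) - \<phi> n y)\<bar> \<le> \<epsilon> powr (-2 * s) * (B + B)"
        unfolding abs_mult by (intro mult_mono) auto
      have 2: "\<bar>\<kappa> n y * D y + \<rho> n y * \<Phi> y\<bar> \<le> 1 * B' + B0 * B"
        using \<kappa>b[of n y] D(3)[of y] \<rho>b[of n y] \<Phi>(2)[of y] nn
        by (intro order_trans[OF abs_triangle_ineq] add_mono) (auto simp only: abs_mult intro!: mult_mono)
      show "norm (S n y) \<le> F y * (\<epsilon> powr (-2 * s) * (B + B) + (B' + B0 * B))"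
        unfolding S_def real_norm_def abs_mult[of "F y"] abs_of_nonneg[OF prob_densityD(2)[OF F]]
        using 1 2 by (intro mult_left_mono prob_densityD(2)[OF F]) linarith
    qed
  qed (unfold S_def, measurable)
  with S0 show ?thesis using LIMSEQ_unique[OF _ tendsto_const] by fastforce
qed

section \<open>The stationary equation on the Fourier side\<close>

lemma integrable_fourier_kernel:
  fixes f :: "'a::euclidean_space \<Rightarrow> real"
  assumes "integrable lborel f"
  shows "integrable lborel (\<lambda>x. cis (- (x \<bullet> \<xi>)) * complex_of_real (f x))"
proof (rule Bochner_Integration.integrable_bound[OF assms])
  show "(\<lambda>x. cis (- (x \<bullet> \<xi>)) * complex_of_real (f x)) \<in> borel_measurable lborel"
    using borel_measurable_integrable[OF assms] unfolding cis_conv_exp by measurable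
qed (auto simp: norm_mult)

lemma norm_fourier_le:
  fixes f :: "'a::euclidean_space \<Rightarrow> real"
  shows "norm (fourier f \<xi>) \<le> (\<integral>x. \<bar>f x\<bar> \<partial>lborel)"
  unfolding fourier_def by (rule order_trans[OF integral_norm_bound]) (simp add: norm_mult)

lemma norm_fourier_le_1: "prob_density f \<Longrightarrow> norm (fourier f \<xi>) \<le> 1"
  using norm_fourier_le[of f \<xi>] prob_densityD[of f] by simp

lemma fourier_0: "prob_density f \<Longrightarrow> fourier f 0 = 1"
  using prob_densityD[of f] by (simp add: fourier_def)

lemma fourier_diff:
  fixes f g :: "'a::euclidean_space \<Rightarrow> real"
  assumes "integrable lborel f" "integrable lborel g"
  shows "fourier (\<lambda>x. f x - g x) \<xi> = fourier f \<xi> - fourier g \<xi>"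
  unfolding fourier_def
  by (subst Bochner_Integration.integral_diff[OF integrable_fourier_kernel integrable_fourier_kernel, symmetric])
     (simp_all add: assms right_diff_distrib)

lemma continuous_on_fourier:
  fixes f :: "'a::euclidean_space \<Rightarrow> real"
  assumes f: "integrable lborel f"
  shows "continuous_on UNIV (fourier f)"
proof -
  have "isCont (fourier f) \<xi>" for \<xi>
    unfolding continuous_at_sequentially o_def
  proof (intro allI impI)
    fix X assume X: "X \<longlonglongrightarrow> \<xi>"
    note [measurable] = borel_measurable_integrable[OF f]
    show "(\<lambda>n. fourier f (X n)) \<longlonglongrightarrow> fourier f \<xi>"
      unfolding fourier_def
    proof (rule integral_dominated_convergence[where w = "\<lambda>x. \<bar>f x\<bar>"])
      show "AE x in lborel. (\<lambda>n. cis (- (x \<bullet> X n)) * complex_of_real (f x)) \<longlonglongrightarrow> cis (- (x \<bullet> \<xi>)) * complex_of_real (f x)"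
        unfolding cis_conv_exp by (intro AE_I2 tendsto_intros X)
    next
      fix n
      show "(\<lambda>x. cis (- (x \<bullet> \<xi>)) * complex_of_real (f x)) \<in> borel_measurable lborel"
        "(\<lambda>x. cis (- (x \<bullet> X n)) * complex_of_real (f x)) \<in> borel_measurable lborel"
        by (rule borel_measurable_integrable[OF integrable_fourier_kernel[OF f]])+
    qed (use f in \<open>simp_all add: norm_mult\<close>)
  qed
  then show ?thesis by (simp add: continuous_at_imp_continuous_on)
qed

text \<open>Test functions are real, so the equation only yields real parts. The complex weight
  \<open>w\<close> holds a phase, and later also a value of the symbol of \<open>J\<close>; varying
  the phase recovers the complex identity.\<close>

lemma Re_fourier:
  fixes f :: "'a::euclidean_space \<Rightarrow> real"
  assumes "integrable lborel f"
  shows "(\<integral>x. f x * Re (w * cis (- (x \<bullet> \<xi>))) \<partial>lborel) = Re (w * fourier f \<xi>)"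
proof -
  have "Re (w * fourier f \<xi>) = (\<integral>x. Re (w * (cis (- (x \<bullet> \<xi>)) * complex_of_real (f x))) \<partial>lborel)"
    unfolding fourier_def
    by (subst integral_mult_right_zero[symmetric], subst integral_Re)
       (auto intro!: integrable_mult_right integrable_fourier_kernel assms)
  also have "\<dots> = (\<integral>x. f x * Re (w * cis (- (x \<bullet> \<xi>))) \<partial>lborel)"
    by (intro Bochner_Integration.integral_cong) (auto simp: algebra_simps)
  finally show ?thesis by simp
qed

text \<open>Bridges two kinds of integral: space carries the Lebesgue integral, the ray variable the
  gauge integral, in which the Leibniz rule and the fundamental theorem are applied. Boundedness of
  \<open>h\<close> over the interval makes the product integrable, so Fubini applies.\<close>

lemma integral_swap_interval:
  fixes f :: "'a::euclidean_space \<Rightarrow> real" and h :: "'a \<Rightarrow> real \<Rightarrow> real"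
  assumes f: "integrable lborel f"
    and h[measurable]: "(\<lambda>(x, t). h x t) \<in> borel_measurable (borel \<Otimes>\<^sub>M borel)"
    and B: "\<And>x t. t \<in> {a..b} \<Longrightarrow> \<bar>h x t\<bar> \<le> B"
  shows "(\<integral>x. f x * integral {a..b} (h x) \<partial>lborel) = integral {a..b} (\<lambda>t. \<integral>x. f x * h x t \<partial>lborel)"
proof -
  note [measurable] = borel_measurable_integrable[OF f]
  have B': "\<bar>h x t\<bar> \<le> \<bar>B\<bar>" if "a \<le> t" "t \<le> b" for x t
    using B[of t x] that by auto
  define g where "g = (\<lambda>(x, t). f x * (indicator {a..b} t * h x t))"
  have hi: "set_integrable lborel {a..b} (h x)" for x
    unfolding set_integrable_def
  proof (rule Bochner_Integration.integrable_bound[where f = "\<lambda>t. indicator {a..b} t * B"])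
    show "AE t in lborel. norm (indicator {a..b} t *\<^sub>R h x t) \<le> norm (indicator {a..b} t * B)"
      using B' by (intro AE_I2) (auto simp: indicator_def)
    show "integrable lborel (\<lambda>t. indicator {a..b} t * B)"
      by (intro integrable_mult_left integrable_real_indicator) (auto simp: emeasure_lborel_Icc_eq)
  qed auto
  have gi: "integrable (lborel \<Otimes>\<^sub>M lborel) g"
  proof (rule Bochner_Integration.integrable_bound[where f = "\<lambda>(x, t). f x * (indicator {a..b} t * B)"])
    show "integrable (lborel \<Otimes>\<^sub>M lborel) (\<lambda>(x, t). f x * (indicator {a..b} t * B))"
      using f by (intro lborel_pair.Fubini_integrable)
        (auto simp: abs_mult emeasure_lborel_Icc_eq intro!: integrable_real_indicator)
    show "AE p in lborel \<Otimes>\<^sub>M lborel. norm (g p) \<le> norm (case p of (x, t) \<Rightarrow> f x * (indicator {a..b} t * B))"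
      using B' unfolding g_def
      by (intro AE_I2) (auto simp: abs_mult indicator_def intro!: mult_left_mono)
    show "g \<in> borel_measurable (lborel \<Otimes>\<^sub>M lborel)" unfolding g_def by measurable
  qed
  have "(\<integral>x. f x * integral {a..b} (h x) \<partial>lborel) = (\<integral>x. (\<integral>t. g (x, t) \<partial>lborel) \<partial>lborel)"
    using set_borel_integral_eq_integral(2)[OF hi] by (simp add: g_def set_lebesgue_integral_def)
  also have "\<dots> = (\<integral>t. (\<integral>x. g (x, t) \<partial>lborel) \<partial>lborel)"
    using lborel_pair.Fubini_integral[of "\<lambda>x t. g (x, t)"] gi by simp
  also have "\<dots> = (LINT t:{a..b}|lborel. (\<integral>x. f x * h x t \<partial>lborel))"
    unfolding set_lebesgue_integral_def g_def by (intro Bochner_Integration.integral_cong) (auto simp: indicator_def)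
  also have "\<dots> = integral {a..b} (\<lambda>t. \<integral>x. f x * h x t \<partial>lborel)"
  proof (rule set_borel_integral_eq_integral(2))
    have "integrable lborel (\<lambda>t. \<integral>x. g (x, t) \<partial>lborel)"
      using lborel_pair.integrable_snd[of "\<lambda>x t. g (x, t)"] gi by simp
    moreover have "(\<lambda>t. \<integral>x. g (x, t) \<partial>lborel) = (\<lambda>t. indicator {a..b} t *\<^sub>R (\<integral>x. f x * h x t \<partial>lborel))"
      by (auto simp: g_def indicator_def)
    ultimately show "set_integrable lborel {a..b} (\<lambda>t. \<integral>x. f x * h x t \<partial>lborel)"
      by (simp add: set_integrable_def)
  qed
  finally show ?thesis .
qed

section \<open>Oscillatory test functions and the equation along a ray\<close>

text \<open>With \<open>k = 0\<close> this is the test function profile: along a ray, \<open>y \<cdot> \<nabla>\<close> acts on \<open>cos (\<rho> (y \<bullet> \<xi>))\<close>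
  as \<open>\<rho> d/d\<rho>\<close>, so the weight \<open>1/\<rho>\<close> makes \<open>y \<cdot> \<nabla>\<close> of the integral a bounded boundary term,
  although \<open>F\<close> is not known to have a first moment. The index \<open>k\<close> counts derivatives.\<close>

definition osc :: "real \<Rightarrow> real \<Rightarrow> real \<Rightarrow> nat \<Rightarrow> real \<Rightarrow> real" where
  "osc a b c k t = integral {a..b} (\<lambda>\<rho>. \<rho> ^ k / \<rho> * cos (\<rho> * t + c + real k * (pi / 2)))"

text \<open>Differentiating in t brings down a factor \<rho> and turns cos into -sin, a phase shift
  by pi/2; the definition of \<open>osc\<close> absorbs both into the index. Positivity of
  \<open>a\<close> keeps 1/\<rho> continuous on the interval.\<close>

lemma osc_has_derivative:
  assumes "0 < a"
  shows "(osc a b c k has_real_derivative osc a b c (Suc k) t) (at t)"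
proof -
  have "((\<lambda>t. integral (cbox a b) (\<lambda>\<rho>. \<rho> ^ k / \<rho> * cos (\<rho> * t + c + real k * (pi / 2)))) has_field_derivative
     integral (cbox a b) (\<lambda>\<rho>. \<rho> ^ Suc k / \<rho> * cos (\<rho> * t + c + real (Suc k) * (pi / 2)))) (at t within UNIV)"
  proof (rule leibniz_rule_field_derivative)
    fix x \<rho> assume "\<rho> \<in> cbox a b"
    have "cos (\<rho> * x + c + real (Suc k) * (pi / 2)) = - sin (\<rho> * x + c + real k * (pi / 2))"
      using minus_sin_cos_eq[of "\<rho> * x + c + real k * (pi / 2)"] by (simp add: algebra_simps add_divide_distrib)
    then show "((\<lambda>x. \<rho> ^ k / \<rho> * cos (\<rho> * x + c + real k * (pi / 2))) has_field_derivative
       \<rho> ^ Suc k / \<rho> * cos (\<rho> * x + c + real (Suc k) * (pi / 2))) (at x within UNIV)"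
      by (auto intro!: derivative_eq_intros)
  next
    show "continuous_on (UNIV \<times> cbox a b) (\<lambda>(x, \<rho>). \<rho> ^ Suc k / \<rho> * cos (\<rho> * x + c + real (Suc k) * (pi / 2)))"
      using assms unfolding split_beta by (intro continuous_intros) auto
  qed (use assms in \<open>auto intro!: integrable_continuous_interval continuous_intros\<close>)
  then show ?thesis by (simp only: osc_def[abs_def] cbox_interval)
qed

text \<open>The integrand times t is exactly the \<rho>-derivative of cos (\<rho> t + c), so the
  unbounded factor t disappears into two boundary values.\<close>

lemma osc_1:
  assumes "0 < a" "a \<le> b"
  shows "t * osc a b c 1 t = cos (b * t + c) - cos (a * t + c)"
proof -
  have "((\<lambda>\<rho>. t * (\<rho> ^ 1 / \<rho> * cos (\<rho> * t + c + real 1 * (pi / 2)))) has_integral (cos (b * t + c) - cos (a * t + c))) {a..b}"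
  proof (rule fundamental_theorem_of_calculus[OF \<open>a \<le> b\<close>])
    fix \<rho> assume \<rho>: "\<rho> \<in> {a..b}"
    have "((\<lambda>\<rho>. cos (\<rho> * t + c)) has_real_derivative t * (\<rho> ^ 1 / \<rho> * cos (\<rho> * t + c + real 1 * (pi / 2)))) (at \<rho> within {a..b})"
      using \<rho> assms minus_sin_cos_eq[of "\<rho> * t + c"] by (auto intro!: derivative_eq_intros)
    then show "((\<lambda>\<rho>. cos (\<rho> * t + c)) has_vector_derivative t * (\<rho> ^ 1 / \<rho> * cos (\<rho> * t + c + real 1 * (pi / 2)))) (at \<rho> within {a..b})"
      by (simp add: has_real_derivative_iff_has_vector_derivative)
  qed
  then show ?thesis
    unfolding osc_def integral_mult_right[symmetric] by (rule integral_unique)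
qed

lemma osc_0_bounded:
  assumes "0 < a" "a \<le> b"
  shows "\<bar>osc a b c 0 t\<bar> \<le> (1 / a) * (b - a)"
proof -
  have "norm (integral {a..b} (\<lambda>\<rho>. \<rho> ^ 0 / \<rho> * cos (\<rho> * t + c + real 0 * (pi / 2)))) \<le> (1 / a) * (b - a)"
  proof (rule integral_bound[OF \<open>a \<le> b\<close>])
    fix \<rho> assume \<rho>: "\<rho> \<in> {a..b}"
    then have "1 / \<rho> * \<bar>cos (\<rho> * t + c + real 0 * (pi / 2))\<bar> \<le> (1 / a) * 1"
      using assms by (intro mult_mono) (auto simp: field_simps)
    then show "norm (\<rho> ^ 0 / \<rho> * cos (\<rho> * t + c + real 0 * (pi / 2))) \<le> 1 / a"
      using \<rho> assms by (simp add: abs_mult)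
  qed (use assms in \<open>auto intro!: continuous_intros\<close>)
  then show ?thesis by (simp add: osc_def)
qed

text \<open>Test with \<open>osc a b c 0 (y \<bullet> \<xi>)\<close>. The jump part multiplies the
  mode of frequency \<rho> \<xi> by fourier J (\<epsilon> \<rho> \<xi>) - 1, while the drift reduces
  to the values at \<rho> = b and \<rho> = a. Two interchanges of integrals, over z and over y, turn
  this into the integrated ray equation; \<open>c\<close> is a free phase.\<close>

lemma nonlocal_equilibrium_fourier_Re:
  fixes J F :: "'a::euclidean_space \<Rightarrow> real"
  assumes eq: "nonlocal_equilibrium \<epsilon> s J F" and \<epsilon>: "0 < \<epsilon>" and J: "prob_density J"
    and ab: "0 < a" "a \<le> b"
  shows "Re (cis (- c) * (fourier F (b *\<^sub>R \<xi>) - fourier F (a *\<^sub>R \<xi>)))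
     = \<epsilon> powr (-2 * s) * integral {a..b} (\<lambda>\<rho>. 1 / \<rho> *
         Re (cis (- c) * ((fourier J ((\<epsilon> * \<rho>) *\<^sub>R \<xi>) - 1) * fourier F (\<rho> *\<^sub>R \<xi>))))"
proof -
  have F: "prob_density F" using eq by (simp add: nonlocal_equilibrium_def)
  note Ji = prob_densityD(3)[OF J] and Fi = prob_densityD(3)[OF F]
  define \<Phi> where "\<Phi> y = osc a b c 0 (y \<bullet> \<xi>)" for y
  define D where "D y = cos (b * (y \<bullet> \<xi>) + c) - cos (a * (y \<bullet> \<xi>) + c)" for y
  have cosRe: "cos (\<rho> * (y \<bullet> \<xi>) + c) = Re (cis (- c) * cis (- (y \<bullet> (\<rho> *\<^sub>R \<xi>))))" for \<rho> y
    by (simp add: cis_mult, subst cos_minus[symmetric], simp add: algebra_simps)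
  have Dy: "frechet_derivative \<Phi> (at y) y = D y" for y
  proof -
    have "(osc a b c 0 has_derivative (\<lambda>h. h * osc a b c 1 (y \<bullet> \<xi>))) (at (y \<bullet> \<xi>))"
      using osc_has_derivative[OF ab(1), of b c 0 "y \<bullet> \<xi>"] by (simp add: has_field_derivative_def mult_commute_abs)
    from has_derivative_compose[OF has_derivative_inner_left[OF has_derivative_ident] this]
    have "(\<Phi> has_derivative (\<lambda>h. (h \<bullet> \<xi>) * osc a b c 1 (y \<bullet> \<xi>))) (at y)"
      unfolding \<Phi>_def .
    from frechet_derivative_at[OF this, symmetric] show ?thesis
      unfolding D_def osc_1[OF ab, symmetric] by simp
  qed
  have eq0: "(\<integral>y. F y * (\<epsilon> powr (-2 * s) * ((\<integral>z. J z * \<Phi> (y + \<epsilon> *\<^sub>R z) \<partial>lborel) - \<Phi> y) - D y) \<partial>lborel) = 0"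
  proof (rule nonlocal_equilibrium_bounded_test[OF eq \<epsilon> J])
    show "smooth \<Phi>"
      unfolding smooth_def \<Phi>_def using Cn_compose_real[where g = "osc a b c", OF osc_has_derivative[OF ab(1)] Cn_inner] by blast
    show "\<bar>\<Phi> x\<bar> \<le> (1 / a) * (b - a)" for x unfolding \<Phi>_def by (rule osc_0_bounded[OF ab])
    show "continuous_on UNIV D" unfolding D_def by (intro continuous_intros)
    show "\<bar>D x\<bar> \<le> 2" for x
      unfolding D_def using abs_cos_le_one[of "b * (x \<bullet> \<xi>) + c"] abs_cos_le_one[of "a * (x \<bullet> \<xi>) + c"] by linarith
  qed (rule Dy)
  define G where "G \<rho> = fourier J ((\<epsilon> * \<rho>) *\<^sub>R \<xi>)" for \<rho>
  have Gc: "continuous_on UNIV G"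
    unfolding G_def by (intro continuous_on_compose2[OF continuous_on_fourier[OF Ji]] continuous_intros) auto
  then have [measurable]: "G \<in> borel_measurable borel" by (rule borel_measurable_continuous_onI)
  define T where "T y = integral {a..b} (\<lambda>\<rho>. 1 / \<rho> * Re (cis (- c) * (G \<rho> - 1) * cis (- (y \<bullet> (\<rho> *\<^sub>R \<xi>)))))" for y
  \<comment> \<open>The shift by \<epsilon> z multiplies each mode by a character, and averaging
    over \<open>J\<close> gives the factor \<open>G\<close>.\<close>
  have A: "(\<integral>z. J z * \<Phi> (y + \<epsilon> *\<^sub>R z) \<partial>lborel) - \<Phi> y = T y" for y
  proof -
    have "(\<integral>z. J z * \<Phi> (y + \<epsilon> *\<^sub>R z) \<partial>lborel) =
      (\<integral>z. J z * integral {a..b} (\<lambda>\<rho>. 1 / \<rho> * cos (\<rho> * ((y + \<epsilon> *\<^sub>R z) \<bullet> \<xi>) + c)) \<partial>lborel)"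
      by (simp add: \<Phi>_def osc_def)
    also have "\<dots> = integral {a..b} (\<lambda>\<rho>. \<integral>z. J z * (1 / \<rho> * cos (\<rho> * ((y + \<epsilon> *\<^sub>R z) \<bullet> \<xi>) + c)) \<partial>lborel)"
    proof (rule integral_swap_interval[OF Ji, where B = "1 / a * 1"])
      fix x :: 'a and \<rho> assume "\<rho> \<in> {a..b}"
      then show "\<bar>1 / \<rho> * cos (\<rho> * ((y + \<epsilon> *\<^sub>R x) \<bullet> \<xi>) + c)\<bar> \<le> 1 / a * 1"
        unfolding abs_mult using ab by (intro mult_mono) (auto simp: field_simps)
    qed measurable
    also have "\<dots> = integral {a..b} (\<lambda>\<rho>. 1 / \<rho> * Re (cis (- c) * cis (- (y \<bullet> (\<rho> *\<^sub>R \<xi>))) * G \<rho>))"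
    proof (rule integral_cong)
      fix \<rho> assume "\<rho> \<in> {a..b}"
      have "(\<integral>z. J z * (1 / \<rho> * cos (\<rho> * ((y + \<epsilon> *\<^sub>R z) \<bullet> \<xi>) + c)) \<partial>lborel)
        = (\<integral>z. 1 / \<rho> * (J z * Re ((cis (- c) * cis (- (y \<bullet> (\<rho> *\<^sub>R \<xi>)))) * cis (- (z \<bullet> ((\<epsilon> * \<rho>) *\<^sub>R \<xi>))))) \<partial>lborel)"
        unfolding cosRe
        by (intro Bochner_Integration.integral_cong refl) (simp add: cis_mult inner_add_left algebra_simps)
      then show "(\<integral>z. J z * (1 / \<rho> * cos (\<rho> * ((y + \<epsilon> *\<^sub>R z) \<bullet> \<xi>) + c)) \<partial>lborel)
        = 1 / \<rho> * Re (cis (- c) * cis (- (y \<bullet> (\<rho> *\<^sub>R \<xi>))) * G \<rho>)"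
        by (simp only: integral_mult_right_zero Re_fourier[OF Ji] G_def)
    qed
    finally have 1: "(\<integral>z. J z * \<Phi> (y + \<epsilon> *\<^sub>R z) \<partial>lborel) = integral {a..b} (\<lambda>\<rho>. 1 / \<rho> * Re (cis (- c) * cis (- (y \<bullet> (\<rho> *\<^sub>R \<xi>))) * G \<rho>))" .
    have 2: "\<Phi> y = integral {a..b} (\<lambda>\<rho>. 1 / \<rho> * Re (cis (- c) * cis (- (y \<bullet> (\<rho> *\<^sub>R \<xi>)))))"
      unfolding \<Phi>_def osc_def by (simp add: cosRe)
    show ?thesis unfolding 1 2 T_def
    proof (subst Henstock_Kurzweil_Integration.integral_diff[symmetric])
      show "integral {a..b} (\<lambda>\<rho>. 1 / \<rho> * Re (cis (- c) * cis (- (y \<bullet> (\<rho> *\<^sub>R \<xi>))) * G \<rho>) - 1 / \<rho> * Re (cis (- c) * cis (- (y \<bullet> (\<rho> *\<^sub>R \<xi>)))))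
        = integral {a..b} (\<lambda>\<rho>. 1 / \<rho> * Re (cis (- c) * (G \<rho> - 1) * cis (- (y \<bullet> (\<rho> *\<^sub>R \<xi>)))))"
        by (intro integral_cong) (simp add: algebra_simps)
    qed (use ab in \<open>auto simp only: cis_conv_exp atLeastAtMost_iff intro!: integrable_continuous_interval continuous_intros continuous_on_subset[OF Gc]\<close>)
  qed
  have Gb: "norm (G \<rho> - 1) \<le> 2" for \<rho>
    using norm_fourier_le_1[OF J, of "(\<epsilon> * \<rho>) *\<^sub>R \<xi>"] norm_triangle_ineq4[of "G \<rho>" 1] by (simp add: G_def)
  have hb: "\<bar>1 / \<rho> * Re (cis (- c) * (G \<rho> - 1) * cis (- (x \<bullet> (\<rho> *\<^sub>R \<xi>))))\<bar> \<le> 1 / a * 2" if "\<rho> \<in> {a..b}" for x \<rho>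
  proof -
    have "\<bar>Re (cis (- c) * (G \<rho> - 1) * cis (- (x \<bullet> (\<rho> *\<^sub>R \<xi>))))\<bar> \<le> 2"
      using Gb[of \<rho>] by (intro order_trans[OF abs_Re_le_cmod]) (simp add: norm_mult)
    then show ?thesis unfolding abs_mult using that ab by (intro mult_mono) (auto simp: field_simps)
  qed
  have hm: "(\<lambda>(x, \<rho>). 1 / \<rho> * Re (cis (- c) * (G \<rho> - 1) * cis (- (x \<bullet> (\<rho> *\<^sub>R \<xi>))))) \<in> borel_measurable (borel \<Otimes>\<^sub>M borel)"
    unfolding cis_conv_exp by measurable
  have B: "(\<integral>y. F y * T y \<partial>lborel) = integral {a..b} (\<lambda>\<rho>. 1 / \<rho> * Re (cis (- c) * ((G \<rho> - 1) * fourier F (\<rho> *\<^sub>R \<xi>))))"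
    unfolding T_def
  proof (rule trans[OF integral_swap_interval[OF Fi hm hb] integral_cong])
    fix \<rho> 
    have *: "(\<integral>x. F x * (1 / \<rho> * Re (cis (- c) * (G \<rho> - 1) * cis (- (x \<bullet> (\<rho> *\<^sub>R \<xi>))))) \<partial>lborel)
       = 1 / \<rho> * (\<integral>x. F x * Re (cis (- c) * (G \<rho> - 1) * cis (- (x \<bullet> (\<rho> *\<^sub>R \<xi>)))) \<partial>lborel)"
      by (subst integral_mult_right_zero[symmetric]) (simp add: mult.left_commute)
    show "(\<integral>x. F x * (1 / \<rho> * Re (cis (- c) * (G \<rho> - 1) * cis (- (x \<bullet> (\<rho> *\<^sub>R \<xi>))))) \<partial>lborel)
       = 1 / \<rho> * Re (cis (- c) * ((G \<rho> - 1) * fourier F (\<rho> *\<^sub>R \<xi>)))"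
      unfolding * Re_fourier[OF Fi] by (simp only: mult.assoc)
  qed
  have Fcos: "(\<integral>y. F y * cos (r * (y \<bullet> \<xi>) + c) \<partial>lborel) = Re (cis (- c) * fourier F (r *\<^sub>R \<xi>))" for r
    unfolding cosRe by (rule Re_fourier[OF Fi])
  note [measurable] = prob_densityD(1)[OF F]
  have cosi: "integrable lborel (\<lambda>y. F y * cos (r * (y \<bullet> \<xi>) + c))" for r
    by (rule Bochner_Integration.integrable_bound[OF Fi]) (auto simp: abs_mult mult_left_le)
  have C: "(\<integral>y. F y * D y \<partial>lborel) = Re (cis (- c) * (fourier F (b *\<^sub>R \<xi>) - fourier F (a *\<^sub>R \<xi>)))"
    unfolding D_def right_diff_distrib
    by (subst Bochner_Integration.integral_diff[OF cosi cosi]) (simp only: Fcos right_diff_distrib minus_complex.sel)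
  have Di: "integrable lborel (\<lambda>y. F y * D y)"
    unfolding D_def right_diff_distrib by (intro Bochner_Integration.integrable_diff cosi)
  have Tb: "\<bar>T y\<bar> \<le> 1 / a * 2 * (b - a)" for y
    unfolding T_def real_norm_def[symmetric]
    by (rule integral_bound[OF ab(2)])
       (use ab hb in \<open>auto simp only: cis_conv_exp atLeastAtMost_iff real_norm_def intro!: continuous_intros continuous_on_subset[OF Gc]\<close>)
  have [measurable]: "T \<in> borel_measurable borel"
  proof -
    \<comment> \<open>The gauge integral is rewritten as a Lebesgue integral so that measurability
      in the parameter y follows from joint measurability.\<close>
    have Teq: "T = (\<lambda>y. LINT \<rho>:{a..b}|lborel. 1 / \<rho> * Re (cis (- c) * (G \<rho> - 1) * cis (- (y \<bullet> (\<rho> *\<^sub>R \<xi>)))))"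
      unfolding T_def
      by (intro ext set_borel_integral_eq_integral(2)[symmetric] borel_integrable_atLeastAtMost')
         (use ab in \<open>auto simp only: cis_conv_exp atLeastAtMost_iff intro!: continuous_intros continuous_on_subset[OF Gc]\<close>)
    show ?thesis unfolding Teq set_lebesgue_integral_def cis_conv_exp by measurable
  qed
  have Ti: "integrable lborel (\<lambda>y. F y * T y)"
  proof (rule Bochner_Integration.integrable_bound)
    show "integrable lborel (\<lambda>y. F y * (1 / a * 2 * (b - a)))" using Fi by simp
    show "AE y in lborel. norm (F y * T y) \<le> norm (F y * (1 / a * 2 * (b - a)))"
      unfolding norm_mult real_norm_def[of "T _"]
      by (intro AE_I2 mult_left_mono order_trans[OF Tb]) (use ab in \<open>auto simp: abs_mult\<close>)
  qed measurable
  have "0 = (\<integral>y. \<epsilon> powr (-2 * s) * (F y * T y) - F y * D y \<partial>lborel)"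
    using eq0 unfolding A by (simp add: algebra_simps)
  also have "\<dots> = \<epsilon> powr (-2 * s) * (\<integral>y. F y * T y \<partial>lborel) - (\<integral>y. F y * D y \<partial>lborel)"
    using Ti Di by simp
  finally show ?thesis unfolding B C G_def by simp
qed

lemma nonlocal_equilibrium_fourier:
  fixes J F :: "'a::euclidean_space \<Rightarrow> real"
  assumes eq: "nonlocal_equilibrium \<epsilon> s J F" and \<epsilon>: "0 < \<epsilon>" and J: "prob_density J"
    and ab: "0 < a" "a \<le> b"
  shows "fourier F (b *\<^sub>R \<xi>) - fourier F (a *\<^sub>R \<xi>)
     = integral {a..b} (\<lambda>\<rho>. complex_of_real (\<epsilon> powr (-2 * s) / \<rho>) * (fourier J ((\<epsilon> * \<rho>) *\<^sub>R \<xi>) - 1) * fourier F (\<rho> *\<^sub>R \<xi>))"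
proof -
  have F: "prob_density F" using eq by (simp add: nonlocal_equilibrium_def)
  define I where "I \<rho> = complex_of_real (\<epsilon> powr (-2 * s) / \<rho>) * (fourier J ((\<epsilon> * \<rho>) *\<^sub>R \<xi>) - 1) * fourier F (\<rho> *\<^sub>R \<xi>)" for \<rho>
  have "continuous_on {a..b} I"
    unfolding I_def using ab
    by (intro continuous_intros continuous_on_compose2[OF continuous_on_fourier[OF prob_densityD(3)[OF J]]]
         continuous_on_compose2[OF continuous_on_fourier[OF prob_densityD(3)[OF F]]]) auto
  then have Ii: "I integrable_on {a..b}" by (rule integrable_continuous_interval)
  have "Re (cis (- c) * integral {a..b} I) = Re (cis (- c) * (fourier F (b *\<^sub>R \<xi>) - fourier F (a *\<^sub>R \<xi>)))" for c
  proof -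
    have "Re (cis (- c) * integral {a..b} I) = integral {a..b} (\<lambda>\<rho>. Re (cis (- c) * I \<rho>))"
      using integral_linear[OF Ii bounded_linear_compose[OF bounded_linear_Re bounded_linear_mult_right[of "cis (- c)"]]]
      by (simp add: o_def)
    also have "\<dots> = integral {a..b} (\<lambda>\<rho>. \<epsilon> powr (-2 * s) * (1 / \<rho> *
         Re (cis (- c) * ((fourier J ((\<epsilon> * \<rho>) *\<^sub>R \<xi>) - 1) * fourier F (\<rho> *\<^sub>R \<xi>)))))"
    proof (rule integral_cong)
      fix \<rho>
      have "cis (- c) * I \<rho> = complex_of_real (\<epsilon> powr (-2 * s) * (1 / \<rho>)) * (cis (- c) * ((fourier J ((\<epsilon> * \<rho>) *\<^sub>R \<xi>) - 1) * fourier F (\<rho> *\<^sub>R \<xi>)))"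
        by (simp add: I_def)
      then show "Re (cis (- c) * I \<rho>) = \<epsilon> powr (-2 * s) * (1 / \<rho> *
         Re (cis (- c) * ((fourier J ((\<epsilon> * \<rho>) *\<^sub>R \<xi>) - 1) * fourier F (\<rho> *\<^sub>R \<xi>))))"
        by (simp only: Re_complex_of_real complex.sel times_complex.sel Im_complex_of_real mult_zero_left diff_zero mult.assoc)
    qed
    finally show ?thesis
      unfolding nonlocal_equilibrium_fourier_Re[OF eq \<epsilon> J ab]
      by (simp only: Henstock_Kurzweil_Integration.integral_mult_right)
  qed
  \<comment> \<open>Phase 0 gives the real part and phase pi/2 the imaginary part.\<close>
  from this[of 0] this[of "pi / 2"] have "integral {a..b} I = fourier F (b *\<^sub>R \<xi>) - fourier F (a *\<^sub>R \<xi>)"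
    by (auto intro!: complex_eqI)
  then show ?thesis unfolding I_def by simp
qed

text \<open>Integrating factor: \<open>g\<close> times the exponential of minus the primitive of
  \<open>A\<close> has derivative 0. The integral equation and continuity of \<open>A\<close> and
  \<open>g\<close> make \<open>g\<close> differentiable.\<close>

lemma linear_ode_solution:
  fixes g A :: "real \<Rightarrow> complex"
  assumes ab: "a \<le> b" and g: "continuous_on {a..b} g" and A: "continuous_on {a..b} A"
    and eq: "\<And>x. x \<in> {a..b} \<Longrightarrow> g x - g a = integral {a..x} (\<lambda>t. A t * g t)"
  shows "g b = g a * exp (integral {a..b} A)"
proof -
  define h where "h x = g x * exp (- integral {a..x} A)" for x
  have "(h has_vector_derivative 0) (at x within {a..b})" if x: "x \<in> {a..b}" for x
  proof -
    have 1: "((\<lambda>x. integral {a..x} A) has_vector_derivative A x) (at x within {a..b})"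
      by (rule integral_has_vector_derivative[OF A x])
    have "((\<lambda>x. integral {a..x} (\<lambda>t. A t * g t)) has_vector_derivative A x * g x) (at x within {a..b})"
      by (rule integral_has_vector_derivative[OF continuous_on_mult[OF A g] x])
    then have "((\<lambda>x. g a + integral {a..x} (\<lambda>t. A t * g t)) has_vector_derivative 0 + A x * g x) (at x within {a..b})"
      by (intro has_vector_derivative_add has_vector_derivative_const)
    then have "((\<lambda>x. g a + integral {a..x} (\<lambda>t. A t * g t)) has_vector_derivative A x * g x) (at x within {a..b})"
      by simp
    then have 2: "(g has_vector_derivative A x * g x) (at x within {a..b})"
      by (rule has_vector_derivative_transform[OF x, rotated]) (metis eq add_diff_cancel_left' diff_add_cancel add.commute)
    have 3: "((\<lambda>x. exp (- integral {a..x} A)) has_vector_derivative (- A x) * exp (- integral {a..x} A)) (at x within {a..b})"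
      using field_vector_diff_chain_within[OF has_vector_derivative_minus[OF 1] has_field_derivative_at_within[OF DERIV_exp]]
      by (simp only: o_def)
    show ?thesis unfolding h_def
      using has_vector_derivative_mult[OF 2 3] by (simp add: algebra_simps)
  qed
  then have "h b = h a"
    using has_vector_derivative_zero_constant[of "{a..b}" h] ab
    by (metis atLeastAtMost_iff convex_real_interval(5) order_refl)
  then show ?thesis by (simp add: h_def exp_minus field_simps)
qed

section \<open>Low and high frequencies\<close>

lemma norm_exp_minus_1_le:
  fixes z :: complex
  shows "norm (exp z - 1) \<le> norm z * exp (norm z)"
proof -
  have "norm (exp z - (\<Sum>i\<le>0. z ^ i / fact i)) \<le> exp \<bar>Re z\<bar> * (norm z ^ Suc 0) / fact 0"
    by (rule Taylor_exp)
  moreover have "exp \<bar>Re z\<bar> * norm z \<le> exp (norm z) * norm z"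
    by (intro mult_right_mono) (simp_all add: abs_Re_le_cmod)
  ultimately show ?thesis by (simp add: mult.commute)
qed

lemma cos_ge_one_minus_square_half:
  fixes u :: real
  shows "1 - u\<^sup>2 / 2 \<le> cos u"
proof -
  have "(sin (u / 2))\<^sup>2 \<le> (u / 2)\<^sup>2"
    using abs_sin_x_le_abs_x[of "u / 2"] by (simp only: abs_le_square_iff)
  then show ?thesis using cos_double_sin[of "u / 2"] by (simp add: power_divide)
qed

text \<open>Serves to trade powers of the frequency against exponential decay. For u above 1 the
  exponent is rounded up, and a single term of the exponential series suffices.\<close>

lemma powr_times_exp_bounded:
  fixes p c :: real
  assumes "0 \<le> p" "0 < c"
  shows "\<exists>C>0. \<forall>u\<ge>0. u powr p * exp (- (c * u)) \<le> C"
proof -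
  define n where "n = nat \<lceil>p\<rceil>"
  have "u powr p * exp (- (c * u)) \<le> 1 + fact n / c ^ n" if "u \<ge> 0" for u
  proof (cases "u \<le> 1")
    case True
    have "u powr p * exp (- (c * u)) \<le> 1 * 1"
      using that True assms by (intro mult_mono powr_le1) auto
    also have "\<dots> \<le> 1 + fact n / c ^ n" using assms by simp
    finally show ?thesis .
  next
    case False
    have "u powr p \<le> u powr real n"
      using False assms by (intro powr_mono) (auto simp: n_def)
    also have "\<dots> = u ^ n" using False by (simp add: powr_realpow)
    finally have 1: "u powr p \<le> u ^ n" .
    have "(c * u) ^ n /\<^sub>R fact n \<le> exp (c * u)"
    proof -
      have "(\<Sum>k\<in>{n}. (c * u) ^ k /\<^sub>R fact k) \<le> (\<Sum>k. (c * u) ^ k /\<^sub>R fact k)"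
        using that assms by (intro sum_le_suminf summable_exp_generic) auto
      then show ?thesis by (simp add: exp_def)
    qed
    then have "(c * u) ^ n * exp (- (c * u)) \<le> fact n"
      by (simp add: exp_minus field_simps)
    then have "u ^ n * exp (- (c * u)) \<le> fact n / c ^ n"
      using assms by (simp add: field_simps power_mult_distrib)
    with 1 have "u powr p * exp (- (c * u)) \<le> fact n / c ^ n"
      by (meson exp_ge_zero mult_right_mono order_trans)
    then show ?thesis by simp
  qed
  moreover have "0 < 1 + fact n / c ^ n" using assms by (simp add: add_pos_nonneg)
  ultimately show ?thesis by blast
qed

text \<open>Integration by parts of cos (\<rho> t)/\<rho>, arranged as a comparison:
  \<open>P\<close> is ln \<rho> minus the boundary term sin (\<rho> t)/(t \<rho>), and its last
  summand absorbs the remainder, of modulus at most 1/(|t| \<rho>^2). The growth ln (1/a) survives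
  whenever |t| a is bounded below, although 1 - cos vanishes at many points.\<close>

lemma one_minus_cos_over_integral_ge:
  fixes a t :: real
  assumes a: "0 < a" "a \<le> 1" and t: "t \<noteq> 0"
  shows "ln (1 / a) - 2 / (\<bar>t\<bar> * a) \<le> integral {a..1} (\<lambda>\<rho>. 1 / \<rho> * (1 - cos (\<rho> * t)))"
proof -
  define P where "P \<rho> = ln \<rho> - sin (\<rho> * t) / (t * \<rho>) + 1 / (\<bar>t\<bar> * \<rho>)" for \<rho>
  define P' where "P' \<rho> = 1 / \<rho> - cos (\<rho> * t) / \<rho> + sin (\<rho> * t) / (t * \<rho>\<^sup>2) - 1 / (\<bar>t\<bar> * \<rho>\<^sup>2)" for \<rho>
  have "(P' has_integral (P 1 - P a)) {a..1}"
  proof (rule fundamental_theorem_of_calculus[OF a(2)])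
    fix \<rho> assume "\<rho> \<in> {a..1}"
    then have "(P has_real_derivative P' \<rho>) (at \<rho> within {a..1})"
      unfolding P_def P'_def using a t
      by (auto intro!: derivative_eq_intros simp: field_simps power2_eq_square)
    then show "(P has_vector_derivative P' \<rho>) (at \<rho> within {a..1})"
      by (simp add: has_real_derivative_iff_has_vector_derivative)
  qed
  moreover have "((\<lambda>\<rho>. 1 / \<rho> * (1 - cos (\<rho> * t))) has_integral integral {a..1} (\<lambda>\<rho>. 1 / \<rho> * (1 - cos (\<rho> * t)))) {a..1}"
    using a by (intro integrable_integral integrable_continuous_interval continuous_intros) auto
  ultimately have "P 1 - P a \<le> integral {a..1} (\<lambda>\<rho>. 1 / \<rho> * (1 - cos (\<rho> * t)))"
  proof (rule has_integral_le)
    fix \<rho> assume "\<rho> \<in> {a..1}"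
    then have \<rho>: "\<rho> > 0" using a by auto
    have "sin (\<rho> * t) / (t * \<rho>\<^sup>2) \<le> \<bar>sin (\<rho> * t) / (t * \<rho>\<^sup>2)\<bar>" by (rule abs_ge_self)
    also have "\<dots> \<le> 1 / (\<bar>t\<bar> * \<rho>\<^sup>2)"
      using \<rho> t by (simp add: abs_mult divide_right_mono)
    finally show "P' \<rho> \<le> 1 / \<rho> * (1 - cos (\<rho> * t))"
      unfolding P'_def by (simp add: algebra_simps diff_divide_distrib)
  qed
  moreover have "sin t / t \<le> 1 / \<bar>t\<bar>"
    using abs_ge_self[of "sin t / t"] divide_right_mono[OF abs_sin_le_one[of t], of "\<bar>t\<bar>"] by simp
  moreover have "- sin (a * t) / (t * a) \<le> 1 / (\<bar>t\<bar> * a)"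
    using abs_ge_self[of "- sin (a * t) / (t * a)"] divide_right_mono[OF abs_sin_le_one[of "a * t"], of "\<bar>t\<bar> * a"] a
    by (simp add: abs_mult)
  ultimately show ?thesis using a by (simp add: P_def ln_div)
qed

lemma powr_integral:
  fixes a r :: real
  assumes "0 < a" "a \<le> 1" "0 < r"
  shows "((\<lambda>\<rho>. \<rho> powr (r - 1)) has_integral ((1 - a powr r) / r)) {a..1}"
proof -
  have "((\<lambda>\<rho>. \<rho> powr (r - 1)) has_integral (1 powr r / r - a powr r / r)) {a..1}"
  proof (rule fundamental_theorem_of_calculus[OF assms(2)])
    fix \<rho> assume "\<rho> \<in> {a..1}"
    then have "((\<lambda>\<rho>. \<rho> powr r / r) has_real_derivative \<rho> powr (r - 1)) (at \<rho> within {a..1})"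
      using assms by (auto intro!: derivative_eq_intros)
    then show "((\<lambda>\<rho>. \<rho> powr r / r) has_vector_derivative \<rho> powr (r - 1)) (at \<rho> within {a..1})"
      by (simp add: has_real_derivative_iff_has_vector_derivative)
  qed
  then show ?thesis by (simp add: diff_divide_distrib)
qed

text \<open>Fixes a single equilibrium. The parameters \<epsilon> and s change from use to use,
  while \<delta> and \<open>C0\<close> belong to the whole family; estimates explicit in \<epsilon>
  and s, with constants built from \<delta>, \<open>C0\<close> and a radius \<open>r\<close>, are
  therefore uniform.\<close>

locale nonlocal_rescaled =
  fixes J F :: "'a::euclidean_space \<Rightarrow> real" and \<epsilon> s \<delta> C0 :: real
  assumes eq: "nonlocal_equilibrium \<epsilon> s J F" and \<epsilon>: "0 < \<epsilon>" "\<epsilon> \<le> 1" and s: "1/2 < s" "s < 1"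
    and J: "prob_density J" and \<delta>: "0 < \<delta>" and C0: "0 < C0"
    and expansion: "\<And>\<xi>. norm \<xi> \<le> 1 \<Longrightarrow>
       cmod (fourier J \<xi> - complex_of_real (1 - norm \<xi> powr (2 * s))) \<le> C0 * norm \<xi> powr (2 * s + \<delta>)"
begin

lemma F: "prob_density F"
  using eq by (simp add: nonlocal_equilibrium_def)

text \<open>Coefficient of the linear equation that \<rho> -> fourier F (\<rho> \<xi>)
  solves.\<close>

definition A :: "'a \<Rightarrow> real \<Rightarrow> complex" where
  "A \<xi> \<rho> = complex_of_real (\<epsilon> powr (-2 * s) / \<rho>) * (fourier J ((\<epsilon> * \<rho>) *\<^sub>R \<xi>) - 1)"

lemma continuous_A: "0 < a \<Longrightarrow> continuous_on {a..1} (A \<xi>)"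
  unfolding A_def
  by (intro continuous_intros continuous_on_compose2[OF continuous_on_fourier[OF prob_densityD(3)[OF J]]]) auto

lemma fourier_eq:
  assumes "0 < a" "a \<le> 1"
  shows "fourier F \<xi> = fourier F (a *\<^sub>R \<xi>) * exp (integral {a..1} (A \<xi>))"
proof -
  have "fourier F (1 *\<^sub>R \<xi>) = fourier F (a *\<^sub>R \<xi>) * exp (integral {a..1} (A \<xi>))"
  proof (rule linear_ode_solution[OF assms(2) _ continuous_A[OF assms(1)]])
    show "continuous_on {a..1} (\<lambda>\<rho>. fourier F (\<rho> *\<^sub>R \<xi>))"
      by (intro continuous_on_compose2[OF continuous_on_fourier[OF prob_densityD(3)[OF F]]] continuous_intros) auto
    show "fourier F (x *\<^sub>R \<xi>) - fourier F (a *\<^sub>R \<xi>) = integral {a..x} (\<lambda>t. A \<xi> t * fourier F (t *\<^sub>R \<xi>))"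
      if "x \<in> {a..1}" for x
      unfolding A_def using nonlocal_equilibrium_fourier[OF eq \<epsilon>(1) J assms(1), of x] that by simp
  qed
  then show ?thesis by simp
qed

text \<open>By homogeneity the prefactor \<epsilon>^(-2s) cancels the power of \<epsilon> in the
  leading term, which becomes the symbol of the fractional Laplacian along the ray, and leaves
  \<epsilon>^\<delta> in the remainder. The surplus \<rho>^\<delta> is dropped so that both terms
  share the weight \<rho>^(2s-1).\<close>

lemma A_expansion:
  assumes "\<epsilon> * norm \<xi> \<le> 1" "0 < \<rho>" "\<rho> \<le> 1"
  shows "cmod (A \<xi> \<rho> + complex_of_real (norm \<xi> powr (2 * s) * \<rho> powr (2 * s - 1)))
    \<le> C0 * \<epsilon> powr \<delta> * norm \<xi> powr (2 * s + \<delta>) * \<rho> powr (2 * s - 1)"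
proof -
  have n: "norm ((\<epsilon> * \<rho>) *\<^sub>R \<xi>) = \<epsilon> * \<rho> * norm \<xi>" using \<epsilon> assms by simp
  have "(\<epsilon> * norm \<xi>) * \<rho> \<le> 1 * 1" using assms \<epsilon> by (intro mult_mono) auto
  then have le: "norm ((\<epsilon> * \<rho>) *\<^sub>R \<xi>) \<le> 1" unfolding n by (simp add: mult_ac)
  have e: "\<epsilon> powr (-2 * s) * \<epsilon> powr (2 * s) = 1" using \<epsilon> by (simp add: powr_add[symmetric])
  have e': "\<epsilon> powr (-2 * s) * \<epsilon> powr (2 * s + \<delta>) = \<epsilon> powr \<delta>" using \<epsilon> by (simp add: powr_add[symmetric])
  have p: "\<rho> powr q / \<rho> = \<rho> powr (q - 1)" for q using assms by (simp add: powr_diff)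
  have "\<epsilon> powr (-2 * s) / \<rho> * (\<epsilon> * \<rho> * norm \<xi>) powr (2 * s) = (\<epsilon> powr (-2 * s) * \<epsilon> powr (2 * s)) * (\<rho> powr (2 * s) / \<rho>) * norm \<xi> powr (2 * s)"
    using \<epsilon> assms by (simp add: powr_mult)
  then have 1: "\<epsilon> powr (-2 * s) / \<rho> * (\<epsilon> * \<rho> * norm \<xi>) powr (2 * s) = norm \<xi> powr (2 * s) * \<rho> powr (2 * s - 1)"
    unfolding e p by simp
  have "\<epsilon> powr (-2 * s) / \<rho> * (C0 * (\<epsilon> * \<rho> * norm \<xi>) powr (2 * s + \<delta>))
     = C0 * (\<epsilon> powr (-2 * s) * \<epsilon> powr (2 * s + \<delta>)) * norm \<xi> powr (2 * s + \<delta>) * (\<rho> powr (2 * s + \<delta>) / \<rho>)"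
    using \<epsilon> assms by (simp add: powr_mult)
  then have 2: "\<epsilon> powr (-2 * s) / \<rho> * (C0 * (\<epsilon> * \<rho> * norm \<xi>) powr (2 * s + \<delta>))
     = C0 * \<epsilon> powr \<delta> * norm \<xi> powr (2 * s + \<delta>) * \<rho> powr (2 * s + \<delta> - 1)"
    unfolding e' p by simp
  have "A \<xi> \<rho> + complex_of_real (norm \<xi> powr (2 * s) * \<rho> powr (2 * s - 1))
    = complex_of_real (\<epsilon> powr (-2 * s) / \<rho>) * (fourier J ((\<epsilon> * \<rho>) *\<^sub>R \<xi>) - complex_of_real (1 - (\<epsilon> * \<rho> * norm \<xi>) powr (2 * s)))"
    unfolding 1[symmetric] A_def of_real_mult[of "_ / _"] of_real_diff of_real_1 by (simp only: algebra_simps)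
  also have "cmod \<dots> \<le> \<epsilon> powr (-2 * s) / \<rho> * (C0 * (\<epsilon> * \<rho> * norm \<xi>) powr (2 * s + \<delta>))"
  proof -
    have "cmod (complex_of_real (\<epsilon> powr (-2 * s) / \<rho>)) = \<epsilon> powr (-2 * s) / \<rho>"
      unfolding norm_of_real using assms by simp
    moreover have "0 \<le> \<epsilon> powr (-2 * s) / \<rho>" using assms by simp
    ultimately show ?thesis
      unfolding norm_mult using mult_left_mono[OF expansion[OF le]] unfolding n by metis
  qed
  also have "\<dots> \<le> C0 * \<epsilon> powr \<delta> * norm \<xi> powr (2 * s + \<delta>) * \<rho> powr (2 * s - 1)"
    unfolding 2 using C0 \<delta> assms by (intro mult_left_mono powr_mono') auto
  finally show ?thesis .
qed

text \<open>Bound for the total error in the exponent: the remainder of the coefficient integrated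
  over (0, 1], where \<rho>^(2s-1) has integral 1/(2s).\<close>

definition \<kappa> :: "'a \<Rightarrow> real" where
  "\<kappa> \<xi> = C0 * \<epsilon> powr \<delta> * norm \<xi> powr (2 * s + \<delta>) / (2 * s)"

lemma \<kappa>_nonneg: "0 \<le> \<kappa> \<xi>"
  using C0 s by (simp add: \<kappa>_def)

text \<open>\<open>W\<close> is the integrated remainder. It depends on \<open>a\<close>, but its
  bound does not, which is what allows \<open>a\<close> to tend to 0 afterwards.\<close>

lemma fourier_low_aux:
  assumes \<xi>: "\<epsilon> * norm \<xi> \<le> 1" and a: "0 < a" "a \<le> 1"
  obtains W where "cmod W \<le> \<kappa> \<xi>"
    "fourier F \<xi> = fourier F (a *\<^sub>R \<xi>) * exp (complex_of_real (- (norm \<xi> powr (2 * s) * (1 - a powr (2 * s)) / (2 * s)))) * exp W"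
proof -
  let ?X = "norm \<xi> powr (2 * s)" and ?Y = "C0 * \<epsilon> powr \<delta> * norm \<xi> powr (2 * s + \<delta>)"
  have pw: "((\<lambda>\<rho>. \<rho> powr (2 * s - 1)) has_integral ((1 - a powr (2 * s)) / (2 * s))) {a..1}"
    using powr_integral[OF a, of "2 * s"] s by simp
  have hX: "((\<lambda>\<rho>. complex_of_real (?X * \<rho> powr (2 * s - 1))) has_integral complex_of_real (?X * ((1 - a powr (2 * s)) / (2 * s)))) {a..1}"
    by (rule has_integral_of_real[OF has_integral_mult_right[OF pw]])
  have hA: "(A \<xi> has_integral integral {a..1} (A \<xi>)) {a..1}"
    by (intro integrable_integral integrable_continuous_interval continuous_A a)
  define W where "W = integral {a..1} (A \<xi>) + complex_of_real (?X * ((1 - a powr (2 * s)) / (2 * s)))"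
  have hW: "((\<lambda>\<rho>. A \<xi> \<rho> + complex_of_real (?X * \<rho> powr (2 * s - 1))) has_integral W) {a..1}"
    unfolding W_def by (rule has_integral_add[OF hA hX])
  have "cmod W \<le> integral {a..1} (\<lambda>\<rho>. ?Y * \<rho> powr (2 * s - 1))"
    unfolding integral_unique[OF hW, symmetric]
  proof (rule integral_norm_bound_integral)
    show "(\<lambda>\<rho>. A \<xi> \<rho> + complex_of_real (?X * \<rho> powr (2 * s - 1))) integrable_on {a..1}" using hW by blast
    show "(\<lambda>\<rho>. ?Y * \<rho> powr (2 * s - 1)) integrable_on {a..1}"
      using has_integral_mult_right[OF pw] by blast
  qed (use A_expansion[OF \<xi>] a in auto)
  also have "\<dots> = ?Y * ((1 - a powr (2 * s)) / (2 * s))"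
    by (rule integral_unique[OF has_integral_mult_right[OF pw]])
  also have "\<dots> \<le> ?Y * (1 / (2 * s))"
    using C0 s by (intro mult_left_mono divide_right_mono) auto
  finally have "cmod W \<le> \<kappa> \<xi>" by (simp add: \<kappa>_def)
  moreover have "integral {a..1} (A \<xi>) = complex_of_real (- (?X * (1 - a powr (2 * s)) / (2 * s))) + W"
    by (simp add: W_def)
  then have "fourier F \<xi> = fourier F (a *\<^sub>R \<xi>) * exp (complex_of_real (- (?X * (1 - a powr (2 * s)) / (2 * s)))) * exp W"
    using fourier_eq[OF a, of \<xi>] by (simp only: exp_add mult.assoc)
  ultimately show thesis using that by blast
qed

text \<open>The initial condition of the ray equation, namely total mass 1. It has to be taken as a
  limit because the coefficient is singular at \<rho> = 0.\<close>

lemma fourier_ray_tendsto: "((\<lambda>a. fourier F (a *\<^sub>R \<xi>)) \<longlongrightarrow> 1) (at_right 0)"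
proof -
  have "isCont (fourier F) 0"
    using continuous_on_fourier[OF prob_densityD(3)[OF F]] by (simp add: continuous_on_eq_continuous_at)
  moreover have "((\<lambda>a. a *\<^sub>R \<xi>) \<longlongrightarrow> 0) (at_right 0)"
    by (rule tendsto_eq_intros tendsto_ident_at refl)+ simp
  ultimately show ?thesis
    using isCont_tendsto_compose fourier_0[OF F] by metis
qed

lemma fourier_low:
  assumes \<xi>: "\<epsilon> * norm \<xi> \<le> 1"
  shows "cmod (fourier F \<xi> - complex_of_real (exp (- (norm \<xi> powr (2 * s) / (2 * s)))))
      \<le> exp (- (norm \<xi> powr (2 * s) / (2 * s))) * (\<kappa> \<xi> * exp (\<kappa> \<xi>))" (is ?th1)
    and "cmod (fourier F \<xi>) \<le> exp (- (norm \<xi> powr (2 * s) / (2 * s)) + \<kappa> \<xi>)" (is ?th2)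
proof -
  let ?X = "norm \<xi> powr (2 * s)"
  \<comment> \<open>\<open>h a\<close> collects every factor except exp W. As \<open>a\<close> tends
    to 0 it converges to the stable profile, while the estimates \<open>b1\<close> and
    \<open>b2\<close> hold for each \<open>a\<close> in (0, 1].\<close>
  define h where "h a = fourier F (a *\<^sub>R \<xi>) * complex_of_real (exp (- (?X * (1 - a powr (2 * s)) / (2 * s))))" for a
  have pl: "((\<lambda>a::real. a powr (2 * s)) \<longlongrightarrow> 0) (at_right 0)"
    using s by real_asymp
  have hl: "(h \<longlongrightarrow> 1 * complex_of_real (exp (- (?X * (1 - 0) / (2 * s))))) (at_right 0)"
    unfolding h_def using s
    by (intro tendsto_mult fourier_ray_tendsto tendsto_of_real tendsto_exp tendsto_minus tendsto_divide tendsto_diff tendsto_const pl) auto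
  have ev: "\<forall>\<^sub>F a::real in at_right 0. 0 < a \<and> a \<le> 1"
    unfolding eventually_at_right_field by (rule exI[of _ 1]) auto
  have b1: "cmod (fourier F \<xi> - h a) \<le> cmod (h a) * (\<kappa> \<xi> * exp (\<kappa> \<xi>))"
    and b2: "cmod (fourier F \<xi>) \<le> cmod (h a) * exp (\<kappa> \<xi>)" if a: "0 < a \<and> a \<le> 1" for a
  proof -
    obtain W where W: "cmod W \<le> \<kappa> \<xi>" and eqW: "fourier F \<xi> = h a * exp W"
      unfolding h_def exp_of_real[symmetric] using fourier_low_aux[OF \<xi>, of a] a by metis
    have "cmod (exp W - 1) \<le> \<kappa> \<xi> * exp (\<kappa> \<xi>)"
      using W \<kappa>_nonneg by (intro order_trans[OF norm_exp_minus_1_le] mult_mono) auto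
    moreover have "fourier F \<xi> - h a = h a * (exp W - 1)" by (simp add: eqW algebra_simps)
    ultimately show "cmod (fourier F \<xi> - h a) \<le> cmod (h a) * (\<kappa> \<xi> * exp (\<kappa> \<xi>))"
      by (simp add: norm_mult mult_left_mono)
    have "cmod (exp W) \<le> exp (\<kappa> \<xi>)"
      using W complex_Re_le_cmod[of W] by simp
    then show "cmod (fourier F \<xi>) \<le> cmod (h a) * exp (\<kappa> \<xi>)"
      by (simp add: eqW norm_mult mult_left_mono)
  qed
  have "cmod (fourier F \<xi> - 1 * complex_of_real (exp (- (?X * (1 - 0) / (2 * s)))))
     \<le> cmod (1 * complex_of_real (exp (- (?X * (1 - 0) / (2 * s))))) * (\<kappa> \<xi> * exp (\<kappa> \<xi>))"
    by (rule tendsto_le[OF trivial_limit_at_right_real tendsto_mult[OF tendsto_norm[OF hl] tendsto_const] tendsto_norm[OF tendsto_diff[OF tendsto_const hl]]])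
       (use ev b1 in \<open>auto elim: eventually_mono\<close>)
  then show ?th1 by simp
  have "cmod (fourier F \<xi>) \<le> cmod (1 * complex_of_real (exp (- (?X * (1 - 0) / (2 * s))))) * exp (\<kappa> \<xi>)"
    by (rule tendsto_le[OF trivial_limit_at_right_real tendsto_mult[OF tendsto_norm[OF hl] tendsto_const] tendsto_const])
       (use ev b2 in \<open>auto elim: eventually_mono\<close>)
  then show ?th2 unfolding exp_add by simp
qed


text \<open>For \<epsilon> |\<xi>| \<le> r the condition on \<open>r\<close> makes \<kappa> at most
  half of |\<xi>|^(2s)/(2s). Half of the stable decay is spent on exp \<kappa> and the other half
  remains, whence 4s in place of 2s.\<close>

lemma fourier_low_small:
  assumes r: "C0 * r powr \<delta> \<le> 1 / 2" and \<xi>: "\<epsilon> * norm \<xi> \<le> r" and "r \<le> 1"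
  shows "cmod (fourier F \<xi> - complex_of_real (exp (- (norm \<xi> powr (2 * s) / (2 * s)))))
      \<le> C0 * \<epsilon> powr \<delta> * norm \<xi> powr (2 * s + \<delta>) * exp (- (norm \<xi> powr (2 * s) / (4 * s)))" (is ?th1)
    and "cmod (fourier F \<xi>) \<le> exp (- (norm \<xi> powr (2 * s) / (4 * s)))" (is ?th2)
proof -
  have \<xi>1: "\<epsilon> * norm \<xi> \<le> 1" using assms by simp
  have "C0 * \<epsilon> powr \<delta> * norm \<xi> powr (2 * s + \<delta>) = (C0 * (\<epsilon> * norm \<xi>) powr \<delta>) * norm \<xi> powr (2 * s)"
    using \<epsilon> by (simp add: powr_mult powr_add)
  also have "\<dots> \<le> 1 / 2 * norm \<xi> powr (2 * s)"
  proof (rule mult_right_mono)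
    have "C0 * (\<epsilon> * norm \<xi>) powr \<delta> \<le> C0 * r powr \<delta>"
      using C0 \<delta> \<epsilon> \<xi> by (intro mult_left_mono powr_mono2) auto
    with r show "C0 * (\<epsilon> * norm \<xi>) powr \<delta> \<le> 1 / 2" by simp
  qed simp
  finally have k2: "\<kappa> \<xi> \<le> norm \<xi> powr (2 * s) / (4 * s)"
    unfolding \<kappa>_def using s divide_right_mono[of _ _ "2 * s"] by fastforce
  have k1: "\<kappa> \<xi> \<le> C0 * \<epsilon> powr \<delta> * norm \<xi> powr (2 * s + \<delta>)"
  proof -
    have "\<kappa> \<xi> \<le> C0 * \<epsilon> powr \<delta> * norm \<xi> powr (2 * s + \<delta>) / 1"
      unfolding \<kappa>_def using s C0 by (intro divide_left_mono) auto
    then show ?thesis by simp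
  qed
  have e: "- (norm \<xi> powr (2 * s) / (2 * s)) + norm \<xi> powr (2 * s) / (4 * s) = - (norm \<xi> powr (2 * s) / (4 * s))"
    using s by (simp add: field_simps)
  then have ek: "- (norm \<xi> powr (2 * s) / (2 * s)) + \<kappa> \<xi> \<le> - (norm \<xi> powr (2 * s) / (4 * s))"
    using k2 by linarith
  then show ?th2 using fourier_low(2)[OF \<xi>1] by (meson exp_le_cancel_iff order_trans)
  have "exp (- (norm \<xi> powr (2 * s) / (2 * s))) * (\<kappa> \<xi> * exp (\<kappa> \<xi>)) = \<kappa> \<xi> * exp (- (norm \<xi> powr (2 * s) / (2 * s)) + \<kappa> \<xi>)"
    unfolding exp_add by simp
  also have "\<dots> \<le> C0 * \<epsilon> powr \<delta> * norm \<xi> powr (2 * s + \<delta>) * exp (- (norm \<xi> powr (2 * s) / (4 * s)))"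
    using k1 ek C0 by (intro mult_mono) auto
  finally show ?th1 using fourier_low(1)[OF \<xi>1] by linarith
qed

text \<open>By the expansion at a point of norm \<open>r\<close>, no direction can carry almost no mass of \<open>J\<close>;
  this replaces a bound on the Fourier transform of \<open>J\<close> away from 0, which need not be uniform.\<close>

lemma directional_mass:
  assumes r: "C0 * r powr \<delta> \<le> 1 / 2" "0 < r" "r \<le> 1" and \<omega>: "norm \<omega> = 1"
  shows "r\<^sup>2 / 8 \<le> (\<integral>x. J x * indicator {x. 1 / 2 \<le> \<bar>x \<bullet> \<omega>\<bar>} x \<partial>lborel)"
proof -
  note Ji = prob_densityD(3)[OF J] and [measurable] = prob_densityD(1)[OF J]
  have "C0 * r powr (2 * s + \<delta>) = (C0 * r powr \<delta>) * r powr (2 * s)"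
    by (simp add: powr_add)
  also have "\<dots> \<le> 1 / 2 * r powr (2 * s)" using r by (intro mult_right_mono) auto
  finally have 1: "cmod (fourier J (r *\<^sub>R \<omega>) - complex_of_real (1 - r powr (2 * s))) \<le> 1 / 2 * r powr (2 * s)"
    using expansion[of "r *\<^sub>R \<omega>"] r \<omega> by simp
  \<comment> \<open>As r \<le> 1 and 2s < 2, passing to r^2 removes s from the bound.\<close>
  have "r powr 2 \<le> r powr (2 * s)" using r s by (intro powr_mono') auto
  with r have r2: "r\<^sup>2 \<le> r powr (2 * s)" by simp
  have "Re (fourier J (r *\<^sub>R \<omega>)) \<le> 1 - r\<^sup>2 / 2"
    using order_trans[OF complex_Re_le_cmod 1] r2 by simp
  moreover have Ri: "integrable lborel (\<lambda>x. J x * Re (1 * cis (- (x \<bullet> (r *\<^sub>R \<omega>)))))"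
    by (rule Bochner_Integration.integrable_bound[OF Ji]) (auto simp: abs_mult mult_left_le)
  moreover have Ii: "integrable lborel (\<lambda>x. J x * indicator {x. 1 / 2 \<le> \<bar>x \<bullet> \<omega>\<bar>} x)"
    by (rule integrable_mult_indicator[OF _ Ji, simplified mult.commute real_scaleR_def]) measurable
  moreover have "(\<integral>x. J x - J x * Re (1 * cis (- (x \<bullet> (r *\<^sub>R \<omega>)))) \<partial>lborel) \<le>
     (\<integral>x. 2 * (J x * indicator {x. 1 / 2 \<le> \<bar>x \<bullet> \<omega>\<bar>} x) + r\<^sup>2 / 8 * J x \<partial>lborel)"
  proof (rule integral_mono)
    fix x :: 'a
    \<comment> \<open>Inside the slab |x . \<omega>| < 1/2 the phase is below r/2 and the quadratic
      bound gives r^2/8; outside it 1 - cos is at most 2. Compared with the lower bound r^2/2 for 1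
      - Re, the outer mass is at least 3 r^2/16, which exceeds r^2/8.\<close>
    have "1 - cos (r * (x \<bullet> \<omega>)) \<le> 2 * indicator {x. 1 / 2 \<le> \<bar>x \<bullet> \<omega>\<bar>} x + r\<^sup>2 / 8"
    proof (cases "1 / 2 \<le> \<bar>x \<bullet> \<omega>\<bar>")
      case True
      then show ?thesis using cos_ge_minus_one[of "r * (x \<bullet> \<omega>)"] zero_le_power2[of r]
        by (simp only: indicator_simps mem_Collect_eq if_True)
    next
      case False
      then have "(x \<bullet> \<omega>)\<^sup>2 \<le> (1 / 2)\<^sup>2" by (intro power2_le_iff_abs_le[THEN iffD2]) auto
      then have "r\<^sup>2 * (x \<bullet> \<omega>)\<^sup>2 \<le> r\<^sup>2 * (1 / 2)\<^sup>2" by (intro mult_left_mono) auto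
      then have "1 - r\<^sup>2 / 8 \<le> 1 - (r * (x \<bullet> \<omega>))\<^sup>2 / 2" by (simp add: power_mult_distrib power2_eq_square)
      also have "\<dots> \<le> cos (r * (x \<bullet> \<omega>))" by (rule cos_ge_one_minus_square_half)
      finally show ?thesis using False by simp
    qed
    then have "J x * (1 - cos (r * (x \<bullet> \<omega>))) \<le> J x * (2 * indicator {x. 1 / 2 \<le> \<bar>x \<bullet> \<omega>\<bar>} x + r\<^sup>2 / 8)"
      using prob_densityD(2)[OF J] by (intro mult_left_mono)
    then show "J x - J x * Re (1 * cis (- (x \<bullet> (r *\<^sub>R \<omega>)))) \<le> 2 * (J x * indicator {x. 1 / 2 \<le> \<bar>x \<bullet> \<omega>\<bar>} x) + r\<^sup>2 / 8 * J x"
      by (simp add: algebra_simps)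
  qed (intro Bochner_Integration.integrable_add Bochner_Integration.integrable_diff integrable_mult_right Ji Ri Ii)+
  ultimately have "Re (fourier J (r *\<^sub>R \<omega>)) \<le> 1 - r\<^sup>2 / 2"
    "1 - Re (fourier J (r *\<^sub>R \<omega>)) \<le> 2 * (\<integral>x. J x * indicator {x. 1 / 2 \<le> \<bar>x \<bullet> \<omega>\<bar>} x \<partial>lborel) + r\<^sup>2 / 8"
    using Re_fourier[OF Ji, of 1 "r *\<^sub>R \<omega>"] prob_densityD(4)[OF J] Ji by simp_all
  then show ?thesis using zero_le_power2[of r] by linarith
qed

text \<open>The ray is cut where \<epsilon> times the frequency equals \<open>r\<close>. Up to there
  the low-frequency bound gives exp (- N r^2/4) with N = \<epsilon>^(-2s). Beyond, the real part of
  the exponent is -N times the J-average of the logarithmic integrals \<open>I\<close>, and these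
  are large on the mass provided by \<open>directional_mass\<close>.\<close>

lemma fourier_high:
  assumes r: "C0 * r powr \<delta> \<le> 1 / 2" "0 < r" "r \<le> 1" and \<xi>: "r \<le> \<epsilon> * norm \<xi>"
  shows "cmod (fourier F \<xi>) \<le> exp (- (\<epsilon> powr (-2 * s) * (r\<^sup>2 / 8 + r ^ 3 / 32 * ln (\<epsilon> * norm \<xi> / r))))"
proof -
  note Ji = prob_densityD(3)[OF J] and [measurable] = prob_densityD(1)[OF J]
  define a where "a = r / (\<epsilon> * norm \<xi>)"
  define N where "N = \<epsilon> powr (-2 * s)"
  define L where "L = ln (1 / a)"
  have pos: "0 < \<epsilon> * norm \<xi>" using r \<xi> by simp
  then have n0: "norm \<xi> > 0" using \<epsilon> by (simp add: zero_less_mult_iff)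
  have a: "0 < a" "a \<le> 1" using r \<xi> pos by (auto simp: a_def field_simps)
  have ae: "\<epsilon> * norm (a *\<^sub>R \<xi>) = r" using pos a n0 \<epsilon> r(2) by (simp add: a_def)
  have L: "0 \<le> L" using a by (simp add: L_def)
  have cb: "\<bar>1 - cos y\<bar> \<le> 2" for y :: real
    using cos_ge_minus_one[of y] cos_le_one[of y] by linarith
  define I where "I x = integral {a..1} (\<lambda>\<rho>. 1 / \<rho> * (1 - cos (\<rho> * (\<epsilon> * (x \<bullet> \<xi>)))))" for x
  have "Re (integral {a..1} (A \<xi>)) = integral {a..1} (\<lambda>\<rho>. Re (A \<xi> \<rho>))"
    using integral_linear[OF integrable_continuous_interval[OF continuous_A[OF a(1)]] bounded_linear_Re, of \<xi>]
    by (simp add: o_def)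
  also have "\<dots> = integral {a..1} (\<lambda>\<rho>. (- N) * (\<integral>x. J x * (1 / \<rho> * (1 - cos (\<rho> * (\<epsilon> * (x \<bullet> \<xi>))))) \<partial>lborel))"
  proof (rule integral_cong)
    fix \<rho>
    have Ri: "integrable lborel (\<lambda>x. J x * Re (1 * cis (- (x \<bullet> ((\<epsilon> * \<rho>) *\<^sub>R \<xi>)))))"
      by (rule Bochner_Integration.integrable_bound[OF Ji]) (auto simp: abs_mult mult_left_le)
    have "(\<integral>x. J x * (1 / \<rho> * (1 - cos (\<rho> * (\<epsilon> * (x \<bullet> \<xi>))))) \<partial>lborel)
       = (\<integral>x. 1 / \<rho> * (J x - J x * Re (1 * cis (- (x \<bullet> ((\<epsilon> * \<rho>) *\<^sub>R \<xi>))))) \<partial>lborel)"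
      by (intro Bochner_Integration.integral_cong) (simp_all add: algebra_simps)
    also have "\<dots> = 1 / \<rho> * (1 - Re (1 * fourier J ((\<epsilon> * \<rho>) *\<^sub>R \<xi>)))"
      by (simp only: integral_mult_right_zero Bochner_Integration.integral_diff[OF Ji Ri] Re_fourier[OF Ji] prob_densityD(4)[OF J])
    finally have *: "(\<integral>x. J x * (1 / \<rho> * (1 - cos (\<rho> * (\<epsilon> * (x \<bullet> \<xi>))))) \<partial>lborel)
       = 1 / \<rho> * (1 - Re (1 * fourier J ((\<epsilon> * \<rho>) *\<^sub>R \<xi>)))" .
    show "Re (A \<xi> \<rho>) = (- N) * (\<integral>x. J x * (1 / \<rho> * (1 - cos (\<rho> * (\<epsilon> * (x \<bullet> \<xi>))))) \<partial>lborel)"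
      unfolding * unfolding A_def N_def times_complex.sel Re_complex_of_real Im_complex_of_real minus_complex.sel
      by (simp add: algebra_simps diff_divide_distrib)
  qed
  also have "\<dots> = (- N) * integral {a..1} (\<lambda>\<rho>. \<integral>x. J x * (1 / \<rho> * (1 - cos (\<rho> * (\<epsilon> * (x \<bullet> \<xi>))))) \<partial>lborel)"
    by (simp only: Henstock_Kurzweil_Integration.integral_mult_right)
  also have "integral {a..1} (\<lambda>\<rho>. \<integral>x. J x * (1 / \<rho> * (1 - cos (\<rho> * (\<epsilon> * (x \<bullet> \<xi>))))) \<partial>lborel)
      = (\<integral>x. J x * I x \<partial>lborel)"
    unfolding I_def
  proof (rule integral_swap_interval[OF Ji, where B = "1 / a * 2", symmetric])
    fix x :: 'a and \<rho> assume "\<rho> \<in> {a..1}"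
    then show "\<bar>1 / \<rho> * (1 - cos (\<rho> * (\<epsilon> * (x \<bullet> \<xi>))))\<bar> \<le> 1 / a * 2"
      unfolding abs_mult using a cb[of "\<rho> * (\<epsilon> * (x \<bullet> \<xi>))"]
      by (intro mult_mono) (auto simp: frac_le)
  qed measurable
  finally have ReA: "Re (integral {a..1} (A \<xi>)) = - (N * (\<integral>x. J x * I x \<partial>lborel))" by simp
  let ?\<omega> = "\<xi> /\<^sub>R norm \<xi>"
  let ?S = "{x. 1 / 2 \<le> \<bar>x \<bullet> ?\<omega>\<bar>}"
  \<comment> \<open>The offset 4/r is 2/(|t| a) at the smallest admissible value |t| a = r/2. While
    L is below it the estimate is negative, and nonnegativity of \<open>I\<close> takes
    over.\<close>
  let ?M = "max 0 (L - 4 / r)"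
  have Ige: "?M * indicator ?S x \<le> I x" for x
  proof -
    have "0 \<le> I x" unfolding I_def using a
      by (intro Henstock_Kurzweil_Integration.integral_nonneg integrable_continuous_interval continuous_intros) auto
    moreover have "L - 4 / r \<le> I x" if "x \<in> ?S"
    proof -
      let ?t = "\<epsilon> * (x \<bullet> \<xi>)"
      have "1 / 2 \<le> \<bar>x \<bullet> \<xi>\<bar> / norm \<xi>" using that n0 by (simp add: field_simps abs_mult)
      then have *: "norm \<xi> \<le> 2 * \<bar>x \<bullet> \<xi>\<bar>" using n0 by (simp add: field_simps)
      have "r / 2 \<le> \<bar>?t\<bar> * a"
      proof -
        have "\<bar>?t\<bar> * a = r * (\<bar>x \<bullet> \<xi>\<bar> / norm \<xi>)" using \<epsilon> n0 by (simp add: a_def abs_mult)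
        moreover have "r * (1 / 2) \<le> r * (\<bar>x \<bullet> \<xi>\<bar> / norm \<xi>)" using * n0 r by (intro mult_left_mono) (auto simp: field_simps)
        ultimately show ?thesis by simp
      qed
      then have "2 / (\<bar>?t\<bar> * a) \<le> 2 / (r / 2)" using r by (intro divide_left_mono) auto
      moreover have "?t \<noteq> 0" using * n0 \<epsilon> by auto
      ultimately show ?thesis
        using one_minus_cos_over_integral_ge[OF a, of ?t] unfolding I_def L_def by simp
    qed
    ultimately show ?thesis by (auto simp: indicator_def)
  qed
  have Ib: "\<bar>I x\<bar> \<le> (1 / a * 2) * (1 - a)" for x
    unfolding I_def real_norm_def[symmetric]
  proof (rule integral_bound[OF a(2)])
    fix \<rho> assume "\<rho> \<in> {a..1}"
    then show "norm (1 / \<rho> * (1 - cos (\<rho> * (\<epsilon> * (x \<bullet> \<xi>))))) \<le> 1 / a * 2"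
      unfolding norm_mult using a cb[of "\<rho> * (\<epsilon> * (x \<bullet> \<xi>))"]
      by (intro mult_mono) (auto simp: frac_le)
  qed (use a in \<open>auto intro!: continuous_intros\<close>)
  have Im: "I \<in> borel_measurable borel"
  proof -
    have Ieq: "I = (\<lambda>x. LINT \<rho>:{a..1}|lborel. 1 / \<rho> * (1 - cos (\<rho> * (\<epsilon> * (x \<bullet> \<xi>)))))"
      unfolding I_def
      by (intro ext set_borel_integral_eq_integral(2)[symmetric] borel_integrable_atLeastAtMost')
         (use a in \<open>auto intro!: continuous_intros\<close>)
    show ?thesis unfolding Ieq set_lebesgue_integral_def by measurable
  qed
  have JIi: "integrable lborel (\<lambda>x. J x * I x)"
  proof (rule Bochner_Integration.integrable_bound)
    show "integrable lborel (\<lambda>x. J x * (1 / a * 2 * (1 - a)))" using Ji by simp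
    show "AE x in lborel. norm (J x * I x) \<le> norm (J x * (1 / a * 2 * (1 - a)))"
      unfolding norm_mult real_norm_def[of "I _"]
      by (intro AE_I2 mult_left_mono order_trans[OF Ib]) (use a in \<open>auto simp: abs_mult\<close>)
  qed (use Im in measurable)
  have Ii: "integrable lborel (\<lambda>x. J x * indicator ?S x)"
    by (rule integrable_mult_indicator[OF _ Ji, simplified mult.commute real_scaleR_def]) measurable
  have "?M * (r\<^sup>2 / 8) \<le> ?M * (\<integral>x. J x * indicator ?S x \<partial>lborel)"
    using n0 by (intro mult_left_mono directional_mass r) auto
  also have "\<dots> = (\<integral>x. J x * (?M * indicator ?S x) \<partial>lborel)"
    by (subst integral_mult_right_zero[symmetric]) (simp add: mult_ac)
  also have "\<dots> \<le> (\<integral>x. J x * I x \<partial>lborel)"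
    using Ige prob_densityD(2)[OF J] integrable_mult_right[OF Ii, of ?M]
    by (intro integral_mono JIi mult_left_mono) (simp_all add: mult_ac)
  finally have M: "?M * (r\<^sup>2 / 8) \<le> (\<integral>x. J x * I x \<partial>lborel)" .
  \<comment> \<open>The slope is lowered from r^2/8 to r^3/32 so that the offset 4/r costs exactly
    r^2/8, half of the r^2/4 gained at the start of the segment.\<close>
  have "r ^ 3 / 32 * L - r\<^sup>2 / 8 = r ^ 3 / 32 * (L - 4 / r)"
    using r by (simp add: field_simps power2_eq_square power3_eq_cube)
  also have "\<dots> \<le> r ^ 3 / 32 * ?M" using r by (intro mult_left_mono) auto
  also have "\<dots> \<le> r\<^sup>2 / 8 * ?M"
  proof (rule mult_right_mono)
    have "r ^ 3 \<le> r\<^sup>2" using r power_decreasing[of 2 3 r] by simp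
    then show "r ^ 3 / 32 \<le> r\<^sup>2 / 8" using zero_le_power2[of r] by linarith
  qed simp
  finally have M': "r ^ 3 / 32 * L - r\<^sup>2 / 8 \<le> (\<integral>x. J x * I x \<partial>lborel)" using M by (simp add: mult.commute)
  have N: "0 \<le> N" by (simp add: N_def)
  have "cmod (fourier F (a *\<^sub>R \<xi>)) \<le> exp (- (norm (a *\<^sub>R \<xi>) powr (2 * s) / (4 * s)))"
    by (rule fourier_low_small(2)[OF r(1) _ r(3)]) (use ae in simp)
  also have "norm (a *\<^sub>R \<xi>) = r / \<epsilon>" using ae \<epsilon> by (simp add: field_simps)
  also have "(r / \<epsilon>) powr (2 * s) = N * r powr (2 * s)"
    using r \<epsilon> by (simp add: N_def powr_divide powr_minus field_simps)
  also have "exp (- (N * r powr (2 * s) / (4 * s))) \<le> exp (- (N * (r\<^sup>2 / 4)))"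
  proof -
    have "r powr 2 \<le> r powr (2 * s)" using r s by (intro powr_mono') auto
    then have "r\<^sup>2 \<le> r powr (2 * s)" using r by simp
    then have "r\<^sup>2 / 4 \<le> r powr (2 * s) / (4 * s)"
      using s by (intro frac_le) auto
    then have "N * (r\<^sup>2 / 4) \<le> N * (r powr (2 * s) / (4 * s))" using N by (intro mult_left_mono)
    then show ?thesis by simp
  qed
  finally have F1: "cmod (fourier F (a *\<^sub>R \<xi>)) \<le> exp (- (N * (r\<^sup>2 / 4)))" .
  have "cmod (fourier F \<xi>) = cmod (fourier F (a *\<^sub>R \<xi>)) * exp (- (N * (\<integral>x. J x * I x \<partial>lborel)))"
    unfolding fourier_eq[OF a, of \<xi>] norm_mult norm_exp_eq_Re ReA ..
  also have "\<dots> \<le> exp (- (N * (r\<^sup>2 / 4))) * exp (- (N * (r ^ 3 / 32 * L - r\<^sup>2 / 8)))"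
    using F1 M' N by (intro mult_mono) (auto intro: mult_left_mono)
  also have "\<dots> = exp (- (N * (r\<^sup>2 / 8 + r ^ 3 / 32 * L)))"
    by (simp add: exp_add[symmetric] algebra_simps)
  also have "L = ln (\<epsilon> * norm \<xi> / r)" by (simp add: L_def a_def)
  finally show ?thesis unfolding N_def .
qed

end

section \<open>Bounds uniform in the parameters\<close>

lemma minus_1_le_powr:
  fixes n p :: real
  assumes "0 \<le> n" "1 \<le> p"
  shows "n - 1 \<le> n powr p"
proof (cases "n \<le> 1")
  case False
  then have "n powr 1 \<le> n powr p" using assms by (intro powr_mono) auto
  then show ?thesis using False by simp
qed (simp add: order_trans[OF _ powr_ge_zero])

lemma H1_uniform:
  fixes J :: "real \<Rightarrow> 'a::euclidean_space \<Rightarrow> real"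
  assumes "H1 J \<delta>"
  obtains C0 r where "0 < \<delta>" "0 < C0" "0 < r" "r \<le> 1" "C0 * r powr \<delta> \<le> 1 / 2"
    "\<And>\<epsilon> s F. \<lbrakk>nonlocal_equilibrium \<epsilon> s (J s) F; 0 < \<epsilon>; \<epsilon> \<le> 1; 1/2 < s; s < 1\<rbrakk>
       \<Longrightarrow> nonlocal_rescaled (J s) F \<epsilon> s \<delta> C0"
proof -
  have \<delta>: "0 < \<delta>" and J: "\<And>s. s \<in> {1/2<..<1} \<Longrightarrow> prob_density (J s)"
    using assms by (auto simp: H1_def)
  obtain C0 where C0: "C0 > 0" "\<And>s \<xi>. s \<in> {1/2<..<1} \<Longrightarrow> norm \<xi> \<le> 1 \<Longrightarrow>
        cmod (fourier (J s) \<xi> - complex_of_real (1 - norm \<xi> powr (2 * s))) \<le> C0 * norm \<xi> powr (2 * s + \<delta>)"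
    using assms unfolding H1_def by blast
  \<comment> \<open>The largest radius up to 1 with C0 r^\<delta> \<le> 1/2. It is determined by
    \<delta> and \<open>C0\<close>, hence common to all s.\<close>
  define r where "r = min 1 ((1 / (2 * C0)) powr (1 / \<delta>))"
  have r: "0 < r" "r \<le> 1" using C0(1) by (auto simp: r_def)
  have "r powr \<delta> \<le> ((1 / (2 * C0)) powr (1 / \<delta>)) powr \<delta>"
    using \<delta> r by (intro powr_mono2) (auto simp: r_def)
  also have "\<dots> = 1 / (2 * C0)" using C0(1) \<delta> by (simp add: powr_powr)
  finally have "C0 * r powr \<delta> \<le> 1 / 2" using C0(1) by (simp add: field_simps)
  then show thesis
    using that[OF \<delta> C0(1) r] C0 J \<delta> by (auto simp: nonlocal_rescaled_def)
qed

text \<open>Decay at a rate independent of s: n^(2s) \<ge> n - 1 because 2s > 1, and s < 1 bounds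
  the denominators by 2 and 4. Passing from n - 1 to 1 + n produces the constant factors.\<close>

lemma stable_decay:
  fixes n s :: real
  assumes "0 \<le> n" "1/2 < s" "s < 1"
  shows "exp (- (n powr (2 * s) / (2 * s))) \<le> exp 1 * exp (- (1 / 2 * (1 + n)))"
    and "exp (- (n powr (2 * s) / (4 * s))) \<le> exp (1 / 2) * exp (- (1 / 4 * (1 + n)))"
proof -
  have p: "n - 1 \<le> n powr (2 * s)" using assms by (intro minus_1_le_powr) auto
  have "n powr (2 * s) / 2 \<le> n powr (2 * s) / (2 * s)"
    by (rule divide_left_mono) (use assms in auto)
  moreover have "n powr (2 * s) / 4 \<le> n powr (2 * s) / (4 * s)"
    by (rule divide_left_mono) (use assms in auto)
  ultimately have "- (n powr (2 * s) / (2 * s)) \<le> 1 + - (1 / 2 * (1 + n))"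
    "- (n powr (2 * s) / (4 * s)) \<le> 1 / 2 + - (1 / 4 * (1 + n))"
    using p by (auto simp: algebra_simps)
  then show "exp (- (n powr (2 * s) / (2 * s))) \<le> exp 1 * exp (- (1 / 2 * (1 + n)))"
    "exp (- (n powr (2 * s) / (4 * s))) \<le> exp (1 / 2) * exp (- (1 / 4 * (1 + n)))"
    unfolding exp_add[symmetric] exp_le_cancel_iff .
qed

text \<open>The weight (1 + |\<xi>|)^(-d) is a convenient square-integrable majorant. In the low
  range exponential decay pays for it. In the high range the two transforms are estimated
  separately, so each of them has to supply its own factor \<epsilon>^\<delta>.\<close>

lemma fourier_difference_bound:
  fixes J :: "real \<Rightarrow> 'a::euclidean_space \<Rightarrow> real"
  assumes hJ: "H1 J \<delta>"
  shows "\<exists>\<epsilon>0>0. \<epsilon>0 \<le> 1 \<and> (\<exists>C>0. \<forall>\<epsilon> s F \<xi>. 0 < \<epsilon> \<longrightarrow> \<epsilon> \<le> \<epsilon>0 \<longrightarrow> 1/2 < s \<longrightarrow> s < 1 \<longrightarrow> nonlocal_equilibrium \<epsilon> s (J s) F \<longrightarrow>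
    cmod (fourier F \<xi> - complex_of_real (exp (- (norm \<xi> powr (2 * s) / (2 * s)))))
      \<le> C * \<epsilon> powr \<delta> * (1 + norm \<xi>) powr (- real DIM('a)))"
proof -
  obtain C0 r where \<delta>: "0 < \<delta>" and C0: "0 < C0" and r: "0 < r" "r \<le> 1" "C0 * r powr \<delta> \<le> 1 / 2"
    and loc: "\<And>\<epsilon> s F. \<lbrakk>nonlocal_equilibrium \<epsilon> s (J s) F; 0 < \<epsilon>; \<epsilon> \<le> 1; 1/2 < s; s < 1\<rbrakk>
       \<Longrightarrow> nonlocal_rescaled (J s) F \<epsilon> s \<delta> C0"
    using H1_uniform[OF hJ] by metis
  define d where "d = real DIM('a)"
  have d: "1 \<le> d" by (simp add: d_def Suc_leI)
  obtain C1 where C1: "C1 > 0" "\<And>u. 0 \<le> u \<Longrightarrow> u powr (2 + \<delta> + d) * exp (- (1 / 4 * u)) \<le> C1"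
    using powr_times_exp_bounded[of "2 + \<delta> + d" "1 / 4"] \<delta> d by auto
  obtain C2 where C2: "C2 > 0" "\<And>u. 0 \<le> u \<Longrightarrow> u powr (d + \<delta>) * exp (- (1 / 2 * u)) \<le> C2"
    using powr_times_exp_bounded[of "d + \<delta>" "1 / 2"] \<delta> d by auto
  obtain C3 where C3: "C3 > 0" "\<And>u. 0 \<le> u \<Longrightarrow> u powr (d + \<delta>) * exp (- (r\<^sup>2 / 8 * u)) \<le> C3"
    using powr_times_exp_bounded[of "d + \<delta>" "r\<^sup>2 / 8"] \<delta> d r by auto
  \<comment> \<open>Makes \<epsilon>^(-2s) r^3/32 at least d, since \<epsilon>^(-2s) \<ge>
    1/\<epsilon> for \<epsilon> \<le> 1 and s > 1/2; the high-frequency bound then decays at least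
    like the power -d of \<epsilon> n / r.\<close>
  define \<epsilon>0 where "\<epsilon>0 = min 1 (r ^ 3 / (32 * d))"
  have \<epsilon>0: "\<epsilon>0 > 0" "\<epsilon>0 \<le> 1" using r d by (auto simp: \<epsilon>0_def)
  define Cl where "Cl = C0 * exp (1 / 2) * C1"
  define Ch where "Ch = C3 * (1 + 1 / r) powr d + exp 1 * C2 * r powr (- \<delta>)"
  have pos: "Cl > 0" "Ch > 0" using C0 C1(1) C2(1) C3(1) r
    by (auto simp: Cl_def Ch_def intro!: add_nonneg_pos mult_pos_pos)
  have main: "cmod (fourier F \<xi> - complex_of_real (exp (- (norm \<xi> powr (2 * s) / (2 * s)))))
      \<le> (Cl + Ch) * \<epsilon> powr \<delta> * (1 + norm \<xi>) powr (- d)"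
    if \<epsilon>: "0 < \<epsilon>" "\<epsilon> \<le> \<epsilon>0" and s: "1/2 < s" "s < 1" and F: "nonlocal_equilibrium \<epsilon> s (J s) F"
    for \<epsilon> s F and \<xi> :: 'a
  proof -
    have \<epsilon>1: "\<epsilon> \<le> 1" using \<epsilon> \<epsilon>0 by simp
    have \<epsilon>r: "\<epsilon> \<le> r ^ 3 / (32 * d)" using \<epsilon> by (simp add: \<epsilon>0_def)
    interpret nonlocal_rescaled "J s" F \<epsilon> s \<delta> C0 by (rule loc[OF F \<epsilon>(1) \<epsilon>1 s])
    define n where "n = norm \<xi>"
    have n: "0 \<le> n" by (simp add: n_def)
    define e where "e = \<epsilon> powr \<delta> * (1 + n) powr (- d)"
    have e: "0 \<le> e" by (simp add: e_def)
    have split: "(1 + n) powr q = (1 + n) powr (q + d) * (1 + n) powr (- d)" for q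
      by (simp add: powr_add[symmetric])
    show ?thesis
    proof (cases "\<epsilon> * n \<le> r")
      case True
      have 1: "n powr (2 * s + \<delta>) \<le> (1 + n) powr (2 + \<delta>)"
        using n s \<delta> by (intro order_trans[OF powr_mono2[of _ n "1 + n"] powr_mono]) auto
      have "cmod (fourier F \<xi> - complex_of_real (exp (- (norm \<xi> powr (2 * s) / (2 * s)))))
        \<le> C0 * \<epsilon> powr \<delta> * n powr (2 * s + \<delta>) * exp (- (n powr (2 * s) / (4 * s)))"
        unfolding n_def by (rule fourier_low_small(1)[OF r(3) _ r(2)]) (use True n_def in simp)
      also have "\<dots> \<le> C0 * \<epsilon> powr \<delta> * (1 + n) powr (2 + \<delta>) * (exp (1 / 2) * exp (- (1 / 4 * (1 + n))))"
        using 1 stable_decay(2)[OF n s] C0 by (intro mult_mono mult_left_mono) auto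
      also have "\<dots> = (C0 * exp (1 / 2) * e) * ((1 + n) powr (2 + \<delta> + d) * exp (- (1 / 4 * (1 + n))))"
        unfolding split[of "2 + \<delta>"] e_def by simp
      also have "\<dots> \<le> (C0 * exp (1 / 2) * e) * C1"
        using C0 e n by (intro mult_left_mono C1) auto
      also have "\<dots> = Cl * e" by (simp add: Cl_def)
      also have "\<dots> \<le> (Cl + Ch) * e" using pos e by (intro mult_right_mono) auto
      finally show ?thesis by (simp add: e_def n_def mult.assoc)
    next
      case False
      then have n0: "0 < n" using r \<epsilon> n by (cases "n = 0") auto
      have "r \<le> \<epsilon> * n" using False by simp
      moreover have "\<epsilon> * n \<le> 1 * n" using \<epsilon>1 n by (intro mult_right_mono) auto
      ultimately have rn: "r \<le> n" by simp
      have rn': "r / \<epsilon> \<le> 1 + n" using False \<epsilon> by (simp add: field_simps)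
      define \<Lambda> where "\<Lambda> = ln (\<epsilon> * n / r)"
      have \<Lambda>: "0 \<le> \<Lambda>" using False r by (simp add: \<Lambda>_def)
      have "\<epsilon> powr (-1) \<le> \<epsilon> powr (-2 * s)" using \<epsilon> \<epsilon>1 s by (intro powr_mono') auto
      then have N: "1 / \<epsilon> \<le> \<epsilon> powr (-2 * s)" using \<epsilon> by (simp add: powr_minus_divide)
      have "d \<le> (1 / \<epsilon>) * (r ^ 3 / 32)"
        using \<epsilon> \<epsilon>r d by (simp add: field_simps)
      from mult_right_mono[OF this \<Lambda>] have "r\<^sup>2 / 8 * (1 / \<epsilon>) + d * \<Lambda> \<le> (1 / \<epsilon>) * (r\<^sup>2 / 8) + (1 / \<epsilon>) * (r ^ 3 / 32) * \<Lambda>"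
        by (simp add: mult.commute[of "r\<^sup>2 / 8"])
      also have "\<dots> = (1 / \<epsilon>) * (r\<^sup>2 / 8 + r ^ 3 / 32 * \<Lambda>)" by (simp add: algebra_simps)
      also have "\<dots> \<le> \<epsilon> powr (-2 * s) * (r\<^sup>2 / 8 + r ^ 3 / 32 * \<Lambda>)"
        using r \<Lambda> by (intro mult_right_mono N) auto
      finally have X: "r\<^sup>2 / 8 * (1 / \<epsilon>) + d * \<Lambda> \<le> \<epsilon> powr (-2 * s) * (r\<^sup>2 / 8 + r ^ 3 / 32 * \<Lambda>)" .
      have "cmod (fourier F \<xi>) \<le> exp (- (\<epsilon> powr (-2 * s) * (r\<^sup>2 / 8 + r ^ 3 / 32 * \<Lambda>)))"
        unfolding \<Lambda>_def n_def by (rule fourier_high[OF r(3,1,2)]) (use False n_def in simp)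
      also have "\<dots> \<le> exp (- (r\<^sup>2 / 8 * (1 / \<epsilon>)) + - (d * \<Lambda>))" using X by simp
      also have "\<dots> = exp (- (r\<^sup>2 / 8 * (1 / \<epsilon>))) * exp (- (d * \<Lambda>))" by (rule exp_add)
      also have "exp (- (d * \<Lambda>)) = (\<epsilon> * n / r) powr (- d)"
        using \<epsilon> n0 r by (simp add: powr_def \<Lambda>_def)
      also have "\<dots> = (1 / \<epsilon>) powr d * n powr (- d) * r powr d"
        using \<epsilon> n0 r by (simp add: powr_mult powr_divide powr_minus field_simps)
      also have "\<dots> \<le> (1 / \<epsilon>) powr d * n powr (- d) * 1"
        using r d by (intro mult_left_mono powr_le1) auto
      also have "n powr (- d) \<le> (1 + 1 / r) powr d * (1 + n) powr (- d)"
      proof -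
        have "(1 + n) powr d \<le> ((1 + 1 / r) * n) powr d"
          using rn r d n by (intro powr_mono2) (auto simp: field_simps)
        also have "\<dots> = (1 + 1 / r) powr d * n powr d" using r n by (simp add: powr_mult)
        finally show ?thesis using n0 by (simp add: powr_minus field_simps)
      qed
      finally have "cmod (fourier F \<xi>) \<le> exp (- (r\<^sup>2 / 8 * (1 / \<epsilon>))) * ((1 / \<epsilon>) powr d * ((1 + 1 / r) powr d * (1 + n) powr (- d)) * 1)"
        by (simp add: mult_left_mono mult_right_mono)
      \<comment> \<open>The loss \<epsilon>^(-d), enlarged by \<epsilon>^(-\<delta>) in order to
        split off \<epsilon>^\<delta>, is absorbed by the factor exp (- r^2/(8 \<epsilon>)) kept
        apart for this purpose.\<close>
      also have "(1 / \<epsilon>) powr d = (1 / \<epsilon>) powr (d + \<delta>) * \<epsilon> powr \<delta>"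
        using \<epsilon> by (simp add: powr_add powr_divide)
      also have "exp (- (r\<^sup>2 / 8 * (1 / \<epsilon>))) * ((1 / \<epsilon>) powr (d + \<delta>) * \<epsilon> powr \<delta> * ((1 + 1 / r) powr d * (1 + n) powr (- d)) * 1)
         = ((1 / \<epsilon>) powr (d + \<delta>) * exp (- (r\<^sup>2 / 8 * (1 / \<epsilon>)))) * ((1 + 1 / r) powr d * e)"
        by (simp add: e_def)
      also have "\<dots> \<le> C3 * ((1 + 1 / r) powr d * e)"
        using e \<epsilon> by (intro mult_right_mono C3) auto
      finally have F1: "cmod (fourier F \<xi>) \<le> C3 * ((1 + 1 / r) powr d * e)" .
      \<comment> \<open>For the stable profile \<epsilon>^\<delta> comes from 1 + n \<ge>
        r/\<epsilon>, at the price of \<delta> extra powers of 1 + n.\<close>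
      have "exp (- (n powr (2 * s) / (2 * s))) \<le> exp 1 * exp (- (1 / 2 * (1 + n)))"
        by (rule stable_decay(1)[OF n s])
      also have "\<dots> = exp 1 * ((1 + n) powr (d + \<delta>) * exp (- (1 / 2 * (1 + n)))) * ((1 + n) powr (- \<delta>) * (1 + n) powr (- d))"
        using n by (simp add: powr_add powr_minus field_simps)
      also have "\<dots> \<le> exp 1 * C2 * (r powr (- \<delta>) * \<epsilon> powr \<delta> * (1 + n) powr (- d))"
      proof (intro mult_mono mult_left_mono C2)
        have "(1 + n) powr (- \<delta>) \<le> (r / \<epsilon>) powr (- \<delta>)"
          using rn' r \<epsilon> \<delta> by (intro powr_mono2') auto
        also have "\<dots> = r powr (- \<delta>) * \<epsilon> powr \<delta>" using r \<epsilon> by (simp add: powr_divide powr_minus field_simps)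
        finally show "(1 + n) powr (- \<delta>) \<le> r powr (- \<delta>) * \<epsilon> powr \<delta>" .
      qed (use n C2 in auto)
      finally have F2: "exp (- (n powr (2 * s) / (2 * s))) \<le> exp 1 * C2 * r powr (- \<delta>) * e"
        by (simp add: e_def)
      have "cmod (fourier F \<xi> - complex_of_real (exp (- (norm \<xi> powr (2 * s) / (2 * s)))))
        \<le> cmod (fourier F \<xi>) + exp (- (n powr (2 * s) / (2 * s)))"
        by (rule order_trans[OF norm_triangle_ineq4]) (simp add: n_def)
      also have "\<dots> \<le> Ch * e" using F1 F2 by (simp add: Ch_def algebra_simps)
      also have "\<dots> \<le> (Cl + Ch) * e" using pos e by (intro mult_right_mono) auto
      finally show ?thesis by (simp add: e_def n_def mult.assoc)
    qed
  qed
  have "Cl + Ch > 0" using pos by simp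
  with main \<epsilon>0 show ?thesis unfolding d_def by blast
qed

text \<open>A linear bound is what moments of order below 1 require. For small frequencies
  |\<xi>|^(2s) \<le> |\<xi>| since 2s > 1; beyond \<open>r\<close> the trivial bound 2 is at most 2
  |\<xi>| / r. It covers all \<epsilon> up to 1, so the moment bounds also serve above
  \<open>\<epsilon>0\<close>.\<close>

lemma fourier_near_zero_bound:
  fixes J :: "real \<Rightarrow> 'a::euclidean_space \<Rightarrow> real"
  assumes hJ: "H1 J \<delta>"
  shows "\<exists>C>0. \<forall>\<epsilon> s F \<xi>. 0 < \<epsilon> \<longrightarrow> \<epsilon> \<le> 1 \<longrightarrow> 1/2 < s \<longrightarrow> s < 1 \<longrightarrow> nonlocal_equilibrium \<epsilon> s (J s) F \<longrightarrow>
    1 - Re (fourier F \<xi>) \<le> C * norm \<xi>"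
proof -
  obtain C0 r where \<delta>: "0 < \<delta>" and C0: "0 < C0" and r: "0 < r" "r \<le> 1" "C0 * r powr \<delta> \<le> 1 / 2"
    and loc: "\<And>\<epsilon> s F. \<lbrakk>nonlocal_equilibrium \<epsilon> s (J s) F; 0 < \<epsilon>; \<epsilon> \<le> 1; 1/2 < s; s < 1\<rbrakk>
       \<Longrightarrow> nonlocal_rescaled (J s) F \<epsilon> s \<delta> C0"
    using H1_uniform[OF hJ] by metis
  have main: "1 - Re (fourier F \<xi>) \<le> (1 + C0 + 2 / r) * norm \<xi>"
    if \<epsilon>: "0 < \<epsilon>" "\<epsilon> \<le> 1" and s: "1/2 < s" "s < 1" and F: "nonlocal_equilibrium \<epsilon> s (J s) F"
    for \<epsilon> s F and \<xi> :: 'a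
  proof -
    interpret nonlocal_rescaled "J s" F \<epsilon> s \<delta> C0 by (rule loc[OF F \<epsilon> s])
    define n where "n = norm \<xi>"
    have n: "0 \<le> n" by (simp add: n_def)
    show ?thesis
    proof (cases "n \<le> r")
      case True
      have "\<epsilon> * n \<le> 1 * r" using True \<epsilon> r n by (intro mult_mono) auto
      then have "cmod (fourier F \<xi> - complex_of_real (exp (- (n powr (2 * s) / (2 * s)))))
        \<le> C0 * \<epsilon> powr \<delta> * n powr (2 * s + \<delta>) * exp (- (n powr (2 * s) / (4 * s)))"
        unfolding n_def by (intro fourier_low_small(1)[OF r(3) _ r(2)]) simp
      also have "\<dots> \<le> C0 * 1 * n powr 1 * 1"
        using C0 \<epsilon> s \<delta> n True r by (intro mult_mono powr_le1 powr_mono') auto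
      also have "\<dots> = C0 * n" using n by simp
      finally have 1: "cmod (fourier F \<xi> - complex_of_real (exp (- (n powr (2 * s) / (2 * s))))) \<le> C0 * n" .
      have "1 + - (n powr (2 * s) / (2 * s)) \<le> exp (- (n powr (2 * s) / (2 * s)))" by (rule exp_ge_add_one_self)
      moreover have "n powr (2 * s) / (2 * s) \<le> n powr (2 * s) / 1"
        using s by (intro divide_left_mono) auto
      moreover have "n powr (2 * s) \<le> n powr 1" using n s True r by (intro powr_mono') auto
      ultimately have "1 - n \<le> exp (- (n powr (2 * s) / (2 * s)))" using n by simp
      moreover have "exp (- (n powr (2 * s) / (2 * s))) - Re (fourier F \<xi>) \<le> C0 * n"
        using order_trans[OF abs_Re_le_cmod 1] by simp
      ultimately have "1 - Re (fourier F \<xi>) \<le> (1 + C0) * n" by (simp add: algebra_simps)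
      also have "\<dots> \<le> (1 + C0 + 2 / r) * n" using r n by (intro mult_right_mono) auto
      finally show ?thesis by (simp add: n_def)
    next
      case False
      have "1 - Re (fourier F \<xi>) \<le> 2"
        using order_trans[OF abs_Re_le_cmod norm_fourier_le_1[OF local.F, of \<xi>]] by simp
      also have "\<dots> \<le> 2 / r * n" using False r by (simp add: field_simps)
      also have "\<dots> \<le> (1 + C0 + 2 / r) * n" using C0 n by (intro mult_right_mono) auto
      finally show ?thesis by (simp add: n_def)
    qed
  qed
  have "1 + C0 + 2 / r > 0" using C0 r by (simp add: add_pos_pos)
  with main show ?thesis by blast
qed

section \<open>Moments from the Fourier transform near zero\<close>

text \<open>Any q in [0, 1] satisfies q \<le> q^p for p \<le> 1; this is applied to the shares
  u/(u+v) and v/(u+v), which add up to 1.\<close>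

lemma powr_add_le:
  fixes u v p :: real
  assumes "0 \<le> u" "0 \<le> v" "0 \<le> p" "p \<le> 1"
  shows "(u + v) powr p \<le> u powr p + v powr p"
proof (cases "u + v = 0")
  case False
  have *: "x / (u + v) * (u + v) powr p \<le> x powr p" if "0 \<le> x" "x \<le> u + v" for x
  proof (cases "x = 0")
    case x: False
    have "(x / (u + v)) powr 1 \<le> (x / (u + v)) powr p"
      using that assms x by (intro powr_mono') (auto simp: divide_simps)
    then have "x / (u + v) * (u + v) powr p \<le> (x / (u + v)) powr p * (u + v) powr p"
      using that x by (intro mult_right_mono) auto
    also have "\<dots> = x powr p" using that x by (simp add: powr_divide)
    finally show ?thesis .
  qed simp
  have "(u + v) powr p = u / (u + v) * (u + v) powr p + v / (u + v) * (u + v) powr p"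
    using False by (simp add: add_divide_distrib[symmetric] distrib_right[symmetric])
  then show ?thesis using *[of u] *[of v] assms by simp
qed (use assms in auto)

lemma powr_add_sum_le:
  fixes u :: "'i \<Rightarrow> real"
  assumes "finite I" "0 \<le> c" "\<And>i. i \<in> I \<Longrightarrow> 0 \<le> u i" "0 \<le> p" "p \<le> 1"
  shows "(c + sum u I) powr p \<le> c powr p + (\<Sum>i\<in>I. u i powr p)"
  using assms(1,3)
proof (induction I rule: finite_induct)
  case (insert i I)
  have "(c + sum u (insert i I)) powr p = ((c + sum u I) + u i) powr p"
    using insert by (simp add: add_ac)
  also have "\<dots> \<le> (c + sum u I) powr p + u i powr p"
    using insert assms by (intro powr_add_le add_nonneg_nonneg sum_nonneg) auto
  finally show ?case using insert by simp
qed auto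

text \<open>Subadditivity of the power m/2 splits the weight into coordinates, so the moment can be
  read off the transform on the coordinate axes.\<close>

lemma weight_le_sum:
  fixes x :: "'a::euclidean_space"
  assumes "0 \<le> m" "m \<le> 1"
  shows "(1 + (norm x)\<^sup>2) powr (m / 2) \<le> 1 + (\<Sum>b\<in>Basis. \<bar>x \<bullet> b\<bar> powr m)"
proof -
  have "(norm x)\<^sup>2 = (\<Sum>b\<in>Basis. (x \<bullet> b)\<^sup>2)"
    unfolding power2_norm_eq_inner by (subst euclidean_inner) (simp add: power2_eq_square)
  then have "(1 + (norm x)\<^sup>2) powr (m / 2) \<le> 1 powr (m / 2) + (\<Sum>b\<in>Basis. (x \<bullet> b)\<^sup>2 powr (m / 2))"
    using powr_add_sum_le[of Basis 1 "\<lambda>b. (x \<bullet> b)\<^sup>2" "m / 2"] assms by simp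
  moreover have "(x \<bullet> b)\<^sup>2 powr (m / 2) = \<bar>x \<bullet> b\<bar> powr m" for b
  proof (cases "x \<bullet> b = 0")
    case False
    then have "(x \<bullet> b)\<^sup>2 = \<bar>x \<bullet> b\<bar> powr 2" by simp
    then show ?thesis by (simp only: powr_powr) simp
  qed simp
  ultimately show ?thesis by simp
qed

section \<open>The kernel t^(-1-m) (1 - cos (t a)) and coordinate moments\<close>

lemma cos_half_less_1: "cos (1 / 2 :: real) < 1"
  using cos_monotone_0_pi[of 0 "1/2"] pi_gt3 by simp

text \<open>By scaling, the integral of the kernel over all t > 0 is a multiple of |a|^m. Only the
  piece with t |a| in [1/2, 1] is kept: there 1 - cos is at least 1 - cos (1/2), the power is at
  least |a|^(1+m), and the length is 1/(2 |a|). For |a| \<ge> 1 this piece lies in (0, 1].\<close>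

lemma moment_kernel_ge:
  fixes a m :: real
  assumes "1 \<le> \<bar>a\<bar>" "0 < m"
  shows "ennreal ((1 - cos (1/2)) / 2 * \<bar>a\<bar> powr m)
    \<le> (\<integral>\<^sup>+ t. ennreal (indicator {0<..1} t * (t powr (-1 - m) * (1 - cos (t * a)))) \<partial>lborel)"
proof -
  let ?I = "{1 / (2 * \<bar>a\<bar>)..1 / \<bar>a\<bar>}"
  let ?c = "(1 - cos (1/2)) * \<bar>a\<bar> powr (1 + m)"
  have a0: "0 < \<bar>a\<bar>" using assms by simp
  have "ennreal ((1 - cos (1/2)) / 2 * \<bar>a\<bar> powr m) = ennreal ?c * emeasure lborel ?I"
  proof -
    have "1 / (2 * \<bar>a\<bar>) \<le> 1 / \<bar>a\<bar>" using a0 by (simp add: field_simps)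
    then have "emeasure lborel ?I = ennreal (1 / (2 * \<bar>a\<bar>))"
      using a0 by (simp add: field_simps)
    moreover have "?c * (1 / (2 * \<bar>a\<bar>)) = (1 - cos (1/2)) / 2 * \<bar>a\<bar> powr m"
      using a0 by (simp add: powr_add)
    ultimately show ?thesis using cos_half_less_1
      by (simp add: ennreal_mult[symmetric])
  qed
  also have "\<dots> = (\<integral>\<^sup>+ t. ennreal ?c * indicator ?I t \<partial>lborel)"
    by (rule nn_integral_cmult_indicator[symmetric]) simp
  also have "\<dots> \<le> (\<integral>\<^sup>+ t. ennreal (indicator {0<..1} t * (t powr (-1 - m) * (1 - cos (t * a)))) \<partial>lborel)"
  proof (rule nn_integral_mono)
    fix t :: real
    show "ennreal ?c * indicator ?I t \<le> ennreal (indicator {0<..1} t * (t powr (-1 - m) * (1 - cos (t * a))))"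
    proof (cases "t \<in> ?I")
      case True
      then have t: "1 / (2 * \<bar>a\<bar>) \<le> t" "t \<le> 1 / \<bar>a\<bar>" by auto
      moreover have "1 / (2 * \<bar>a\<bar>) > 0" using a0 by simp
      ultimately have t0: "0 < t" by linarith
      have "1 / \<bar>a\<bar> \<le> 1" using assms by simp
      with t(2) have t1: "t \<le> 1" by linarith
      have "cos (t * \<bar>a\<bar>) \<le> cos (1 / 2)"
        using t a0 pi_gt3 by (intro cos_monotone_0_pi_le) (auto simp: field_simps)
      moreover have "cos (t * \<bar>a\<bar>) = cos (t * a)" by (cases "a \<ge> 0") auto
      moreover have "\<bar>a\<bar> powr (1 + m) \<le> t powr (-1 - m)"
      proof -
        have "(1 / \<bar>a\<bar>) powr (- (1 + m)) \<le> t powr (- (1 + m))"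
          using t t0 assms by (intro powr_mono2') auto
        moreover have "(1 / \<bar>a\<bar>) powr (- (1 + m)) = \<bar>a\<bar> powr (1 + m)"
          using a0 by (simp only: powr_divide powr_minus_divide) simp
        ultimately show ?thesis by simp
      qed
      ultimately have "\<bar>a\<bar> powr (1 + m) * (1 - cos (1 / 2)) \<le> t powr (-1 - m) * (1 - cos (t * a))"
        using cos_half_less_1 by (intro mult_mono) auto
      then show ?thesis using True t0 t1 by (simp add: mult.commute ennreal_leI)
    qed simp
  qed
  finally show ?thesis .
qed

text \<open>Where |x . b| \<ge> 1 the power is replaced by the kernel integral, elsewhere by 1.
  After Tonelli the inner integral is t^(-1-m) (1 - Re fourier f (t b)) \<le> C t^(-m), integrable
  at 0 because m < 1. Nonnegative integrals are used throughout, as finiteness of the moment is part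
  of the claim.\<close>

lemma coordinate_moment_bound:
  fixes f :: "'a::euclidean_space \<Rightarrow> real"
  assumes f: "prob_density f" and m: "0 < m" "m < 1" and C: "0 \<le> C"
    and near0: "\<And>\<xi>. 1 - Re (fourier f \<xi>) \<le> C * norm \<xi>" and b: "norm b = 1"
  shows "(\<integral>\<^sup>+ x. ennreal (\<bar>x \<bullet> b\<bar> powr m * f x) \<partial>lborel)
    \<le> ennreal (1 + 2 / (1 - cos (1/2)) * (C / (1 - m)))"
proof -
  note [measurable] = prob_densityD(1)[OF f] and fi = prob_densityD(3)[OF f] and f0 = prob_densityD(2)[OF f]
  let ?c = "2 / (1 - cos (1/2 :: real))"
  have c: "0 < ?c" using cos_half_less_1 by simp
  define k where "k t a = indicator {0<..1} t * (t powr (-1 - m) * (1 - cos (t * a)))" for t a :: real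
  have k0: "0 \<le> k t a" for t a by (simp add: k_def)
  have [measurable]: "(\<lambda>(t, a). k t a) \<in> borel_measurable (borel \<Otimes>\<^sub>M borel)" unfolding k_def by measurable
  have "(\<integral>\<^sup>+ x. ennreal (\<bar>x \<bullet> b\<bar> powr m * f x) \<partial>lborel)
    \<le> (\<integral>\<^sup>+ x. ennreal (f x) + ennreal ?c * (\<integral>\<^sup>+ t. ennreal (f x * k t (x \<bullet> b)) \<partial>lborel) \<partial>lborel)"
  proof (rule nn_integral_mono)
    fix x
    show "ennreal (\<bar>x \<bullet> b\<bar> powr m * f x) \<le> ennreal (f x) + ennreal ?c * (\<integral>\<^sup>+ t. ennreal (f x * k t (x \<bullet> b)) \<partial>lborel)"
    proof (cases "1 \<le> \<bar>x \<bullet> b\<bar>")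
      case False
      then have "\<bar>x \<bullet> b\<bar> powr m \<le> 1" using m by (intro powr_le1) auto
      then have "\<bar>x \<bullet> b\<bar> powr m * f x \<le> 1 * f x" using f0 by (intro mult_right_mono)
      then have "ennreal (\<bar>x \<bullet> b\<bar> powr m * f x) \<le> ennreal (f x)" by (intro ennreal_leI) simp
      then show ?thesis by (meson add_increasing2 zero_le)
    next
      case True
      have "ennreal ((1 - cos (1/2)) / 2 * \<bar>x \<bullet> b\<bar> powr m) \<le> (\<integral>\<^sup>+ t. ennreal (k t (x \<bullet> b)) \<partial>lborel)"
        unfolding k_def using moment_kernel_ge[OF True m(1)] .
      then have "ennreal (f x) * ennreal ((1 - cos (1/2)) / 2 * \<bar>x \<bullet> b\<bar> powr m) \<le> ennreal (f x) * (\<integral>\<^sup>+ t. ennreal (k t (x \<bullet> b)) \<partial>lborel)"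
        by (rule mult_left_mono) simp
      also have "\<dots> = (\<integral>\<^sup>+ t. ennreal (f x * k t (x \<bullet> b)) \<partial>lborel)"
        using f0[of x] k0 by (subst nn_integral_cmult[symmetric]) (auto simp: ennreal_mult)
      finally have "ennreal ?c * (ennreal (f x) * ennreal ((1 - cos (1/2)) / 2 * \<bar>x \<bullet> b\<bar> powr m)) \<le> ennreal ?c * (\<integral>\<^sup>+ t. ennreal (f x * k t (x \<bullet> b)) \<partial>lborel)"
        by (rule mult_left_mono) simp
      moreover have "ennreal ?c * (ennreal (f x) * ennreal ((1 - cos (1/2)) / 2 * \<bar>x \<bullet> b\<bar> powr m)) = ennreal (\<bar>x \<bullet> b\<bar> powr m * f x)"
      proof -
        have "?c * (f x * ((1 - cos (1/2)) / 2 * \<bar>x \<bullet> b\<bar> powr m)) = \<bar>x \<bullet> b\<bar> powr m * f x"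
          using cos_half_less_1 by (simp add: field_simps)
        then show ?thesis using cos_half_less_1 f0[of x] by (simp only: ennreal_mult'[symmetric] mult_nonneg_nonneg ennreal_mult[symmetric] c less_imp_le)
      qed
      ultimately show ?thesis by (simp add: add_increasing)
    qed
  qed
  also have "\<dots> = 1 + ennreal ?c * (\<integral>\<^sup>+ x. \<integral>\<^sup>+ t. ennreal (f x * k t (x \<bullet> b)) \<partial>lborel \<partial>lborel)"
    using f by (subst nn_integral_add) (auto simp: nn_integral_cmult prob_density_def)
  also have "(\<integral>\<^sup>+ x. \<integral>\<^sup>+ t. ennreal (f x * k t (x \<bullet> b)) \<partial>lborel \<partial>lborel)
      = (\<integral>\<^sup>+ t. \<integral>\<^sup>+ x. ennreal (f x * k t (x \<bullet> b)) \<partial>lborel \<partial>lborel)"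
    by (rule lborel_pair.Fubini'[symmetric]) measurable
  also have "\<dots> \<le> (\<integral>\<^sup>+ t. ennreal (C * (indicator {0..1} t * t powr (- m))) \<partial>lborel)"
  proof (rule nn_integral_mono)
    fix t :: real
    show "(\<integral>\<^sup>+ x. ennreal (f x * k t (x \<bullet> b)) \<partial>lborel) \<le> ennreal (C * (indicator {0..1} t * t powr (- m)))"
    proof (cases "t \<in> {0<..1}")
      case True
      have Ri: "integrable lborel (\<lambda>x. f x * Re (1 * cis (- (x \<bullet> (t *\<^sub>R b)))))"
        by (rule Bochner_Integration.integrable_bound[OF fi]) (auto simp: abs_mult mult_left_le)
      have "has_bochner_integral lborel (\<lambda>x. t powr (-1 - m) * (f x - f x * Re (1 * cis (- (x \<bullet> (t *\<^sub>R b))))))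
         (t powr (-1 - m) * (1 - Re (1 * fourier f (t *\<^sub>R b))))"
        using fi Ri prob_densityD(4)[OF f] Re_fourier[OF fi, of 1 "t *\<^sub>R b"] unfolding has_bochner_integral_iff
        by (simp only: integral_mult_right_zero Bochner_Integration.integral_diff[OF fi Ri] integrable_mult_right Bochner_Integration.integrable_diff simp_thms)
      moreover have "t powr (-1 - m) * (f x - f x * Re (1 * cis (- (x \<bullet> (t *\<^sub>R b))))) = f x * k t (x \<bullet> b)" for x
        using True by (simp add: k_def algebra_simps)
      ultimately have "has_bochner_integral lborel (\<lambda>x. f x * k t (x \<bullet> b)) (t powr (-1 - m) * (1 - Re (fourier f (t *\<^sub>R b))))"
        by simp
      then have "(\<integral>\<^sup>+ x. ennreal (f x * k t (x \<bullet> b)) \<partial>lborel) = ennreal (t powr (-1 - m) * (1 - Re (fourier f (t *\<^sub>R b))))"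
        using f0 k0 by (subst nn_integral_eq_integral) (auto simp: has_bochner_integral_iff)
      also have "\<dots> \<le> ennreal (t powr (-1 - m) * (C * t))"
        using near0[of "t *\<^sub>R b"] True b by (intro ennreal_leI mult_left_mono) auto
      also have "t powr (-1 - m) * (C * t) = C * (indicator {0..1} t * t powr (- m))"
        using True powr_add[of t "-1 - m" 1] by simp
      finally show ?thesis .
    next
      case False
      then have "k t a = 0" for a by (simp add: k_def)
      then show ?thesis by simp
    qed
  qed
  also have "\<dots> = ennreal (C * (1 / (1 - m)))"
  proof -
    have "((\<lambda>t. t powr (- m)) has_integral (1 powr (- m + 1) / (- m + 1))) {0..1}"
      using m by (intro has_integral_powr_from_0) auto
    from has_integral_mult_right[OF this, of C]
    have "((\<lambda>t. C * t powr (- m)) has_integral C * (1 / (1 - m))) {0..1}" by simp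
    then have "((\<lambda>t. if t \<in> {0..1} then C * t powr (- m) else 0) has_integral C * (1 / (1 - m))) UNIV"
      by (simp only: has_integral_restrict_UNIV)
    then have "((\<lambda>t. C * (indicator {0..1} t * t powr (- m))) has_integral C * (1 / (1 - m))) UNIV"
      by (rule has_integral_eq[rotated]) (auto simp: indicator_def)
    then show ?thesis using C by (intro nn_integral_has_integral_lborel) auto
  qed
  finally have "(\<integral>\<^sup>+ x. ennreal (\<bar>x \<bullet> b\<bar> powr m * f x) \<partial>lborel) \<le> 1 + ennreal ?c * ennreal (C * (1 / (1 - m)))"
    by (simp add: add_left_mono mult_left_mono)
  also have "\<dots> = ennreal (1 + ?c * (C / (1 - m)))"
    using C m c by (simp add: ennreal_mult[symmetric] ennreal_plus[symmetric] del: ennreal_plus flip: ennreal_1)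
  finally show ?thesis .
qed

lemma L1k_norm_moment_bound:
  fixes f :: "'a::euclidean_space \<Rightarrow> real"
  assumes f: "prob_density f" and m: "0 < m" "m < 1" and C: "0 \<le> C"
    and near0: "\<And>\<xi>. 1 - Re (fourier f \<xi>) \<le> C * norm \<xi>"
  shows "L1k_norm m f \<le> ennreal (1 + real DIM('a) * (1 + 2 / (1 - cos (1/2)) * (C / (1 - m))))"
proof -
  let ?M = "1 + 2 / (1 - cos (1/2)) * (C / (1 - m))"
  note [measurable] = prob_densityD(1)[OF f] and f0 = prob_densityD(2)[OF f]
  have M: "0 \<le> ?M" using cos_half_less_1 C m by (intro add_nonneg_nonneg mult_nonneg_nonneg divide_nonneg_pos) auto
  have "L1k_norm m f \<le> (\<integral>\<^sup>+ x. ennreal (f x) + (\<Sum>b\<in>Basis. ennreal (\<bar>x \<bullet> b\<bar> powr m * f x)) \<partial>lborel)"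
    unfolding L1k_norm_def
  proof (rule nn_integral_mono)
    fix x :: 'a
    have "(1 + (norm x)\<^sup>2) powr (m / 2) * \<bar>f x\<bar> \<le> (1 + (\<Sum>b\<in>Basis. \<bar>x \<bullet> b\<bar> powr m)) * f x"
      unfolding abs_of_nonneg[OF f0] using weight_le_sum[of m x] m f0 by (intro mult_right_mono) auto
    also have "\<dots> = f x + (\<Sum>b\<in>Basis. \<bar>x \<bullet> b\<bar> powr m * f x)" by (simp add: distrib_right sum_distrib_right)
    finally show "ennreal ((1 + (norm x)\<^sup>2) powr (m / 2) * \<bar>f x\<bar>) \<le> ennreal (f x) + (\<Sum>b\<in>Basis. ennreal (\<bar>x \<bullet> b\<bar> powr m * f x))"
      using f0[of x] by (subst sum_ennreal) (auto simp: ennreal_plus[symmetric] sum_nonneg simp del: ennreal_plus intro: ennreal_leI)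
  qed
  also have "\<dots> = 1 + (\<Sum>b\<in>Basis. \<integral>\<^sup>+ x. ennreal (\<bar>x \<bullet> b\<bar> powr m * f x) \<partial>lborel)"
    using f by (subst nn_integral_add) (auto simp: nn_integral_sum prob_density_def simp del: sum_ennreal)
  also have "\<dots> \<le> 1 + (\<Sum>b\<in>(Basis :: 'a set). ennreal ?M)"
    by (intro add_left_mono sum_mono coordinate_moment_bound[OF f m C near0]) simp
  also have "\<dots> = 1 + of_nat DIM('a) * ennreal ?M" by simp
  also have "\<dots> = ennreal (1 + real DIM('a) * ?M)"
    using M by (simp add: ennreal_of_nat_eq_real_of_nat ennreal_mult[symmetric] ennreal_plus[symmetric] del: ennreal_plus flip: ennreal_1)
  finally show ?thesis .
qed

section \<open>Gaussian regularisation and duality\<close>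

lemma lborel_prod:
  fixes f :: "'a::euclidean_space \<Rightarrow> real \<Rightarrow> 'b::{real_normed_field, banach, second_countable_topology}"
  assumes "\<And>b. b \<in> Basis \<Longrightarrow> integrable lborel (f b)"
  shows "integrable lborel (\<lambda>x::'a. \<Prod>b\<in>Basis. f b (x \<bullet> b))" (is ?th1)
    and "(\<integral>x. (\<Prod>b\<in>Basis. f b (x \<bullet> b)) \<partial>lborel) = (\<Prod>b\<in>Basis. \<integral>t. f b t \<partial>lborel)" (is ?th2)
proof -
  interpret product_sigma_finite "\<lambda>b::'a. lborel :: real measure" ..
  have [measurable]: "\<And>b. b \<in> Basis \<Longrightarrow> f b \<in> borel_measurable borel"
    using borel_measurable_integrable[OF assms] by simp
  have meas: "(\<lambda>x::'a. \<Prod>b\<in>Basis. f b (x \<bullet> b)) \<in> borel_measurable borel" by measurable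
  have T: "(\<lambda>g. \<Sum>b\<in>Basis. g b *\<^sub>R b) \<in> (\<Pi>\<^sub>M b\<in>(Basis :: 'a set). (lborel :: real measure)) \<rightarrow>\<^sub>M borel"
    by measurable
  have eq: "(\<Prod>b\<in>Basis. f b ((\<Sum>b\<in>Basis. g b *\<^sub>R b) \<bullet> b)) = (\<Prod>b\<in>Basis. f b (g b))" for g
    by (intro prod.cong refl) simp
  show ?th1
    unfolding lborel_eq[where 'a = 'a] integrable_distr_eq[OF T meas] eq
    by (rule product_integrable_prod) (use assms in auto)
  show ?th2
    unfolding lborel_eq[where 'a = 'a] integral_distr[OF T meas] eq
    by (rule product_integral_prod) (use assms in auto)
qed

section \<open>The Gaussian and its Fourier transform\<close>

definition gauss :: "'a::euclidean_space \<Rightarrow> real" where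
  "gauss x = exp (- ((norm x)\<^sup>2 / 2))"

text \<open>The number (2 pi)^(d/2) is the integral of \<open>gauss\<close> as well as the factor in
  its transform, and its square is the Plancherel constant. The type argument records the
  dimension.\<close>

definition gauss_mass :: "'a::euclidean_space itself \<Rightarrow> real" where
  "gauss_mass _ = sqrt (2 * pi) ^ DIM('a)"

lemma gauss_mass_pos: "0 < gauss_mass TYPE('a::euclidean_space)"
  by (simp add: gauss_mass_def)

lemma gauss_nonneg: "0 \<le> gauss x"
  by (simp add: gauss_def)

lemma gauss_eq_prod: "gauss (x::'a::euclidean_space) = (\<Prod>b\<in>Basis. exp (- ((x \<bullet> b)\<^sup>2 / 2)))"
proof -
  have "(norm x)\<^sup>2 = (\<Sum>b\<in>Basis. (x \<bullet> b)\<^sup>2)"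
    unfolding power2_norm_eq_inner by (subst euclidean_inner) (simp add: power2_eq_square)
  then show ?thesis
    unfolding gauss_def by (simp add: exp_sum[symmetric] sum_negf sum_divide_distrib)
qed

lemma measurable_gauss[measurable]: "(gauss :: 'a::euclidean_space \<Rightarrow> real) \<in> borel_measurable borel"
  unfolding gauss_def by measurable

text \<open>The transform is read off the characteristic function of the standard normal
  distribution.\<close>

lemma gauss_1d:
  "integrable lborel (\<lambda>x::real. exp (- (x\<^sup>2 / 2)))"
  "(\<integral>x. complex_of_real (exp (- (x\<^sup>2 / 2))) * cis (x * t) \<partial>lborel) = complex_of_real (sqrt (2 * pi) * exp (- (t\<^sup>2 / 2)))"
proof -
  have d: "exp (- (x\<^sup>2 / 2)) = sqrt (2 * pi) * std_normal_density x" for x :: real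
    by (simp add: std_normal_density_def)
  show "integrable lborel (\<lambda>x::real. exp (- (x\<^sup>2 / 2)))"
    unfolding d by simp
  have "complex_of_real (exp (- (t\<^sup>2 / 2))) = char std_normal_distribution t"
    by (simp add: char_std_normal_distribution)
  also have "\<dots> = (\<integral>x. std_normal_density x *\<^sub>R cis (t * x) \<partial>lborel)"
    unfolding char_def by (subst integral_density) (auto simp: cis_conv_exp)
  finally have *: "(\<integral>x. std_normal_density x *\<^sub>R cis (t * x) \<partial>lborel) = complex_of_real (exp (- (t\<^sup>2 / 2)))" by simp
  have "(\<integral>x. complex_of_real (exp (- (x\<^sup>2 / 2))) * cis (x * t) \<partial>lborel)
    = (\<integral>x. complex_of_real (sqrt (2 * pi)) * (std_normal_density x *\<^sub>R cis (t * x)) \<partial>lborel)"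
    unfolding d by (intro Bochner_Integration.integral_cong refl) (simp add: scaleR_conv_of_real mult_ac)
  also have "\<dots> = complex_of_real (sqrt (2 * pi)) * complex_of_real (exp (- (t\<^sup>2 / 2)))"
    by (simp only: integral_mult_right_zero *)
  finally show "(\<integral>x. complex_of_real (exp (- (x\<^sup>2 / 2))) * cis (x * t) \<partial>lborel) = complex_of_real (sqrt (2 * pi) * exp (- (t\<^sup>2 / 2)))"
    by simp
qed

lemma integrable_gauss: "integrable lborel (gauss :: 'a::euclidean_space \<Rightarrow> real)"
proof -
  have "integrable lborel (\<lambda>x::'a. \<Prod>b\<in>Basis. exp (- ((x \<bullet> b)\<^sup>2 / 2)))"
    by (rule lborel_prod(1)[where f = "\<lambda>b t. exp (- (t\<^sup>2 / 2))", OF gauss_1d(1)])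
  then show ?thesis unfolding gauss_eq_prod[abs_def] .
qed

lemma fourier_gauss:
  fixes \<xi> :: "'a::euclidean_space"
  shows "(\<integral>x. complex_of_real (gauss x) * cis (x \<bullet> \<xi>) \<partial>lborel) = complex_of_real (gauss_mass TYPE('a) * gauss \<xi>)"
proof -
  have cis_sum: "cis (\<Sum>b\<in>B. h b) = (\<Prod>b\<in>B. cis (h b))" if "finite B" for h :: "'a \<Rightarrow> real" and B
    using that by (induction B) (auto simp: cis_mult[symmetric])
  have "(\<integral>x. complex_of_real (gauss x) * cis (x \<bullet> \<xi>) \<partial>lborel)
    = (\<integral>x. (\<Prod>b\<in>Basis. complex_of_real (exp (- ((x \<bullet> b)\<^sup>2 / 2))) * cis ((x \<bullet> b) * (\<xi> \<bullet> b))) \<partial>lborel)"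
    unfolding gauss_eq_prod
    by (intro Bochner_Integration.integral_cong refl)
       (subst euclidean_inner, simp add: cis_sum prod.distrib)
  also have "\<dots> = (\<Prod>b\<in>Basis. \<integral>t. complex_of_real (exp (- (t\<^sup>2 / 2))) * cis (t * (\<xi> \<bullet> b)) \<partial>lborel)"
  proof (rule lborel_prod(2)[where f = "\<lambda>b t. complex_of_real (exp (- (t\<^sup>2 / 2))) * cis (t * (\<xi> \<bullet> b))"])
    fix b :: 'a
    show "integrable lborel (\<lambda>t. complex_of_real (exp (- (t\<^sup>2 / 2))) * cis (t * (\<xi> \<bullet> b)))"
      by (rule Bochner_Integration.integrable_bound[OF gauss_1d(1)]) (auto simp: norm_mult cis_conv_exp)
  qed
  also have "\<dots> = (\<Prod>b\<in>(Basis :: 'a set). complex_of_real (sqrt (2 * pi) * exp (- ((\<xi> \<bullet> b)\<^sup>2 / 2))))"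
    by (simp only: gauss_1d(2))
  also have "\<dots> = complex_of_real (gauss_mass TYPE('a) * gauss \<xi>)"
    by (simp only: of_real_prod[symmetric] gauss_eq_prod gauss_mass_def) (simp add: prod.distrib)
  finally show ?thesis .
qed

lemma integral_gauss: "(\<integral>x. gauss (x::'a::euclidean_space) \<partial>lborel) = gauss_mass TYPE('a)"
  using fourier_gauss[of "0::'a"] by (simp add: gauss_def of_real_eq_iff flip: of_real_power)

lemma fubini_bounded_kernel:
  fixes u v :: "'a::euclidean_space \<Rightarrow> 'b::{real_normed_field, banach, second_countable_topology}"
    and h :: "'a \<Rightarrow> 'a \<Rightarrow> 'b"
  assumes u: "integrable lborel u" and v: "integrable lborel v"
    and [measurable]: "(\<lambda>(x, y). h x y) \<in> borel_measurable (borel \<Otimes>\<^sub>M borel)" and B: "\<And>x y. norm (h x y) \<le> B"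
  shows "(\<integral>x. u x * (\<integral>y. v y * h x y \<partial>lborel) \<partial>lborel) = (\<integral>y. v y * (\<integral>x. u x * h x y \<partial>lborel) \<partial>lborel)"
proof -
  note [measurable] = borel_measurable_integrable[OF u] borel_measurable_integrable[OF v]
  have "integrable (lborel \<Otimes>\<^sub>M lborel) (\<lambda>(x, y). u x * (v y * h x y))"
  proof (rule Bochner_Integration.integrable_bound[where f = "\<lambda>(x, y). norm (u x) * (norm (v y) * B)"])
    show "integrable (lborel \<Otimes>\<^sub>M lborel) (\<lambda>(x, y). norm (u x) * (norm (v y) * B))"
      using u v by (intro lborel_pair.Fubini_integrable) (auto simp: abs_mult)
    have "B \<ge> 0" using order_trans[OF norm_ge_zero B] by blast
    then show "AE p in lborel \<Otimes>\<^sub>M lborel. norm (case p of (x, y) \<Rightarrow> u x * (v y * h x y)) \<le> norm (case p of (x, y) \<Rightarrow> norm (u x) * (norm (v y) * B))"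
      using B by (intro AE_I2) (auto simp: norm_mult abs_mult intro!: mult_left_mono)
  qed measurable
  from lborel_pair.Fubini_integral[OF this]
  have "(\<integral>y. (\<integral>x. u x * (v y * h x y) \<partial>lborel) \<partial>lborel) = (\<integral>x. (\<integral>y. u x * (v y * h x y) \<partial>lborel) \<partial>lborel)" .
  then have "(\<integral>x. u x * (\<integral>y. v y * h x y \<partial>lborel) \<partial>lborel) = (\<integral>y. (\<integral>x. u x * (v y * h x y) \<partial>lborel) \<partial>lborel)"
    by (simp only: integral_mult_right_zero)
  also have "\<dots> = (\<integral>y. (\<integral>x. v y * (u x * h x y) \<partial>lborel) \<partial>lborel)"
    by (simp only: mult.left_commute)
  finally show ?thesis by (simp only: integral_mult_right_zero)
qed

lemma fourier_gauss_scaled: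
  fixes z :: "'a::euclidean_space"
  assumes \<sigma>: "0 < \<sigma>"
  shows "\<sigma> ^ DIM('a) *\<^sub>R (\<integral>\<xi>. complex_of_real (gauss (\<sigma> *\<^sub>R \<xi>)) * cis (z \<bullet> \<xi>) \<partial>lborel)
     = complex_of_real (gauss_mass TYPE('a) * gauss (z /\<^sub>R \<sigma>))"
proof -
  have "complex_of_real (gauss_mass TYPE('a) * gauss (z /\<^sub>R \<sigma>)) = (\<integral>x. complex_of_real (gauss x) * cis (x \<bullet> (z /\<^sub>R \<sigma>)) \<partial>lborel)"
    by (simp only: fourier_gauss)
  also have "\<dots> = \<bar>\<sigma>\<bar> ^ DIM('a) *\<^sub>R (\<integral>x. complex_of_real (gauss (0 + \<sigma> *\<^sub>R x)) * cis ((0 + \<sigma> *\<^sub>R x) \<bullet> (z /\<^sub>R \<sigma>)) \<partial>lborel)"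
    by (rule lborel_integral_affine) (use \<sigma> in \<open>auto simp: cis_conv_exp\<close>)
  also have "\<dots> = \<sigma> ^ DIM('a) *\<^sub>R (\<integral>\<xi>. complex_of_real (gauss (\<sigma> *\<^sub>R \<xi>)) * cis (z \<bullet> \<xi>) \<partial>lborel)"
  proof -
    have "(0 + \<sigma> *\<^sub>R x) \<bullet> (z /\<^sub>R \<sigma>) = z \<bullet> x" for x
      using \<sigma> by (simp add: inner_commute flip: mult.assoc)
    then show ?thesis using \<sigma> by (simp only: add_0 abs_of_pos)
  qed
  finally show ?thesis by simp
qed

lemma integrable_gauss_scaled:
  assumes "0 < \<sigma>"
  shows "integrable lborel (\<lambda>\<xi>::'a::euclidean_space. gauss (\<sigma> *\<^sub>R \<xi>))"
proof -
  have "integrable (density (distr lborel borel (\<lambda>x::'a. 0 + \<sigma> *\<^sub>R x)) (\<lambda>_. \<bar>\<sigma>\<bar> ^ DIM('a))) gauss"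
    using integrable_gauss lborel_affine[of \<sigma> "0::'a"] assms by simp
  then show ?thesis using assms
    by (subst (asm) integrable_density) (auto simp: integrable_distr_eq)
qed

text \<open>The Gaussian factor makes the frequency integral absolutely convergent although both
  transforms are only known to be bounded. Fubini moves this factor to the space side, where it
  becomes a convolution of \<phi> with a Gaussian of width \<sigma>.\<close>

lemma regularised_parseval:
  fixes f \<phi> :: "'a::euclidean_space \<Rightarrow> real"
  assumes f: "integrable lborel f" and \<phi>: "integrable lborel \<phi>" and \<phi>c: "continuous_on UNIV \<phi>" and \<sigma>: "0 < \<sigma>"
  shows "(\<integral>\<xi>. complex_of_real (gauss (\<sigma> *\<^sub>R \<xi>)) * (cnj (fourier f \<xi>) * fourier \<phi> \<xi>) \<partial>lborel)
     = complex_of_real (gauss_mass TYPE('a) * (\<integral>x. f x * (\<integral>z. \<phi> (x - \<sigma> *\<^sub>R z) * gauss z \<partial>lborel) \<partial>lborel))"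
proof -
  let ?w = "\<lambda>\<xi>::'a. complex_of_real (gauss (\<sigma> *\<^sub>R \<xi>))"
  have [measurable]: "\<phi> \<in> borel_measurable borel" "fourier f \<in> borel_measurable borel" "fourier \<phi> \<in> borel_measurable borel"
    using \<phi>c continuous_on_fourier[OF f] continuous_on_fourier[OF \<phi>] by (auto intro: borel_measurable_continuous_onI)
  note [measurable] = borel_measurable_integrable[OF f]
  have wi: "integrable lborel ?w" using integrable_gauss_scaled[OF \<sigma>] by auto
  have fC: "integrable lborel (\<lambda>x. complex_of_real (f x))" and \<phi>C: "integrable lborel (\<lambda>x. complex_of_real (\<phi> x))"
    using f \<phi> by auto
  have w\<phi>: "integrable lborel (\<lambda>\<xi>. ?w \<xi> * fourier \<phi> \<xi>)"
    by (rule Bochner_Integration.integrable_bound[OF integrable_mult_left[OF wi, of "complex_of_real (\<integral>x. \<bar>\<phi> x\<bar> \<partial>lborel)"]])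
       (auto simp: norm_mult intro!: mult_left_mono norm_fourier_le intro: order_trans[OF _ abs_ge_self])
  have cnjf: "cnj (fourier f \<xi>) = (\<integral>x. complex_of_real (f x) * cis (x \<bullet> \<xi>) \<partial>lborel)" for \<xi>
    unfolding fourier_def
    by (subst Bochner_Integration.integral_cnj[symmetric]) (simp add: cis_cnj mult.commute)
  have cism: "(\<lambda>(x::'a, y::'a). cis (x \<bullet> y)) \<in> borel_measurable (borel \<Otimes>\<^sub>M borel)"
    unfolding cis_conv_exp by measurable
  have cism': "(\<lambda>(x::'a, y::'a). cis (- (y \<bullet> x))) \<in> borel_measurable (borel \<Otimes>\<^sub>M borel)"
    unfolding cis_conv_exp by measurable
  have inner: "(\<integral>\<xi>. (?w \<xi> * fourier \<phi> \<xi>) * cis (x \<bullet> \<xi>) \<partial>lborel)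
      = complex_of_real (gauss_mass TYPE('a) * (\<integral>z. \<phi> (x - \<sigma> *\<^sub>R z) * gauss z \<partial>lborel))" for x
  proof -
    have wx: "integrable lborel (\<lambda>\<xi>. ?w \<xi> * cis (x \<bullet> \<xi>))"
      by (rule Bochner_Integration.integrable_bound[OF wi]) (auto simp: norm_mult cis_conv_exp)
    have "(\<integral>\<xi>. (?w \<xi> * fourier \<phi> \<xi>) * cis (x \<bullet> \<xi>) \<partial>lborel)
      = (\<integral>\<xi>. (?w \<xi> * cis (x \<bullet> \<xi>)) * (\<integral>y. complex_of_real (\<phi> y) * cis (- (y \<bullet> \<xi>)) \<partial>lborel) \<partial>lborel)"
      unfolding fourier_def by (intro Bochner_Integration.integral_cong refl) (simp add: mult_ac)
    also have "\<dots> = (\<integral>y. complex_of_real (\<phi> y) * (\<integral>\<xi>. (?w \<xi> * cis (x \<bullet> \<xi>)) * cis (- (y \<bullet> \<xi>)) \<partial>lborel) \<partial>lborel)"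
      by (rule fubini_bounded_kernel[OF wx \<phi>C cism', where B = 1]) simp
    also have "\<dots> = (\<integral>y. complex_of_real (\<phi> y) * (\<integral>\<xi>. ?w \<xi> * cis ((x - y) \<bullet> \<xi>) \<partial>lborel) \<partial>lborel)"
      by (simp add: mult.assoc cis_mult inner_diff_left)
    \<comment> \<open>Substitution y = x - \<sigma> z; its Jacobian is the factor that normalises
      the scaled Gaussian transform.\<close>
    also have "\<dots> = \<bar>- \<sigma>\<bar> ^ DIM('a) *\<^sub>R (\<integral>z. complex_of_real (\<phi> (x + (- \<sigma>) *\<^sub>R z)) * (\<integral>\<xi>. ?w \<xi> * cis ((x - (x + (- \<sigma>) *\<^sub>R z)) \<bullet> \<xi>) \<partial>lborel) \<partial>lborel)"
      by (rule lborel_integral_affine) (use \<sigma> in \<open>auto simp: cis_conv_exp\<close>)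
    also have "\<dots> = (\<integral>z. complex_of_real (\<phi> (x - \<sigma> *\<^sub>R z)) * (\<sigma> ^ DIM('a) *\<^sub>R (\<integral>\<xi>. ?w \<xi> * cis ((\<sigma> *\<^sub>R z) \<bullet> \<xi>) \<partial>lborel)) \<partial>lborel)"
      using \<sigma> by simp
    also have "\<dots> = (\<integral>z. complex_of_real (\<phi> (x - \<sigma> *\<^sub>R z)) * complex_of_real (gauss_mass TYPE('a) * gauss ((\<sigma> *\<^sub>R z) /\<^sub>R \<sigma>)) \<partial>lborel)"
      by (simp only: fourier_gauss_scaled[OF \<sigma>])
    also have "\<dots> = (\<integral>z. complex_of_real (gauss_mass TYPE('a) * (\<phi> (x - \<sigma> *\<^sub>R z) * gauss z)) \<partial>lborel)"
      using \<sigma> by (intro Bochner_Integration.integral_cong refl) simp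
    also have "\<dots> = complex_of_real (gauss_mass TYPE('a) * (\<integral>z. \<phi> (x - \<sigma> *\<^sub>R z) * gauss z \<partial>lborel))"
      by (simp only: integral_complex_of_real integral_mult_right_zero)
    finally show ?thesis .
  qed
  have "(\<integral>\<xi>. ?w \<xi> * (cnj (fourier f \<xi>) * fourier \<phi> \<xi>) \<partial>lborel)
    = (\<integral>\<xi>. (?w \<xi> * fourier \<phi> \<xi>) * (\<integral>x. complex_of_real (f x) * cis (x \<bullet> \<xi>) \<partial>lborel) \<partial>lborel)"
    unfolding cnjf[symmetric] by (intro Bochner_Integration.integral_cong refl) (simp add: mult_ac)
  also have "\<dots> = (\<integral>x. complex_of_real (f x) * (\<integral>\<xi>. (?w \<xi> * fourier \<phi> \<xi>) * cis (x \<bullet> \<xi>) \<partial>lborel) \<partial>lborel)"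
    by (rule fubini_bounded_kernel[OF fC w\<phi> cism, where B = 1, symmetric]) simp
  also have "\<dots> = (\<integral>x. complex_of_real (gauss_mass TYPE('a) * (f x * (\<integral>z. \<phi> (x - \<sigma> *\<^sub>R z) * gauss z \<partial>lborel))) \<partial>lborel)"
    unfolding inner by (intro Bochner_Integration.integral_cong refl) simp
  also have "\<dots> = complex_of_real (gauss_mass TYPE('a) * (\<integral>x. f x * (\<integral>z. \<phi> (x - \<sigma> *\<^sub>R z) * gauss z \<partial>lborel) \<partial>lborel))"
    by (simp only: integral_complex_of_real integral_mult_right_zero)
  finally show ?thesis .
qed

text \<open>For each shift the correlation of \<phi> with its translate is at most the squared norm
  of \<phi>, by AM-GM and translation invariance; averaging over the shifts \<sigma> z with Gaussian
  weight preserves this. Through \<open>regularised_parseval\<close> it is the inequality half of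
  Plancherel for \<phi>, uniformly in \<sigma>.\<close>

lemma gauss_autocorrelation_le:
  fixes \<phi> :: "'a::euclidean_space \<Rightarrow> real"
  assumes \<phi>: "integrable lborel \<phi>" and \<phi>c: "continuous_on UNIV \<phi>" and B: "\<And>x. \<bar>\<phi> x\<bar> \<le> B"
  shows "(\<integral>x. \<phi> x * (\<integral>z. \<phi> (x - \<sigma> *\<^sub>R z) * gauss z \<partial>lborel) \<partial>lborel) \<le> gauss_mass TYPE('a) * (\<integral>x. (\<phi> x)\<^sup>2 \<partial>lborel)"
proof -
  have [measurable]: "\<phi> \<in> borel_measurable borel" using \<phi>c by (rule borel_measurable_continuous_onI)
  have B': "norm (\<phi> x) \<le> norm B" for x
    using order_trans[OF B abs_ge_self] by simp
  have sq: "integrable lborel (\<lambda>x. (\<phi> x)\<^sup>2)"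
    by (rule Bochner_Integration.integrable_bound[OF integrable_mult_left[OF \<phi>, of B]])
       (measurable, unfold power2_eq_square norm_mult, intro AE_I2 mult_left_mono, use B' in auto)
  have shift: "has_bochner_integral lborel (\<lambda>x. (\<phi> (x - c))\<^sup>2) (\<integral>x. (\<phi> x)\<^sup>2 \<partial>lborel)" for c
  proof -
    have "has_bochner_integral (distr lborel borel ((+) (- c))) (\<lambda>x. (\<phi> x)\<^sup>2) (\<integral>x. (\<phi> x)\<^sup>2 \<partial>lborel)"
      using sq by (simp add: lborel_distr_plus has_bochner_integral_iff)
    then show ?thesis unfolding has_bochner_integral_iff
      by (simp add: integrable_distr_eq integral_distr)
  qed
  have cor: "(\<integral>x. \<phi> x * \<phi> (x - c) \<partial>lborel) \<le> (\<integral>x. (\<phi> x)\<^sup>2 \<partial>lborel)" for c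
  proof -
    have "(\<integral>x. \<phi> x * \<phi> (x - c) \<partial>lborel) \<le> (\<integral>x. ((\<phi> x)\<^sup>2 + (\<phi> (x - c))\<^sup>2) / 2 \<partial>lborel)"
    proof (rule integral_mono)
      show "integrable lborel (\<lambda>x. \<phi> x * \<phi> (x - c))"
        by (rule Bochner_Integration.integrable_bound[OF integrable_mult_left[OF \<phi>, of B]])
           (measurable, unfold norm_mult, intro AE_I2 mult_left_mono, use B' in auto)
      show "integrable lborel (\<lambda>x. ((\<phi> x)\<^sup>2 + (\<phi> (x - c))\<^sup>2) / 2)"
        using sq shift[of c] by (simp add: has_bochner_integral_iff)
      show "\<phi> x * \<phi> (x - c) \<le> ((\<phi> x)\<^sup>2 + (\<phi> (x - c))\<^sup>2) / 2" for x
        using sum_squares_bound[of "\<phi> x" "\<phi> (x - c)"] by simp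
    qed
    also have "\<dots> = (\<integral>x. (\<phi> x)\<^sup>2 \<partial>lborel)"
      using sq shift[of c] by (simp add: has_bochner_integral_iff)
    finally show ?thesis .
  qed
  have corb: "\<bar>\<integral>x. \<phi> x * \<phi> (x - c) \<partial>lborel\<bar> \<le> (\<integral>x. \<bar>\<phi> x\<bar> * B \<partial>lborel)" for c
    unfolding real_norm_def[symmetric]
  proof (rule Bochner_Integration.integral_norm_bound_integral)
    show "integrable lborel (\<lambda>x. \<phi> x * \<phi> (x - c))"
      by (rule Bochner_Integration.integrable_bound[OF integrable_mult_left[OF \<phi>, of B]])
         (measurable, unfold norm_mult, intro AE_I2 mult_left_mono, use B' in auto)
  qed (use \<phi> B in \<open>auto simp: abs_mult intro!: mult_left_mono\<close>)
  have "(\<integral>x. \<phi> x * (\<integral>z. \<phi> (x - \<sigma> *\<^sub>R z) * gauss z \<partial>lborel) \<partial>lborel) = (\<integral>x. \<phi> x * (\<integral>z. gauss z * \<phi> (x - \<sigma> *\<^sub>R z) \<partial>lborel) \<partial>lborel)"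
    by (simp add: mult.commute)
  also have "\<dots> = (\<integral>z. gauss z * (\<integral>x. \<phi> x * \<phi> (x - \<sigma> *\<^sub>R z) \<partial>lborel) \<partial>lborel)"
    by (rule fubini_bounded_kernel[OF \<phi> integrable_gauss, where B = B]) (use B in auto)
  also have "\<dots> \<le> (\<integral>z. gauss z * (\<integral>x. (\<phi> x)\<^sup>2 \<partial>lborel) \<partial>(lborel :: 'a measure))"
  proof (rule integral_mono)
    show "integrable lborel (\<lambda>z. gauss z * (\<integral>x. \<phi> x * \<phi> (x - \<sigma> *\<^sub>R z) \<partial>lborel))"
      by (rule Bochner_Integration.integrable_bound[OF integrable_mult_left[OF integrable_gauss, of "\<integral>x. \<bar>\<phi> x\<bar> * B \<partial>lborel"]])
         (measurable, unfold norm_mult, intro AE_I2 mult_left_mono, unfold real_norm_def, rule order_trans[OF corb abs_ge_self], simp)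
  qed (use cor integrable_gauss in \<open>auto intro: mult_left_mono gauss_nonneg\<close>)
  also have "\<dots> = gauss_mass TYPE('a) * (\<integral>x. (\<phi> x)\<^sup>2 \<partial>lborel)"
    by (simp add: integral_gauss)
  finally show ?thesis .
qed

text \<open>Approximate identity along \<sigma> = 1/(n + 1): continuity of \<phi> gives the
  pointwise limit, its boundedness the domination.\<close>

lemma gauss_regularisation_tendsto:
  fixes f \<phi> :: "'a::euclidean_space \<Rightarrow> real"
  assumes f: "integrable lborel f" and \<phi>c: "continuous_on UNIV \<phi>" and B: "\<And>x. \<bar>\<phi> x\<bar> \<le> B"
  shows "(\<lambda>n. \<integral>x. f x * (\<integral>z. \<phi> (x - inverse (real (Suc n)) *\<^sub>R z) * gauss z \<partial>lborel) \<partial>lborel)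
    \<longlonglongrightarrow> gauss_mass TYPE('a) * (\<integral>x. f x * \<phi> x \<partial>lborel)"
proof -
  have [measurable]: "\<phi> \<in> borel_measurable borel" using \<phi>c by (rule borel_measurable_continuous_onI)
  note [measurable] = borel_measurable_integrable[OF f]
  have pb: "norm (\<phi> y * gauss z) \<le> B * gauss z" for y z :: 'a
    using mult_right_mono[OF B gauss_nonneg, of y z] by (simp add: abs_mult gauss_nonneg)
  have pb': "norm (\<phi> y * gauss z) \<le> norm (B * gauss z)" for y z :: 'a
    using order_trans[OF pb abs_ge_self] by simp
  have inner: "(\<lambda>n. \<integral>z. \<phi> (x - inverse (real (Suc n)) *\<^sub>R z) * gauss z \<partial>lborel) \<longlonglongrightarrow> (\<integral>z. \<phi> x * gauss z \<partial>(lborel :: 'a measure))" for x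
  proof (rule integral_dominated_convergence[where w = "\<lambda>z. B * gauss z"])
    show "AE z in lborel. (\<lambda>n. \<phi> (x - inverse (real (Suc n)) *\<^sub>R z) * gauss z) \<longlonglongrightarrow> \<phi> x * gauss z"
    proof (rule AE_I2)
      fix z :: 'a
      have "(\<lambda>n. x - inverse (real (Suc n)) *\<^sub>R z) \<longlonglongrightarrow> x - 0 *\<^sub>R z"
        by (intro tendsto_intros LIMSEQ_inverse_real_of_nat)
      moreover have "isCont \<phi> x" using \<phi>c by (simp add: continuous_on_eq_continuous_at)
      ultimately have "(\<lambda>n. \<phi> (x - inverse (real (Suc n)) *\<^sub>R z)) \<longlonglongrightarrow> \<phi> x"
        using isCont_tendsto_compose[of x \<phi>] by simp
      then show "(\<lambda>n. \<phi> (x - inverse (real (Suc n)) *\<^sub>R z) * gauss z) \<longlonglongrightarrow> \<phi> x * gauss z"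
        by (intro tendsto_intros)
    qed
  qed (use integrable_gauss pb in \<open>auto simp del: real_norm_def\<close>)
  have innerb: "\<bar>\<integral>z. \<phi> (x - inverse (real (Suc n)) *\<^sub>R z) * gauss z \<partial>lborel\<bar> \<le> B * gauss_mass TYPE('a)" for x n
  proof -
    have "norm (\<integral>z. \<phi> (x - inverse (real (Suc n)) *\<^sub>R z) * gauss z \<partial>lborel) \<le> (\<integral>z. B * gauss z \<partial>(lborel :: 'a measure))"
    proof (rule Bochner_Integration.integral_norm_bound_integral)
      show "integrable lborel (\<lambda>z::'a. \<phi> (x - inverse (real (Suc n)) *\<^sub>R z) * gauss z)"
        by (rule Bochner_Integration.integrable_bound[OF integrable_mult_right[OF integrable_gauss, of B]])
           (use pb' in \<open>auto simp del: real_norm_def\<close>)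
    qed (use integrable_gauss pb in \<open>auto simp del: real_norm_def\<close>)
    then show ?thesis by (simp add: integral_gauss)
  qed
  have "(\<lambda>n. \<integral>x. f x * (\<integral>z. \<phi> (x - inverse (real (Suc n)) *\<^sub>R z) * gauss z \<partial>lborel) \<partial>lborel)
    \<longlonglongrightarrow> (\<integral>x. f x * (\<integral>z. \<phi> x * gauss z \<partial>(lborel :: 'a measure)) \<partial>lborel)"
  proof (rule integral_dominated_convergence[where w = "\<lambda>x. \<bar>f x\<bar> * (B * gauss_mass TYPE('a))"])
    show "AE x in lborel. (\<lambda>n. f x * (\<integral>z. \<phi> (x - inverse (real (Suc n)) *\<^sub>R z) * gauss z \<partial>lborel)) \<longlonglongrightarrow> f x * (\<integral>z. \<phi> x * gauss z \<partial>(lborel :: 'a measure))"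
      by (intro AE_I2 tendsto_intros inner)
    show "AE x in lborel. norm (f x * (\<integral>z. \<phi> (x - inverse (real (Suc n)) *\<^sub>R z) * gauss z \<partial>lborel)) \<le> \<bar>f x\<bar> * (B * gauss_mass TYPE('a))" for n
      unfolding real_norm_def abs_mult by (intro AE_I2 mult_left_mono innerb) auto
  qed (use f in auto)
  also have "(\<integral>x. f x * (\<integral>z. \<phi> x * gauss z \<partial>(lborel :: 'a measure)) \<partial>lborel) = gauss_mass TYPE('a) * (\<integral>x. f x * \<phi> x \<partial>lborel)"
    by (simp add: integral_gauss mult_ac flip: integral_mult_right_zero)
  finally show ?thesis .
qed

text \<open>The parameter \<open>l\<close> comes from AM-GM and plays the role of Cauchy--Schwarz after optimisation.\<close>

lemma fourier_duality_bound:
  fixes f \<phi> :: "'a::euclidean_space \<Rightarrow> real"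
  assumes f: "integrable lborel f" and f2: "integrable lborel (\<lambda>\<xi>. (cmod (fourier f \<xi>))\<^sup>2)"
    and \<phi>: "integrable lborel \<phi>" and \<phi>c: "continuous_on UNIV \<phi>" and B: "\<And>x. \<bar>\<phi> x\<bar> \<le> B" and l: "0 < l"
  shows "2 * (gauss_mass TYPE('a))\<^sup>2 * \<bar>\<integral>x. f x * \<phi> x \<partial>lborel\<bar>
    \<le> l * (\<integral>\<xi>. (cmod (fourier f \<xi>))\<^sup>2 \<partial>lborel) + (gauss_mass TYPE('a))\<^sup>2 / l * (\<integral>x. (\<phi> x)\<^sup>2 \<partial>lborel)"
proof -
  let ?g = "gauss_mass TYPE('a)"
  let ?T = "\<lambda>\<sigma>. \<integral>x. f x * (\<integral>z. \<phi> (x - \<sigma> *\<^sub>R z) * gauss z \<partial>lborel) \<partial>lborel"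
  let ?R = "l * (\<integral>\<xi>. (cmod (fourier f \<xi>))\<^sup>2 \<partial>lborel) + ?g\<^sup>2 / l * (\<integral>x. (\<phi> x)\<^sup>2 \<partial>lborel)"
  have [measurable]: "fourier f \<in> borel_measurable borel" "fourier \<phi> \<in> borel_measurable borel"
    using continuous_on_fourier[OF f] continuous_on_fourier[OF \<phi>] by (auto intro: borel_measurable_continuous_onI)
  have [measurable]: "(\<lambda>\<xi>. cnj (fourier f \<xi>)) \<in> borel_measurable borel"
    using continuous_on_fourier[OF f] by (intro borel_measurable_continuous_onI continuous_intros)
  have main: "2 * (?g * \<bar>?T \<sigma>\<bar>) \<le> ?R" if \<sigma>: "0 < \<sigma>" for \<sigma>
  proof -
    let ?w = "\<lambda>\<xi>::'a. gauss (\<sigma> *\<^sub>R \<xi>)"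
    note wi = integrable_gauss_scaled[OF \<sigma>, where 'a = 'a]
    have w: "0 \<le> ?w \<xi>" "?w \<xi> \<le> 1" for \<xi> by (auto simp: gauss_def)
    define P where "P = (\<integral>x. \<bar>\<phi> x\<bar> \<partial>lborel)"
    have \<phi>2: "integrable lborel (\<lambda>\<xi>. ?w \<xi> * (cmod (fourier \<phi> \<xi>))\<^sup>2)"
    proof (rule Bochner_Integration.integrable_bound[OF integrable_mult_left[OF wi, of "P\<^sup>2"]])
      have "(cmod (fourier \<phi> \<xi>))\<^sup>2 \<le> P\<^sup>2" for \<xi>
        unfolding P_def by (intro power_mono norm_fourier_le) auto
      then show "AE \<xi> in lborel. norm (?w \<xi> * (cmod (fourier \<phi> \<xi>))\<^sup>2) \<le> norm (?w \<xi> * P\<^sup>2)"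
        using w by (intro AE_I2) (auto simp: abs_mult intro!: mult_left_mono)
    qed measurable
    have cn: "complex_of_real ((cmod z)\<^sup>2) = cnj z * z" for z
      by (simp only: complex_norm_square mult.commute)
    have "complex_of_real (\<integral>\<xi>. ?w \<xi> * (cmod (fourier \<phi> \<xi>))\<^sup>2 \<partial>lborel)
       = (\<integral>\<xi>. complex_of_real (?w \<xi>) * (cnj (fourier \<phi> \<xi>) * fourier \<phi> \<xi>) \<partial>lborel)"
      unfolding integral_complex_of_real[symmetric]
      by (intro Bochner_Integration.integral_cong refl) (simp only: of_real_mult cn)
    then have "(\<integral>\<xi>. ?w \<xi> * (cmod (fourier \<phi> \<xi>))\<^sup>2 \<partial>lborel) = ?g * (\<integral>x. \<phi> x * (\<integral>z. \<phi> (x - \<sigma> *\<^sub>R z) * gauss z \<partial>lborel) \<partial>lborel)"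
      unfolding regularised_parseval[OF \<phi> \<phi> \<phi>c \<sigma>] of_real_eq_iff .
    also have "\<dots> \<le> ?g * (?g * (\<integral>x. (\<phi> x)\<^sup>2 \<partial>lborel))"
      using gauss_mass_pos[where 'a = 'a] by (intro mult_left_mono gauss_autocorrelation_le[OF \<phi> \<phi>c B]) (simp add: less_imp_le)
    finally have w\<phi>: "(\<integral>\<xi>. ?w \<xi> * (cmod (fourier \<phi> \<xi>))\<^sup>2 \<partial>lborel) \<le> ?g\<^sup>2 * (\<integral>x. (\<phi> x)\<^sup>2 \<partial>lborel)"
      by (simp add: power2_eq_square)
    have bi: "integrable lborel (\<lambda>\<xi>. l / 2 * (cmod (fourier f \<xi>))\<^sup>2 + 1 / (2 * l) * (?w \<xi> * (cmod (fourier \<phi> \<xi>))\<^sup>2))"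
      using f2 \<phi>2 by auto
    have "?g * \<bar>?T \<sigma>\<bar> = cmod (\<integral>\<xi>. complex_of_real (?w \<xi>) * (cnj (fourier f \<xi>) * fourier \<phi> \<xi>) \<partial>lborel)"
      unfolding regularised_parseval[OF f \<phi> \<phi>c \<sigma>] norm_of_real abs_mult using gauss_mass_pos[where 'a = 'a] by simp
    also have "\<dots> \<le> (\<integral>\<xi>. l / 2 * (cmod (fourier f \<xi>))\<^sup>2 + 1 / (2 * l) * (?w \<xi> * (cmod (fourier \<phi> \<xi>))\<^sup>2) \<partial>lborel)"
    proof -
      have le: "norm (complex_of_real (?w \<xi>) * (cnj (fourier f \<xi>) * fourier \<phi> \<xi>))
         \<le> l / 2 * (cmod (fourier f \<xi>))\<^sup>2 + 1 / (2 * l) * (?w \<xi> * (cmod (fourier \<phi> \<xi>))\<^sup>2)" for \<xi>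
      proof -
        let ?u = "cmod (fourier f \<xi>)" and ?v = "cmod (fourier \<phi> \<xi>)"
        have "?u * ?v \<le> l / 2 * ?u\<^sup>2 + 1 / (2 * l) * ?v\<^sup>2"
        proof -
          have "0 \<le> (l * ?u - ?v)\<^sup>2 / (2 * l)" using l by simp
          also have "\<dots> = l / 2 * ?u\<^sup>2 + 1 / (2 * l) * ?v\<^sup>2 - ?u * ?v"
            using l by (simp add: power2_eq_square field_simps)
          finally show ?thesis by simp
        qed
        then have "?w \<xi> * (?u * ?v) \<le> ?w \<xi> * (l / 2 * ?u\<^sup>2) + 1 / (2 * l) * (?w \<xi> * ?v\<^sup>2)"
          using mult_left_mono[of "?u * ?v" "l / 2 * ?u\<^sup>2 + 1 / (2 * l) * ?v\<^sup>2" "?w \<xi>"] w(1)[of \<xi>]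
          by (simp only: distrib_left mult.left_commute)
        \<comment> \<open>The Gaussian weight is discarded only next to \<open>fourier f\<close>,
          whose square is integrable. It stays with \<open>fourier \<phi>\<close>, whose square is
          controlled in weighted form.\<close>
        also have "?w \<xi> * (l / 2 * ?u\<^sup>2) \<le> 1 * (l / 2 * ?u\<^sup>2)"
          using w l by (intro mult_right_mono) auto
        finally show ?thesis using w(1)[of \<xi>] by (simp add: norm_mult)
      qed
      show ?thesis
      proof (rule Bochner_Integration.integral_norm_bound_integral[OF _ bi le])
        show "integrable lborel (\<lambda>\<xi>. complex_of_real (?w \<xi>) * (cnj (fourier f \<xi>) * fourier \<phi> \<xi>))"
          by (rule Bochner_Integration.integrable_bound[OF bi])
             (measurable, intro AE_I2, unfold real_norm_def, rule order_trans[OF le abs_ge_self])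
      qed
    qed
    also have "\<dots> = l / 2 * (\<integral>\<xi>. (cmod (fourier f \<xi>))\<^sup>2 \<partial>lborel) + 1 / (2 * l) * (\<integral>\<xi>. ?w \<xi> * (cmod (fourier \<phi> \<xi>))\<^sup>2 \<partial>lborel)"
      using f2 \<phi>2 by simp
    also have "\<dots> \<le> l / 2 * (\<integral>\<xi>. (cmod (fourier f \<xi>))\<^sup>2 \<partial>lborel) + 1 / (2 * l) * (?g\<^sup>2 * (\<integral>x. (\<phi> x)\<^sup>2 \<partial>lborel))"
      using w\<phi> l by (intro add_left_mono mult_left_mono) auto
    finally show ?thesis by (simp add: field_simps)
  qed
  \<comment> \<open>One factor \<open>?g\<close> stems from the Parseval formula, the other from the
    limit of the regularisation.\<close>
  have "2 * (?g * \<bar>?g * (\<integral>x. f x * \<phi> x \<partial>lborel)\<bar>) \<le> ?R"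
  proof (rule LIMSEQ_le_const2)
    show "(\<lambda>n. 2 * (?g * \<bar>?T (inverse (real (Suc n)))\<bar>)) \<longlonglongrightarrow> 2 * (?g * \<bar>?g * (\<integral>x. f x * \<phi> x \<partial>lborel)\<bar>)"
      by (intro tendsto_intros gauss_regularisation_tendsto[OF f \<phi>c B])
    show "\<exists>N. \<forall>n\<ge>N. 2 * (?g * \<bar>?T (inverse (real (Suc n)))\<bar>) \<le> ?R"
      using main by (intro exI allI impI) simp
  qed
  then show ?thesis using gauss_mass_pos[where 'a = 'a] by (simp add: abs_mult power2_eq_square mult.assoc)
qed

text \<open>Duality with \<phi> close to c sgn f, where c is 1 on the ball of radius R and vanishes
  outside radius 2R; the squared norm of \<phi> is then at most the volume of the larger ball, hence
  (2 R)^d. This stands in for Cauchy-Schwarz followed by Plancherel, without placing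
  \<open>f\<close> itself in L^2.\<close>

lemma ball_L1_le_fourier_L2:
  fixes f :: "'a::euclidean_space \<Rightarrow> real"
  assumes f: "integrable lborel f" and f2: "integrable lborel (\<lambda>\<xi>. (cmod (fourier f \<xi>))\<^sup>2)"
    and l: "0 < l" and R: "0 < R"
  shows "2 * (gauss_mass TYPE('a))\<^sup>2 * (\<integral>x. indicator (cball 0 R) x * \<bar>f x\<bar> \<partial>lborel)
    \<le> l * (\<integral>\<xi>. (cmod (fourier f \<xi>))\<^sup>2 \<partial>lborel)
      + (gauss_mass TYPE('a))\<^sup>2 / l * (unit_ball_vol (real DIM('a)) * (2 * R) ^ DIM('a))"
proof -
  let ?g = "gauss_mass TYPE('a)"
  let ?V = "unit_ball_vol (real DIM('a)) * (2 * R) ^ DIM('a)"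
  note [measurable] = borel_measurable_integrable[OF f]
  \<comment> \<open>The duality bound wants continuous test functions while sgn f may jump;
    \<open>measurable_on\<close> supplies continuous functions that converge to it off a negligible
    set.\<close>
  have "(\<lambda>x. sgn (f x)) \<in> borel_measurable lebesgue"
    by (intro measurable_completion) measurable
  then have "(\<lambda>x. sgn (f x)) measurable_on UNIV"
    by (intro lebesgue_measurable_imp_measurable_on) auto
  then obtain N h where N: "negligible N" and h: "\<And>n. continuous_on UNIV (h n)"
    and hlim: "\<And>x. x \<notin> N \<Longrightarrow> (\<lambda>n. h n x) \<longlonglongrightarrow> sgn (f x)"
    unfolding measurable_on_def by auto
  have ae: "AE x in lborel. x \<notin> N"
    using AE_not_in[of N lebesgue] N by (simp add: negligible_iff_null_sets AE_completion_iff)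
  define c where "c x = max 0 (min 1 (2 - norm x / R))" for x :: 'a
  \<comment> \<open>Clamping to [-1, 1] gives the uniform bound 1 and leaves the limit unchanged,
    because sgn takes its values there.\<close>
  define \<phi> where "\<phi> n x = c x * max (-1) (min 1 (h n x))" for n x
  have c: "0 \<le> c x" "c x \<le> 1" for x by (auto simp: c_def)
  have c1: "c x = 1" if "norm x \<le> R" for x using that R by (simp add: c_def)
  have c0: "c x = 0" if "\<not> norm x \<le> 2 * R" for x using that R by (simp add: c_def field_simps)
  have \<phi>c: "continuous_on UNIV (\<phi> n)" for n
    unfolding \<phi>_def c_def using R by (intro continuous_intros h) auto
  have [measurable]: "\<phi> n \<in> borel_measurable borel" "c \<in> borel_measurable borel" for n
    using \<phi>c by (auto intro: borel_measurable_continuous_onI simp: c_def[abs_def])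
  have \<phi>1: "\<bar>\<phi> n x\<bar> \<le> 1" for n x
    unfolding \<phi>_def abs_mult using c[of x] by (intro mult_le_one) auto
  have \<phi>i: "\<bar>\<phi> n x\<bar> \<le> indicator (cball 0 (2 * R)) x" for n x
    using \<phi>1[of n x] c0[of x] by (cases "norm x \<le> 2 * R") (auto simp: \<phi>_def)
  have bi: "integrable lborel (indicator (cball (0::'a) (2 * R)) :: 'a \<Rightarrow> real)"
    by (intro integrable_real_indicator emeasure_bounded_finite) auto
  have \<phi>int: "integrable lborel (\<phi> n)" for n
    by (rule Bochner_Integration.integrable_bound[OF bi]) (use \<phi>i in auto)
  have \<phi>sq: "(\<integral>x. (\<phi> n x)\<^sup>2 \<partial>lborel) \<le> ?V" for n
  proof -
    have le: "(\<phi> n x)\<^sup>2 \<le> indicator (cball 0 (2 * R)) x" for x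
      using \<phi>1[of n x] c0[of x] by (cases "norm x \<le> 2 * R") (auto simp: \<phi>_def[of n x] abs_square_le_1)
    have "(\<integral>x. (\<phi> n x)\<^sup>2 \<partial>lborel) \<le> (\<integral>x. indicator (cball (0::'a) (2 * R)) x \<partial>lborel)"
    proof (rule integral_mono[OF _ bi le])
      show "integrable lborel (\<lambda>x. (\<phi> n x)\<^sup>2)"
        by (rule Bochner_Integration.integrable_bound[OF bi]) (use le in auto)
    qed
    also have "\<dots> = ?V" using R by (simp add: content_cball)
    finally show ?thesis .
  qed
  have bound: "2 * ?g\<^sup>2 * (\<integral>x. f x * \<phi> n x \<partial>lborel)
      \<le> l * (\<integral>\<xi>. (cmod (fourier f \<xi>))\<^sup>2 \<partial>lborel) + ?g\<^sup>2 / l * ?V" for n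
  proof -
    have "2 * ?g\<^sup>2 * (\<integral>x. f x * \<phi> n x \<partial>lborel) \<le> 2 * ?g\<^sup>2 * \<bar>\<integral>x. f x * \<phi> n x \<partial>lborel\<bar>"
      by (intro mult_left_mono) auto
    also have "\<dots> \<le> l * (\<integral>\<xi>. (cmod (fourier f \<xi>))\<^sup>2 \<partial>lborel) + ?g\<^sup>2 / l * (\<integral>x. (\<phi> n x)\<^sup>2 \<partial>lborel)"
      by (rule fourier_duality_bound[OF f f2 \<phi>int \<phi>c \<phi>1 l])
    also have "\<dots> \<le> l * (\<integral>\<xi>. (cmod (fourier f \<xi>))\<^sup>2 \<partial>lborel) + ?g\<^sup>2 / l * ?V"
      using l by (intro add_left_mono mult_left_mono \<phi>sq) auto
    finally show ?thesis .
  qed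
  have lim: "(\<lambda>n. \<integral>x. f x * \<phi> n x \<partial>lborel) \<longlonglongrightarrow> (\<integral>x. f x * (c x * sgn (f x)) \<partial>lborel)"
  proof (rule integral_dominated_convergence[where w = "\<lambda>x. \<bar>f x\<bar>"])
    show "AE x in lborel. (\<lambda>n. f x * \<phi> n x) \<longlonglongrightarrow> f x * (c x * sgn (f x))"
      using ae
    proof (rule AE_mp, intro AE_I2 impI)
      fix x assume "x \<notin> N"
      then have "(\<lambda>n. max (-1) (min 1 (h n x))) \<longlonglongrightarrow> max (-1) (min 1 (sgn (f x)))"
        by (intro tendsto_intros hlim)
      moreover have "max (-1) (min 1 (sgn (f x))) = sgn (f x)" by (simp add: sgn_if)
      ultimately show "(\<lambda>n. f x * \<phi> n x) \<longlonglongrightarrow> f x * (c x * sgn (f x))"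
        unfolding \<phi>_def by (intro tendsto_intros) simp
    qed
  qed (use f \<phi>1 in \<open>auto simp: abs_mult mult_left_le\<close>)
  have eq: "f x * (c x * sgn (f x)) = c x * \<bar>f x\<bar>" for x
    by (simp add: abs_sgn)
  have ci: "integrable lborel (\<lambda>x. c x * \<bar>f x\<bar>)"
    by (rule Bochner_Integration.integrable_bound[OF f]) (use c in \<open>auto simp: abs_mult mult_left_le_one_le\<close>)
  have "(\<integral>x. indicator (cball 0 R) x * \<bar>f x\<bar> \<partial>lborel) \<le> (\<integral>x. c x * \<bar>f x\<bar> \<partial>lborel)"
  proof (rule integral_mono[OF _ ci])
    show "integrable lborel (\<lambda>x. indicator (cball 0 R) x * \<bar>f x\<bar>)"
      by (rule Bochner_Integration.integrable_bound[OF f]) (auto simp: indicator_def)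
    show "indicator (cball 0 R) x * \<bar>f x\<bar> \<le> c x * \<bar>f x\<bar>" for x
      using c[of x] c1[of x] by (auto simp: indicator_def)
  qed
  then have "2 * ?g\<^sup>2 * (\<integral>x. indicator (cball 0 R) x * \<bar>f x\<bar> \<partial>lborel) \<le> 2 * ?g\<^sup>2 * (\<integral>x. c x * \<bar>f x\<bar> \<partial>lborel)"
    by (intro mult_left_mono) auto
  also have "\<dots> \<le> l * (\<integral>\<xi>. (cmod (fourier f \<xi>))\<^sup>2 \<partial>lborel) + ?g\<^sup>2 / l * ?V"
    by (rule LIMSEQ_le_const2[OF tendsto_mult[OF tendsto_const lim[unfolded eq]]]) (use bound in auto)
  finally show ?thesis .
qed

text \<open>The square is (1 + |\<xi>|)^(-2d), which is one factor (1 + |\<xi>|)^(-2) per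
  coordinate. Each is at most 1/(1 + t^2) with t the coordinate, and the product of these is
  integrable.\<close>

lemma integrable_decay:
  "integrable lborel (\<lambda>\<xi>::'a::euclidean_space. ((1 + norm \<xi>) powr (- real DIM('a)))\<^sup>2)"
proof -
  have 1: "integrable lborel (\<lambda>t::real. inverse (1 + t\<^sup>2))"
    using integrable_inverse_1_plus_square by (simp add: set_integrable_def einterval_def)
  have "integrable lborel (\<lambda>x::'a. \<Prod>b\<in>Basis. inverse (1 + (x \<bullet> b)\<^sup>2))"
    by (rule lborel_prod(1)[where f = "\<lambda>b t. inverse (1 + t\<^sup>2)", OF 1])
  then show ?thesis
  proof (rule Bochner_Integration.integrable_bound)
    show "AE \<xi>::'a in lborel. norm (((1 + norm \<xi>) powr (- real DIM('a)))\<^sup>2) \<le> norm (\<Prod>b\<in>Basis. inverse (1 + (\<xi> \<bullet> b)\<^sup>2))"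
    proof (rule AE_I2)
      fix \<xi> :: 'a
      have p: "1 + norm \<xi> > 0" by (simp add: add_pos_nonneg)
      have "((1 + norm \<xi>) powr (- real DIM('a)))\<^sup>2 = (\<Prod>b\<in>(Basis :: 'a set). inverse ((1 + norm \<xi>)\<^sup>2))"
        using p by (simp add: powr_minus powr_realpow power_inverse power_mult[symmetric] mult.commute)
      also have "\<dots> \<le> (\<Prod>b\<in>Basis. inverse (1 + (\<xi> \<bullet> b)\<^sup>2))"
      proof (rule prod_mono)
        fix b :: 'a assume b: "b \<in> Basis"
        have "(\<xi> \<bullet> b)\<^sup>2 \<le> (norm \<xi>)\<^sup>2"
          using Basis_le_norm[OF b, of \<xi>] by (simp add: abs_le_square_iff[symmetric])
        then have "1 + (\<xi> \<bullet> b)\<^sup>2 \<le> (1 + norm \<xi>)\<^sup>2" by (auto simp: power2_sum intro: add_increasing2)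
        then show "0 \<le> inverse ((1 + norm \<xi>)\<^sup>2) \<and> inverse ((1 + norm \<xi>)\<^sup>2) \<le> inverse (1 + (\<xi> \<bullet> b)\<^sup>2)"
          by (auto intro!: le_imp_inverse_le add_pos_nonneg)
      qed
      finally show "norm (((1 + norm \<xi>) powr (- real DIM('a)))\<^sup>2) \<le> norm (\<Prod>b\<in>Basis. inverse (1 + (\<xi> \<bullet> b)\<^sup>2))"
        by simp
    qed
  qed measurable
qed

section \<open>Weighted norms and interpolation between a ball and a moment\<close>

lemma L1k_norm_mono: "k \<le> m \<Longrightarrow> L1k_norm k f \<le> L1k_norm m f"
  unfolding L1k_norm_def by (intro nn_integral_mono ennreal_leI mult_right_mono powr_mono) auto

lemma L1k_norm_diff_le:
  fixes f g :: "'a::euclidean_space \<Rightarrow> real"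
  assumes [measurable]: "f \<in> borel_measurable borel" "g \<in> borel_measurable borel"
  shows "L1k_norm m (\<lambda>x. f x - g x) \<le> L1k_norm m f + L1k_norm m g"
proof -
  have "L1k_norm m (\<lambda>x. f x - g x) \<le> (\<integral>\<^sup>+ x. ennreal ((1 + (norm x)\<^sup>2) powr (m / 2) * \<bar>f x\<bar>) + ennreal ((1 + (norm x)\<^sup>2) powr (m / 2) * \<bar>g x\<bar>) \<partial>lborel)"
    unfolding L1k_norm_def
    by (intro nn_integral_mono)
       (auto simp: ennreal_plus[symmetric] distrib_left[symmetric] simp del: ennreal_plus intro!: ennreal_leI mult_left_mono)
  also have "\<dots> = L1k_norm m f + L1k_norm m g"
    unfolding L1k_norm_def by (rule nn_integral_add) auto
  finally show ?thesis .
qed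

text \<open>Inside the ball the weight is at most (2 R^2)^(k/2), and k \<le> 2 keeps the constant
  below 2. Outside, (1 + |x|^2)^((k-m)/2) \<le> R^(k-m) exchanges weight k for weight m.\<close>

lemma L1k_norm_interpolation:
  fixes f :: "'a::euclidean_space \<Rightarrow> real"
    and k m R :: real
  assumes f: "integrable lborel f" and k: "0 \<le> k" "k \<le> m" "k \<le> 2" and R: "1 \<le> R"
  shows "L1k_norm k f \<le> ennreal (2 * R powr k * (\<integral>x. indicator (cball 0 R) x * \<bar>f x\<bar> \<partial>lborel))
    + ennreal (R powr (k - m)) * L1k_norm m f"
proof -
  note [measurable] = borel_measurable_integrable[OF f]
  let ?w = "\<lambda>x::'a. 1 + (norm x)\<^sup>2"
  have "L1k_norm k f \<le> (\<integral>\<^sup>+ x. ennreal (2 * R powr k * (indicator (cball 0 R) x * \<bar>f x\<bar>))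
     + ennreal (R powr (k - m)) * ennreal (?w x powr (m / 2) * \<bar>f x\<bar>) \<partial>lborel)"
    unfolding L1k_norm_def
  proof (rule nn_integral_mono)
    fix x :: 'a
    have "?w x powr (k / 2) * \<bar>f x\<bar> \<le> 2 * R powr k * (indicator (cball 0 R) x * \<bar>f x\<bar>) + R powr (k - m) * (?w x powr (m / 2) * \<bar>f x\<bar>)"
    proof (cases "norm x \<le> R")
      case True
      have "(norm x)\<^sup>2 \<le> R\<^sup>2" "1 \<le> R\<^sup>2" using True R by (auto intro: power_mono)
      then have "?w x powr (k / 2) \<le> (2 * R\<^sup>2) powr (k / 2)" using k by (intro powr_mono2) auto
      also have "\<dots> = 2 powr (k / 2) * R powr k"
        using R by (simp add: powr_mult powr_powr powr_numeral[symmetric] del: powr_numeral)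
      also have "\<dots> \<le> 2 powr 1 * R powr k" using k by (intro mult_right_mono powr_mono) auto
      finally have "?w x powr (k / 2) * \<bar>f x\<bar> \<le> 2 * R powr k * \<bar>f x\<bar>" by (intro mult_right_mono) auto
      also have "\<dots> \<le> 2 * R powr k * \<bar>f x\<bar> + R powr (k - m) * (?w x powr (m / 2) * \<bar>f x\<bar>)" by simp
      finally show ?thesis using True by simp
    next
      case False
      have w0: "?w x > 0" by (simp add: add_pos_nonneg)
      have "?w x powr (k / 2) = ?w x powr ((k - m) / 2) * ?w x powr (m / 2)"
        using w0 by (simp add: powr_add[symmetric] add_divide_distrib[symmetric])
      also have "\<dots> \<le> R powr (k - m) * ?w x powr (m / 2)"
      proof (rule mult_right_mono)
        have "R \<le> norm x" "0 \<le> R" using False R by auto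
        from power_mono[OF this, of 2] have "R\<^sup>2 \<le> ?w x" by simp
        then have "?w x powr ((k - m) / 2) \<le> (R\<^sup>2) powr ((k - m) / 2)"
          using k R by (intro powr_mono2') (simp_all add: divide_nonpos_pos)
        also have "\<dots> = R powr (k - m)" 
        proof -
          have "R\<^sup>2 = R powr 2" using R by simp
          moreover have "2 * ((k - m) / 2) = k - m" by (simp add: field_simps)
          ultimately show ?thesis by (simp only: powr_powr)
        qed
        finally show "?w x powr ((k - m) / 2) \<le> R powr (k - m)" .
      qed simp
      finally have "?w x powr (k / 2) * \<bar>f x\<bar> \<le> R powr (k - m) * ?w x powr (m / 2) * \<bar>f x\<bar>" by (intro mult_right_mono) auto
      then show ?thesis using False by (simp add: mult.assoc)
    qed
    then have "ennreal (?w x powr (k / 2) * \<bar>f x\<bar>) \<le> ennreal (2 * R powr k * (indicator (cball 0 R) x * \<bar>f x\<bar>) + R powr (k - m) * (?w x powr (m / 2) * \<bar>f x\<bar>))"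
      by (rule ennreal_leI)
    also have "\<dots> = ennreal (2 * R powr k * (indicator (cball 0 R) x * \<bar>f x\<bar>)) + ennreal (R powr (k - m)) * ennreal (?w x powr (m / 2) * \<bar>f x\<bar>)"
      by (subst ennreal_plus) (auto simp: ennreal_mult)
    finally show "ennreal (?w x powr (k / 2) * \<bar>f x\<bar>) \<le> \<dots>" .
  qed
  also have "\<dots> = (\<integral>\<^sup>+ x. ennreal (2 * R powr k * (indicator (cball 0 R) x * \<bar>f x\<bar>)) \<partial>lborel) + ennreal (R powr (k - m)) * L1k_norm m f"
  proof -
    have "(\<integral>\<^sup>+ x. ennreal (R powr (k - m)) * ennreal (?w x powr (m / 2) * \<bar>f x\<bar>) \<partial>lborel) = ennreal (R powr (k - m)) * L1k_norm m f"
      unfolding L1k_norm_def by (rule nn_integral_cmult) measurable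
    moreover have "(\<integral>\<^sup>+ x. ennreal (2 * R powr k * (indicator (cball 0 R) x * \<bar>f x\<bar>))
       + ennreal (R powr (k - m)) * ennreal (?w x powr (m / 2) * \<bar>f x\<bar>) \<partial>lborel)
       = (\<integral>\<^sup>+ x. ennreal (2 * R powr k * (indicator (cball 0 R) x * \<bar>f x\<bar>)) \<partial>lborel)
       + (\<integral>\<^sup>+ x. ennreal (R powr (k - m)) * ennreal (?w x powr (m / 2) * \<bar>f x\<bar>) \<partial>lborel)"
    proof (rule nn_integral_add)
      show "(\<lambda>x. ennreal (2 * R powr k * (indicator (cball 0 R) x * \<bar>f x\<bar>))) \<in> borel_measurable lborel"
        by (intro measurable_compose[OF _ measurable_ennreal] borel_measurable_times borel_measurable_const
          borel_measurable_indicator borel_measurable_abs borel_measurable_integrable[OF f]) auto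
    qed measurable
    ultimately show ?thesis by (simp only:)
  qed
  also have "(\<integral>\<^sup>+ x. ennreal (2 * R powr k * (indicator (cball 0 R) x * \<bar>f x\<bar>)) \<partial>lborel) = ennreal (\<integral>x. 2 * R powr k * (indicator (cball 0 R) x * \<bar>f x\<bar>) \<partial>lborel)"
  proof (rule nn_integral_eq_integral)
    have "integrable lborel (\<lambda>x. indicator (cball 0 R) x * \<bar>f x\<bar>)"
      by (rule Bochner_Integration.integrable_bound[OF f]) (auto simp: indicator_def)
    then show "integrable lborel (\<lambda>x. 2 * R powr k * (indicator (cball 0 R) x * \<bar>f x\<bar>))" by simp
  qed auto
  finally show ?thesis by simp
qed

section \<open>Choice of the radius and the convergence rate\<close>

theorem theorem4p6:
  fixes J :: "real \<Rightarrow> 'a::euclidean_space \<Rightarrow> real"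
    and Feps :: "real \<Rightarrow> real \<Rightarrow> 'a \<Rightarrow> real"
    and Fs :: "real \<Rightarrow> 'a \<Rightarrow> real"
    and \<delta> k m :: real
  assumes hJ: "H1 J \<delta>"
    and hFeps: "\<And>\<epsilon> s. \<epsilon> \<in> {0<..1} \<Longrightarrow> s \<in> {1/2<..<1} \<Longrightarrow>
                  nonlocal_equilibrium \<epsilon> s (J s) (Feps \<epsilon> s)"
    and hFs: "\<And>s. s \<in> {1/2<..<1} \<Longrightarrow> prob_density (Fs s) \<and>
                  (\<forall>\<xi>. fourier (Fs s) \<xi> = complex_of_real (exp (- (norm \<xi> powr (2 * s)) / (2 * s))))"
    and hk: "0 \<le> k" "k < m" "m < 1"
  shows "\<exists>C::real. \<forall>\<epsilon>\<in>{0<..1}. \<forall>s\<in>{1/2<..<1}.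
           L1k_norm k (\<lambda>x. Feps \<epsilon> s x - Fs s x)
             \<le> ennreal (C * \<epsilon> powr (((m - k) / (m + real DIM('a) / 2)) * \<delta>))"
proof -
  define d where "d = real DIM('a)"
  define \<theta> where "\<theta> = (m - k) / (m + d / 2)"
  have d: "1 \<le> d" by (simp add: d_def Suc_leI)
  have md: "0 < m + d / 2" using hk d by simp
  have \<theta>: "0 < \<theta>" using hk md by (simp add: \<theta>_def)
  have \<delta>: "0 < \<delta>" using hJ by (simp add: H1_def)
  obtain \<epsilon>0 C1 where \<epsilon>0: "0 < \<epsilon>0" "\<epsilon>0 \<le> 1" and C1: "0 < C1"
    and diff: "\<And>\<epsilon> s F \<xi>. 0 < \<epsilon> \<Longrightarrow> \<epsilon> \<le> \<epsilon>0 \<Longrightarrow> 1/2 < s \<Longrightarrow> s < 1 \<Longrightarrow> nonlocal_equilibrium \<epsilon> s (J s) F \<Longrightarrow>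
      cmod (fourier F \<xi> - complex_of_real (exp (- (norm \<xi> powr (2 * s) / (2 * s)))))
      \<le> C1 * \<epsilon> powr \<delta> * (1 + norm \<xi>) powr (- d)"
    using fourier_difference_bound[OF hJ] unfolding d_def by blast
  obtain C2 where C2: "0 < C2" and near0: "\<And>\<epsilon> s F \<xi>. 0 < \<epsilon> \<Longrightarrow> \<epsilon> \<le> 1 \<Longrightarrow> 1/2 < s \<Longrightarrow> s < 1 \<Longrightarrow> nonlocal_equilibrium \<epsilon> s (J s) F \<Longrightarrow>
    1 - Re (fourier F \<xi>) \<le> C2 * norm \<xi>"
    using fourier_near_zero_bound[OF hJ] by blast
  \<comment> \<open>A moment bound common to both equilibria: the linear bound near frequency 0
    holds with \<open>C2\<close> for \<open>Feps\<close> and with 2 for \<open>Fs\<close>.\<close>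
  define M where "M = 1 + d * (1 + 2 / (1 - cos (1/2)) * (max C2 2 / (1 - m)))"
  have M: "0 \<le> M" unfolding M_def using d hk cos_half_less_1 C2
    by (intro add_nonneg_nonneg mult_nonneg_nonneg divide_nonneg_pos) auto
  define Q0 where "Q0 = (\<integral>\<xi>. ((1 + norm \<xi>) powr (- d))\<^sup>2 \<partial>(lborel :: 'a measure))"
  have Q0: "0 \<le> Q0" by (simp add: Q0_def)
  let ?g = "gauss_mass TYPE('a)"
  define V where "V = unit_ball_vol d * 2 ^ DIM('a)"
  have V: "0 \<le> V" using d by (simp add: V_def)
  \<comment> \<open>With the choice of \<open>l\<close> made below, both terms of the ball estimate
    become multiples of R^(d/2) \<epsilon>^\<delta>; \<open>K\<close> is their total after division
    by 2 (2 pi)^d.\<close>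
  define K where "K = (C1\<^sup>2 * Q0 + ?g\<^sup>2 * V) / (2 * ?g\<^sup>2)"
  have K: "0 \<le> K" using Q0 V by (simp add: K_def)
  have Feps: "prob_density (Feps \<epsilon> s)" if "\<epsilon> \<in> {0<..1}" "s \<in> {1/2<..<1}" for \<epsilon> s
    using hFeps[OF that] by (simp add: nonlocal_equilibrium_def)
  have Fs: "prob_density (Fs s)" "fourier (Fs s) \<xi> = complex_of_real (exp (- (norm \<xi> powr (2 * s) / (2 * s))))"
    if "s \<in> {1/2<..<1}" for s \<xi>
    using hFs[OF that] by simp_all
  have mom: "L1k_norm m (\<lambda>x. Feps \<epsilon> s x - Fs s x) \<le> ennreal (2 * M)" if es: "\<epsilon> \<in> {0<..1}" "s \<in> {1/2<..<1}" for \<epsilon> s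
  proof -
    have "L1k_norm m (Feps \<epsilon> s) \<le> ennreal M"
      unfolding M_def d_def
    proof (rule L1k_norm_moment_bound[OF Feps[OF es]])
      fix \<xi> :: 'a
      have "1 - Re (fourier (Feps \<epsilon> s) \<xi>) \<le> C2 * norm \<xi>"
        using near0[OF _ _ _ _ hFeps[OF es]] es by auto
      also have "\<dots> \<le> max C2 2 * norm \<xi>" by (intro mult_right_mono) auto
      finally show "1 - Re (fourier (Feps \<epsilon> s) \<xi>) \<le> max C2 2 * norm \<xi>" .
    qed (use hk C2 in auto)
    moreover have "L1k_norm m (Fs s) \<le> ennreal M"
      unfolding M_def d_def
    proof (rule L1k_norm_moment_bound[OF Fs(1)[OF es(2)]])
      fix \<xi> :: 'a
      let ?n = "norm \<xi>"
      have "1 - exp (- (?n powr (2 * s) / (2 * s))) \<le> 2 * ?n"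
      proof (cases "?n \<le> 1")
        case True
        have "1 + - (?n powr (2 * s) / (2 * s)) \<le> exp (- (?n powr (2 * s) / (2 * s)))" by (rule exp_ge_add_one_self)
        moreover have "?n powr (2 * s) / (2 * s) \<le> ?n powr (2 * s) / 1"
          by (rule divide_left_mono) (use es in auto)
        moreover have "?n powr (2 * s) \<le> ?n powr 1" using True es by (intro powr_mono') auto
        ultimately have "1 - exp (- (?n powr (2 * s) / (2 * s))) \<le> ?n" by simp
        also have "?n \<le> 2 * ?n" by simp
        finally show ?thesis .
      next
        case False
        have "0 \<le> exp (- (?n powr (2 * s) / (2 * s)))" by simp
        with False show ?thesis by linarith
      qed
      also have "\<dots> \<le> max C2 2 * ?n" by (intro mult_right_mono) auto
      finally show "1 - Re (fourier (Fs s) \<xi>) \<le> max C2 2 * ?n" by (simp add: Fs(2)[OF es(2)])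
    qed (use hk C2 in auto)
    ultimately have "L1k_norm m (Feps \<epsilon> s) + L1k_norm m (Fs s) \<le> ennreal M + ennreal M"
      by (rule add_mono)
    with L1k_norm_diff_le[OF prob_densityD(1)[OF Feps[OF es]] prob_densityD(1)[OF Fs(1)[OF es(2)]], of m]
    show ?thesis using M by (simp add: ennreal_plus[symmetric] del: ennreal_plus)
  qed
  have small: "L1k_norm k (\<lambda>x. Feps \<epsilon> s x - Fs s x) \<le> ennreal ((2 * K + 2 * M) * \<epsilon> powr (\<theta> * \<delta>))"
    if \<epsilon>: "0 < \<epsilon>" "\<epsilon> \<le> \<epsilon>0" and s: "s \<in> {1/2<..<1}" for \<epsilon> s
  proof -
    have es: "\<epsilon> \<in> {0<..1}" using \<epsilon> \<epsilon>0 by auto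
    define f where "f = (\<lambda>x. Feps \<epsilon> s x - Fs s x)"
    note Fi = prob_densityD(3)[OF Feps[OF es s]] and Gi = prob_densityD(3)[OF Fs(1)[OF s]]
    have f: "integrable lborel f" unfolding f_def using Fi Gi by simp
    have ff: "cmod (fourier f \<xi>) \<le> C1 * \<epsilon> powr \<delta> * (1 + norm \<xi>) powr (- d)" for \<xi>
      unfolding f_def fourier_diff[OF Fi Gi] Fs(2)[OF s] using diff[OF \<epsilon> _ _ hFeps[OF es s]] s by auto
    have ff2: "(cmod (fourier f \<xi>))\<^sup>2 \<le> (C1 * \<epsilon> powr \<delta>)\<^sup>2 * ((1 + norm \<xi>) powr (- d))\<^sup>2" for \<xi>
      unfolding power_mult_distrib[symmetric] by (intro power_mono ff) auto
    have [measurable]: "fourier f \<in> borel_measurable borel"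
      using continuous_on_fourier[OF f] by (rule borel_measurable_continuous_onI)
    have Qi: "integrable lborel (\<lambda>\<xi>::'a. (C1 * \<epsilon> powr \<delta>)\<^sup>2 * ((1 + norm \<xi>) powr (- d))\<^sup>2)"
      unfolding d_def by (intro integrable_mult_right integrable_decay)
    have f2: "integrable lborel (\<lambda>\<xi>. (cmod (fourier f \<xi>))\<^sup>2)"
      by (rule Bochner_Integration.integrable_bound[OF Qi])
         (measurable, intro AE_I2, use order_trans[OF ff2 abs_ge_self] in simp)
    have "(\<integral>\<xi>. (cmod (fourier f \<xi>))\<^sup>2 \<partial>lborel) \<le> (\<integral>\<xi>. (C1 * \<epsilon> powr \<delta>)\<^sup>2 * ((1 + norm \<xi>) powr (- d))\<^sup>2 \<partial>(lborel :: 'a measure))"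
      by (rule integral_mono[OF f2 Qi ff2])
    also have "\<dots> = C1\<^sup>2 * Q0 * (\<epsilon> powr \<delta>)\<^sup>2"
      by (simp add: Q0_def power_mult_distrib)
    finally have Q: "(\<integral>\<xi>. (cmod (fourier f \<xi>))\<^sup>2 \<partial>lborel) \<le> C1\<^sup>2 * Q0 * (\<epsilon> powr \<delta>)\<^sup>2" .
    \<comment> \<open>Solves R^(m + d/2) \<epsilon>^\<delta> = 1, so that the ball term R^(k + d/2)
      \<epsilon>^\<delta> and the tail term R^(k - m) both equal \<epsilon>^(\<theta>
      \<delta>).\<close>
    define R where "R = \<epsilon> powr (- (\<delta> / (m + d / 2)))"
    have "\<epsilon> powr 0 \<le> R" unfolding R_def using es \<delta> md by (intro powr_mono') auto
    then have R: "1 \<le> R" using \<epsilon> by simp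
    \<comment> \<open>Balances l \<epsilon>^(2 \<delta>) against R^d / l, which up to constants is
      the optimal parameter in the AM-GM form of duality.\<close>
    define l where "l = R powr (d / 2) / \<epsilon> powr \<delta>"
    have l: "0 < l" using R \<epsilon> by (simp add: l_def)
    define I where "I = (\<integral>x. indicator (cball 0 R) x * \<bar>f x\<bar> \<partial>lborel)"
    have Rd: "R ^ DIM('a) = R powr (d / 2) * R powr (d / 2)"
      using R by (simp add: d_def powr_add[symmetric] powr_realpow)
    have "2 * ?g\<^sup>2 * I \<le> l * (\<integral>\<xi>. (cmod (fourier f \<xi>))\<^sup>2 \<partial>lborel) + ?g\<^sup>2 / l * (unit_ball_vol d * (2 * R) ^ DIM('a))"
      unfolding I_def d_def using R by (intro ball_L1_le_fourier_L2[OF f f2 l]) simp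
    also have "\<dots> \<le> l * (C1\<^sup>2 * Q0 * (\<epsilon> powr \<delta>)\<^sup>2) + ?g\<^sup>2 / l * (unit_ball_vol d * (2 * R) ^ DIM('a))"
      using l Q by (intro add_right_mono mult_left_mono) auto
    also have "l * (C1\<^sup>2 * Q0 * (\<epsilon> powr \<delta>)\<^sup>2) = (C1\<^sup>2 * Q0) * (R powr (d / 2) * \<epsilon> powr \<delta>)"
      using \<epsilon> by (simp add: l_def power2_eq_square)
    also have "?g\<^sup>2 / l * (unit_ball_vol d * (2 * R) ^ DIM('a)) = (?g\<^sup>2 * V) * (R powr (d / 2) * \<epsilon> powr \<delta>)"
      using R \<epsilon> by (simp add: l_def V_def power_mult_distrib Rd)
    finally have "2 * ?g\<^sup>2 * I \<le> (C1\<^sup>2 * Q0 + ?g\<^sup>2 * V) * (R powr (d / 2) * \<epsilon> powr \<delta>)"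
      by (simp add: distrib_right)
    then have I: "I \<le> K * (R powr (d / 2) * \<epsilon> powr \<delta>)"
      using gauss_mass_pos[where 'a = 'a] by (simp add: K_def field_simps)
    have e1: "R powr k * (R powr (d / 2) * \<epsilon> powr \<delta>) = \<epsilon> powr (\<theta> * \<delta>)"
    proof -
      have "- (\<delta> / (m + d / 2)) * k + (- (\<delta> / (m + d / 2)) * (d / 2) + \<delta>) = \<theta> * \<delta>"
        using md unfolding \<theta>_def by (simp add: divide_simps) (simp add: algebra_simps)
      then show ?thesis by (simp only: R_def powr_powr powr_add[symmetric])
    qed
    have e2: "R powr (k - m) = \<epsilon> powr (\<theta> * \<delta>)"
    proof -
      have "- (\<delta> / (m + d / 2)) * (k - m) = \<theta> * \<delta>"
        using md unfolding \<theta>_def by (simp add: divide_simps) (simp add: algebra_simps)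
      then show ?thesis by (simp only: R_def powr_powr)
    qed
    have "L1k_norm k f \<le> ennreal (2 * R powr k * I) + ennreal (R powr (k - m)) * L1k_norm m f"
      unfolding I_def using hk R by (intro L1k_norm_interpolation[OF f]) auto
    also have "\<dots> \<le> ennreal (2 * K * \<epsilon> powr (\<theta> * \<delta>)) + ennreal (\<epsilon> powr (\<theta> * \<delta>)) * ennreal (2 * M)"
    proof (rule add_mono[OF ennreal_leI mult_mono])
      have "2 * R powr k * I \<le> 2 * R powr k * (K * (R powr (d / 2) * \<epsilon> powr \<delta>))"
        by (intro mult_left_mono I) auto
      also have "\<dots> = 2 * K * (R powr k * (R powr (d / 2) * \<epsilon> powr \<delta>))" by simp
      finally show "2 * R powr k * I \<le> 2 * K * \<epsilon> powr (\<theta> * \<delta>)" unfolding e1 .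
      show "L1k_norm m f \<le> ennreal (2 * M)" unfolding f_def by (rule mom[OF es s])
    qed (auto simp: e2)
    also have "\<dots> = ennreal ((2 * K + 2 * M) * \<epsilon> powr (\<theta> * \<delta>))"
      using K M by (simp add: ennreal_mult[symmetric] ennreal_plus[symmetric] algebra_simps del: ennreal_plus)
    finally show ?thesis unfolding f_def .
  qed
  \<comment> \<open>Away from \<epsilon> = 0 the target \<epsilon>^(\<theta> \<delta>) is at least
    \<open>\<epsilon>0\<close> to the same power, so the uniform moment bound is enough.\<close>
  have large: "L1k_norm k (\<lambda>x. Feps \<epsilon> s x - Fs s x) \<le> ennreal ((2 * M * \<epsilon>0 powr (- (\<theta> * \<delta>))) * \<epsilon> powr (\<theta> * \<delta>))"
    if es: "\<epsilon> \<in> {0<..1}" "s \<in> {1/2<..<1}" and \<epsilon>: "\<epsilon>0 \<le> \<epsilon>" for \<epsilon> s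
  proof -
    have "L1k_norm k (\<lambda>x. Feps \<epsilon> s x - Fs s x) \<le> L1k_norm m (\<lambda>x. Feps \<epsilon> s x - Fs s x)"
      using hk by (intro L1k_norm_mono) auto
    also have "\<dots> \<le> ennreal (2 * M)" by (rule mom[OF es])
    also have "\<dots> \<le> ennreal ((2 * M * \<epsilon>0 powr (- (\<theta> * \<delta>))) * \<epsilon> powr (\<theta> * \<delta>))"
    proof (rule ennreal_leI)
      have "\<epsilon>0 powr (\<theta> * \<delta>) \<le> \<epsilon> powr (\<theta> * \<delta>)" using \<epsilon>0 \<epsilon> \<theta> \<delta> by (intro powr_mono2) auto
      then have "1 \<le> \<epsilon>0 powr (- (\<theta> * \<delta>)) * \<epsilon> powr (\<theta> * \<delta>)"
        using \<epsilon>0 by (simp add: powr_minus field_simps)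
      then show "2 * M \<le> (2 * M * \<epsilon>0 powr (- (\<theta> * \<delta>))) * \<epsilon> powr (\<theta> * \<delta>)"
        using M mult_left_mono[of 1 "\<epsilon>0 powr (- (\<theta> * \<delta>)) * \<epsilon> powr (\<theta> * \<delta>)" "2 * M"] by (simp add: mult.assoc)
    qed
    finally show ?thesis .
  qed
  define C where "C = 2 * K + 2 * M + 2 * M * \<epsilon>0 powr (- (\<theta> * \<delta>))"
  have "L1k_norm k (\<lambda>x. Feps \<epsilon> s x - Fs s x) \<le> ennreal (C * \<epsilon> powr (\<theta> * \<delta>))"
    if es: "\<epsilon> \<in> {0<..1}" "s \<in> {1/2<..<1}" for \<epsilon> s
  proof (cases "\<epsilon> \<le> \<epsilon>0")
    case True
    have "L1k_norm k (\<lambda>x. Feps \<epsilon> s x - Fs s x) \<le> ennreal ((2 * K + 2 * M) * \<epsilon> powr (\<theta> * \<delta>))"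
      using small True es by auto
    also have "\<dots> \<le> ennreal (C * \<epsilon> powr (\<theta> * \<delta>))"
      unfolding C_def using M by (intro ennreal_leI mult_right_mono) auto
    finally show ?thesis .
  next
    case False
    have "L1k_norm k (\<lambda>x. Feps \<epsilon> s x - Fs s x) \<le> ennreal ((2 * M * \<epsilon>0 powr (- (\<theta> * \<delta>))) * \<epsilon> powr (\<theta> * \<delta>))"
      using large[OF es] False by simp
    also have "\<dots> \<le> ennreal (C * \<epsilon> powr (\<theta> * \<delta>))"
      unfolding C_def using M K by (intro ennreal_leI mult_right_mono) auto
    finally show ?thesis .
  qed
  then show ?thesis unfolding \<theta>_def d_def by blast
qed

end
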